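(* Consider the class of equations $$f(x)u_{tt}=(g(x)H(u)u_x)_x+h(x)K(u)u_x$$ for $u=u(t,x)$, with arbitrary elements $f,g,h,H,K$ (smooth real-valued functions of the indicated variables, $f(x)g(x)H(u)\neq0$, $(H_u,K_u)\neq(0,0)$). The usual equivalence transformation group $G^{\sim}$ of this class consists of the transformations $$\tilde t=\delta_1t+\delta_2,\quad \tilde x=X(x),\quad \tilde u=\delta_3u+\delta_4,$$ $$\tilde f=\frac{\epsilon_1\delta_1^2}{X_x}f,\quad \tilde g=\epsilon_1\epsilon_2^{-1}X_x\,g,\quad \tilde h=\epsilon_1\epsilon_3^{-1}h,\quad \tilde H=\epsilon_2H,\quad \tilde K=\epsilon_3K,$$ where $\delta_j$ $(j=1,\ldots,4)$ and $\epsilon_i$ $(i=1,2,3)$ are arbitrary constants with $\delta_1\delta_3\epsilon_1\epsilon_2\epsilon_3\neq0$, and $X$ is an arbitrary smooth function of $x$ with $X_x\neq0$.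
   Context: The usual equivalence group $G^{\sim}$ of the class is the group of nondegenerate point transformations in the space of $(t,x,u,f,g,h,H,K)$ which are projectible on the space of $(t,x,u)$, i.e. of the form $(\tilde t,\tilde x,\tilde u)=(T^t,T^x,T^u)(t,x,u)$ and $(\tilde f,\tilde g,\tilde h,\tilde H,\tilde K)=(T^f,T^g,T^h,T^H,T^K)(t,x,u,f,g,h,H,K)$, and which transform every equation of the class for $u=u(t,x)$ with arbitrary elements $(f,g,h,H,K)$ to an equation of the same class for $\tilde u=\tilde u(\tilde t,\tilde x)$ with arbitrary elements $(\tilde f,\tilde g,\tilde h,\tilde H,\tilde K)$, where $\tilde f,\tilde g,\tilde h$ are functions of $\tilde x$ and $\tilde H,\tilde K$ are functions of $\tilde u$. *)

theory Defs
  imports "HOL-Analysis.Analysis"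
begin

text \<open>Smoothness on an open set: Frechet derivatives of all orders exist and are continuous.\<close>

fun Ck_on :: "nat \<Rightarrow> 'a::real_normed_vector set \<Rightarrow> ('a \<Rightarrow> 'b::real_normed_vector) \<Rightarrow> bool" where
  "Ck_on 0 S F \<longleftrightarrow> continuous_on S F"
| "Ck_on (Suc k) S F \<longleftrightarrow>
     (\<forall>p\<in>S. F differentiable (at p)) \<and> (\<forall>v. Ck_on k S (\<lambda>p. frechet_derivative F (at p) v))"

definition smooth_on :: "'a::real_normed_vector set \<Rightarrow> ('a \<Rightarrow> 'b::real_normed_vector) \<Rightarrow> bool" where
  "smooth_on S F \<longleftrightarrow> (\<forall>k. Ck_on k S F)"

definition open_interval :: "real set \<Rightarrow> bool" where
  "open_interval I \<longleftrightarrow> open I \<and> is_interval I \<and> I \<noteq> {}"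

type_synonym txu = "real \<times> real \<times> real"

text \<open>Values \<open>(f, g, h, H, K)\<close> of the arbitrary elements at a point, and the arbitrary elements
  themselves, in the same order.\<close>

type_synonym elem_vals = "real \<times> real \<times> real \<times> real \<times> real"
type_synonym elems =
  "(real \<Rightarrow> real) \<times> (real \<Rightarrow> real) \<times> (real \<Rightarrow> real) \<times> (real \<Rightarrow> real) \<times> (real \<Rightarrow> real)"

fun vals_at :: "elems \<Rightarrow> txu \<Rightarrow> elem_vals" where
  "vals_at (f, g, h, H, K) (t, x, u) = (f x, g x, h x, H u, K u)"

text \<open>Arbitrary elements with \<open>x\<close> ranging over \<open>Ix\<close> and \<open>u\<close> over \<open>Iu\<close>. The product \<open>f g H\<close>
  vanishes nowhere; \<open>(H\<^sub>u, K\<^sub>u) \<noteq> (0, 0)\<close> is an inequality between functions (it excludes the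
  linear equations), so it is required at some point only.\<close>

fun admissible :: "real set \<Rightarrow> real set \<Rightarrow> elems \<Rightarrow> bool" where
  "admissible Ix Iu (f, g, h, H, K) \<longleftrightarrow>
     smooth_on Ix f \<and> smooth_on Ix g \<and> smooth_on Ix h \<and> smooth_on Iu H \<and> smooth_on Iu K \<and>
     (\<forall>x\<in>Ix. \<forall>u\<in>Iu. f x * g x * H u \<noteq> 0) \<and>
     (\<exists>u\<in>Iu. (deriv H u, deriv K u) \<noteq> (0, 0))"

fun equation_holds :: "elems \<Rightarrow> (real \<times> real \<Rightarrow> real) \<Rightarrow> real \<times> real \<Rightarrow> bool" where
  "equation_holds (f, g, h, H, K) w (t, x) \<longleftrightarrow>
     f x * deriv (\<lambda>s. deriv (\<lambda>r. w (r, x)) s) t =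
     deriv (\<lambda>y. g y * H (w (t, y)) * deriv (\<lambda>z. w (t, z)) y) x
       + h x * K (w (t, x)) * deriv (\<lambda>z. w (t, z)) x"

definition graph_on :: "(real \<times> real) set \<Rightarrow> (real \<times> real \<Rightarrow> real) \<Rightarrow> txu set" where
  "graph_on W w = (\<lambda>(t, x). (t, x, w (t, x))) ` W"

text \<open>The change of variables \<open>\<Phi>\<close> turns the equation with elements \<open>\<theta>\<close> into the one with
  elements \<open>\<theta>'\<close>, as differential equations rather than merely as solution sets: \<open>w\<close> and \<open>w'\<close> are
  arbitrary smooth functions, not necessarily solutions, whose graphs correspond under \<open>\<Phi>\<close>,
  and the equations for \<open>w\<close> and \<open>w'\<close> are equivalent at each pair of corresponding points.
  Equivalently, the second prolongation of \<open>\<Phi>\<close> matches the two submanifolds of the jet space.\<close>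

definition transforms_equation :: "txu set \<Rightarrow> (txu \<Rightarrow> txu) \<Rightarrow> elems \<Rightarrow> elems \<Rightarrow> bool" where
  "transforms_equation B \<Phi> \<theta> \<theta>' \<longleftrightarrow>
     (\<forall>W w W' w'.
        open W \<and> smooth_on W w \<and> graph_on W w \<subseteq> B \<and>
        open W' \<and> smooth_on W' w' \<and> \<Phi> ` graph_on W w = graph_on W' w' \<longrightarrow>
        (\<forall>(t, x)\<in>W. \<forall>t' x' u'. \<Phi> (t, x, w (t, x)) = (t', x', u') \<longrightarrow>
           (equation_holds \<theta> w (t, x) \<longleftrightarrow> equation_holds \<theta>' w' (t', x'))))"

text \<open>The usual equivalence group over the box \<open>It \<times> Ix \<times> Iu\<close>. Point transformations are local in
  \<open>(t, x, u)\<close>: the box is arbitrary and need not be mapped onto itself, so the transformations for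
  varying boxes form a pseudogroup under composition. In \<open>(f, g, h, H, K)\<close> a transformation is
  defined on the entire space, also where \<open>f g H = 0\<close>. Its values off the domain are irrelevant.
  Nondegeneracy means that the Jacobian is invertible everywhere on the domain.
  The map \<open>\<Phi>\<close> is the projection of \<open>T\<close> to the space of \<open>(t, x, u)\<close>; the transformed elements are
  functions on the ranges of the new \<open>x\<close> and of the new \<open>u\<close>.\<close>

definition usual_equivalence_group ::
  "real set \<Rightarrow> real set \<Rightarrow> real set \<Rightarrow> (txu \<times> elem_vals \<Rightarrow> txu \<times> elem_vals) set" where
  "usual_equivalence_group It Ix Iu =
     {T. let B = It \<times> Ix \<times> Iu; D = B \<times> (UNIV :: elem_vals set) in
       smooth_on D T \<and>
       (\<forall>p\<in>D. bij (frechet_derivative T (at p))) \<and>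
       (\<exists>\<Phi>. (\<forall>z\<in>B. \<forall>a. fst (T (z, a)) = \<Phi> z) \<and>
         (\<forall>\<theta>. admissible Ix Iu \<theta> \<longrightarrow>
           (\<exists>\<theta>'. admissible ((\<lambda>(t, x, u). x) ` \<Phi> ` B) ((\<lambda>(t, x, u). u) ` \<Phi> ` B) \<theta>' \<and>
             (\<forall>z\<in>B. snd (T (z, vals_at \<theta> z)) = vals_at \<theta>' (\<Phi> z)) \<and>
             transforms_equation B \<Phi> \<theta> \<theta>')))}"

end

theory Submission
  imports Defs
begin

text \<open>For an equivalence transformation with \<open>(t, x, u)\<close>-part \<open>(P, Q, R)\<close>, fix a point and a first-order
  jet there. Both equations are affine conditions on the second-order jet, so their coefficients are
  proportional. The mixed coefficient, polynomial in the first-order jet, forces \<open>P\<^sub>u = Q\<^sub>u = 0\<close>;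
  varying \<open>g H\<close> leaves \<open>P\<^sub>x = Q\<^sub>t = 0\<close> or \<open>P\<^sub>t = Q\<^sub>x = 0\<close>, and the second case would give
  \<open>R\<^sub>u\<^sub>u / R\<^sub>u = H\<^sub>u / H\<close> for every \<open>H\<close>. The lower-order coefficients then make \<open>P\<close> and \<open>R\<close> affine in \<open>t\<close>
  and \<open>u\<close>, and with \<open>m = f' X\<^sub>x / (f \<delta>1\<^sup>2)\<close> what remains is that \<open>H' / H\<close> is constant and
  \<open>h' K' = m h K - m\<^sub>x g H\<close>. Since the left-hand side depends on the values, not on the derivatives, of
  the arbitrary elements, \<open>m\<close> depends on \<open>x\<close> only, and the rank-one form of \<open>h' K'\<close> forces \<open>m\<^sub>x = 0\<close>.\<close>

section \<open>Smooth maps between normed spaces\<close>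

text \<open>Every \<open>\<theta>\<close> has some \<open>\<theta>'\<close>, chosen anew for each
  \<open>\<theta>\<close>, so a constant read off from one pair is a constant of that pair only.
  What connects different pairs is that the new elements are values of one smooth map
  \<open>T\<close>. The connection is made by differentiation: values and slopes of arbitrary
  elements at a point are independent, so an expression in the components of \<open>T\<close> that
  is constant along every choice of elements has zero derivative in all directions of the space of
  (t, x, u, f, g, h, H, K). The test elements have to be free of zeros on the whole interval, with
  prescribed value and slope at one point, which quadratic polynomials achieve. They keep their
  sign, so this argument gives constants on each orthant of values separately; the orthants are then
  joined by continuity of \<open>T\<close> across the coordinate planes, where the equations
  themselves may say nothing because f g H vanishes.\<close>

definition dd :: "'a::real_normed_vector \<Rightarrow> ('a \<Rightarrow> 'b::real_normed_vector) \<Rightarrow> 'a \<Rightarrow> 'b" where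
  "dd v F = (\<lambda>p. frechet_derivative F (at p) v)"

lemma dd_eqI: "(F has_derivative F') (at p) \<Longrightarrow> dd v F p = F' v"
  unfolding dd_def using frechet_derivative_at by metis

lemma Ck_on_SucD: "Ck_on (Suc k) S F \<Longrightarrow> Ck_on k S F"
proof (induction k arbitrary: F)
  case 0
  then show ?case
    by (auto intro!: continuous_at_imp_continuous_on differentiable_imp_continuous_within)
next
  case (Suc k)
  show ?case
    unfolding Ck_on.simps(2)[of k]
  proof (intro conjI allI)
    show "\<forall>p\<in>S. F differentiable (at p)"
      using Suc.prems by simp
    show "Ck_on k S (\<lambda>p. frechet_derivative F (at p) v)" for v
      using Suc.prems by (intro Suc.IH) (simp only: Ck_on.simps(2)[of "Suc k"])
  qed
qed

lemma Ck_on_cong: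
  assumes "open S" "\<And>p. p \<in> S \<Longrightarrow> F p = G p"
  shows "Ck_on k S F \<longleftrightarrow> Ck_on k S G"
  using assms(2)
proof (induction k arbitrary: F G)
  case 0
  then show ?case
    by (auto intro: continuous_on_eq)
next
  case (Suc k)
  have hd: "(F has_derivative L) (at p) \<longleftrightarrow> (G has_derivative L) (at p)" if "p \<in> S" for p L
    using has_derivative_transform_within_open[OF _ \<open>open S\<close> that] Suc.prems by metis
  have "F differentiable (at p) \<longleftrightarrow> G differentiable (at p)" if "p \<in> S" for p
    unfolding differentiable_def using hd[OF that] by simp
  moreover have "frechet_derivative F (at p) v = frechet_derivative G (at p) v" if "p \<in> S" for p v
    unfolding frechet_derivative_def using hd[OF that] by simp
  ultimately show ?case
    using Suc.IH[of "\<lambda>p. frechet_derivative F (at p) v" "\<lambda>p. frechet_derivative G (at p) v" for v] by simp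
qed

text \<open>Working rule for the closure properties below: by uniqueness of derivatives any
  pointwise derivative \<open>F'\<close> may replace \<open>frechet_derivative\<close>, and
  \<open>Ck_on_cong\<close> carries this equality on the open set \<open>S\<close> through the
  recursion.\<close>

lemma Ck_on_SucI:
  assumes "open S" "\<And>p. p \<in> S \<Longrightarrow> (F has_derivative F' p) (at p)"
    and "\<And>v. Ck_on k S (\<lambda>p. F' p v)"
  shows "Ck_on (Suc k) S F"
proof -
  have "frechet_derivative F (at p) v = F' p v" if "p \<in> S" for p v
    using assms(2)[OF that] frechet_derivative_at by metis
  then show ?thesis
    using assms Ck_on_cong[OF \<open>open S\<close>, of "\<lambda>p. frechet_derivative F (at p) v" "\<lambda>p. F' p v" for v]
    by (auto simp: differentiable_def)
qed

lemma Ck_on_SucE: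
  assumes "Ck_on (Suc k) S F"
  shows "p \<in> S \<Longrightarrow> (F has_derivative (\<lambda>v. dd v F p)) (at p)" and "Ck_on k S (dd v F)"
  using assms unfolding dd_def by (auto simp: frechet_derivative_works)

lemma Ck_on_subset: "Ck_on k S F \<Longrightarrow> U \<subseteq> S \<Longrightarrow> Ck_on k U F"
  by (induction k arbitrary: F) (auto intro: continuous_on_subset)

lemma Ck_on_const: "open S \<Longrightarrow> Ck_on k S (\<lambda>p. c)"
proof (induction k arbitrary: c)
  case (Suc k)
  show ?case
    by (rule Ck_on_SucI[where F' = "\<lambda>p v. 0"]) (use Suc in auto)
qed simp

lemma Ck_on_bounded_linear:
  assumes "open S" "bounded_linear L"
  shows "Ck_on k S F \<Longrightarrow> Ck_on k S (\<lambda>p. L (F p))"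
proof (induction k arbitrary: F)
  case 0
  then show ?case
    using bounded_linear.continuous_on[OF assms(2)] by simp
next
  case (Suc k)
  note F = Ck_on_SucE[OF Suc.prems]
  show ?case
    by (rule Ck_on_SucI[where F' = "\<lambda>p v. L (dd v F p)", OF assms(1)
          bounded_linear.has_derivative[OF assms(2) F(1)] Suc.IH[OF F(2)]])
qed

lemma Ck_on_ident: "open S \<Longrightarrow> Ck_on k S (\<lambda>p. p)"
  by (cases k) (auto intro!: Ck_on_SucI[where F' = "\<lambda>p v. v"] Ck_on_const)

lemma Ck_on_add:
  assumes "open S"
  shows "Ck_on k S F \<Longrightarrow> Ck_on k S G \<Longrightarrow> Ck_on k S (\<lambda>p. F p + G p)"
proof (induction k arbitrary: F G)
  case 0
  then show ?case
    by (simp add: continuous_on_add)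
next
  case (Suc k)
  note F = Ck_on_SucE[OF Suc.prems(1)] and G = Ck_on_SucE[OF Suc.prems(2)]
  show ?case
    by (rule Ck_on_SucI[where F' = "\<lambda>p v. dd v F p + dd v G p", OF assms
          has_derivative_add[OF F(1) G(1)] Suc.IH[OF F(2) G(2)]])
qed

lemma Ck_on_sum:
  assumes "open S" "\<And>i. i \<in> I \<Longrightarrow> Ck_on k S (F i)"
  shows "Ck_on k S (\<lambda>p. \<Sum>i\<in>I. F i p)"
  using assms(2) by (induction I rule: infinite_finite_induct)
    (auto intro: Ck_on_const Ck_on_add assms(1))

lemma Ck_on_bilinear:
  assumes "open S" "bounded_bilinear B"
  shows "Ck_on k S F \<Longrightarrow> Ck_on k S G \<Longrightarrow> Ck_on k S (\<lambda>p. B (F p) (G p))"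
proof (induction k arbitrary: F G)
  case 0
  then show ?case
    using bounded_bilinear.continuous_on[OF assms(2)] by simp
next
  case (Suc k)
  note F = Ck_on_SucE[OF Suc.prems(1)] and G = Ck_on_SucE[OF Suc.prems(2)]
  show ?case
  proof (rule Ck_on_SucI[where F' = "\<lambda>p v. B (F p) (dd v G p) + B (dd v F p) (G p)"])
    show "((\<lambda>p. B (F p) (G p)) has_derivative
        (\<lambda>v. B (F p) (dd v G p) + B (dd v F p) (G p))) (at p)" if "p \<in> S" for p
      using bounded_bilinear.FDERIV[OF assms(2) F(1)[OF that] G(1)[OF that]] .
  next
    fix v
    show "Ck_on k S (\<lambda>p. B (F p) (dd v G p) + B (dd v F p) (G p))"
      by (intro Ck_on_add Suc.IH F G Ck_on_SucD[OF Suc.prems(1)] Ck_on_SucD[OF Suc.prems(2)] assms(1))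
  qed fact
qed

text \<open>The chain rule gives the derivative \<open>dd (dd v G p) F (G p)\<close>, whose
  direction moves with \<open>p\<close>, whereas the induction hypothesis speaks of fixed
  directions. Expanding the direction in the basis of the Euclidean space leaves only the
  \<open>dd b F\<close>, with coefficients that are linear in \<open>dd v G p\<close>.\<close>

lemma Ck_on_compose:
  fixes G :: "'a::real_normed_vector \<Rightarrow> 'b::euclidean_space"
  assumes "open S" "open U" "G ` U \<subseteq> S"
  shows "Ck_on k S F \<Longrightarrow> Ck_on k U G \<Longrightarrow> Ck_on k U (\<lambda>p. F (G p))"
proof (induction k arbitrary: F)
  case 0
  then show ?case
    using continuous_on_compose2[of S F U G] assms(3) by simp
next
  case (Suc k)
  note F = Ck_on_SucE[OF Suc.prems(1)] and G = Ck_on_SucE[OF Suc.prems(2)]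
  have exp: "dd y F q = (\<Sum>b\<in>Basis. (y \<bullet> b) *\<^sub>R dd b F q)" if "q \<in> S" for q y
  proof -
    interpret L: linear "\<lambda>v. dd v F q"
      using F(1)[OF that] by (rule has_derivative_linear)
    show ?thesis
      by (subst (1) euclidean_representation[symmetric]) (simp only: L.sum L.scaleR)
  qed
  show ?case
  proof (rule Ck_on_SucI[where F' = "\<lambda>p v. \<Sum>b\<in>Basis. (dd v G p \<bullet> b) *\<^sub>R dd b F (G p)"])
    fix p assume p: "p \<in> U"
    then have q: "G p \<in> S"
      using assms(3) by auto
    have "((\<lambda>p. F (G p)) has_derivative (\<lambda>v. dd (dd v G p) F (G p))) (at p)"
      using diff_chain_at[OF G(1)[OF p] F(1)[OF q]] by (simp add: comp_def)
    then show "((\<lambda>p. F (G p)) has_derivative (\<lambda>v. \<Sum>b\<in>Basis. (dd v G p \<bullet> b) *\<^sub>R dd b F (G p))) (at p)"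
      by (simp add: exp[OF q, symmetric])
  next
    fix v
    show "Ck_on k U (\<lambda>p. \<Sum>b\<in>Basis. (dd v G p \<bullet> b) *\<^sub>R dd b F (G p))"
      by (intro Ck_on_sum Ck_on_bilinear[OF _ bounded_bilinear_scaleR]
          Ck_on_bounded_linear[OF _ bounded_linear_inner_left] Suc.IH F G Ck_on_SucD[OF Suc.prems(2)]
          \<open>open U\<close>)
  qed fact
qed

lemma Ck_on_mult:
  fixes F G :: "'a::real_normed_vector \<Rightarrow> real"
  shows "open S \<Longrightarrow> Ck_on k S F \<Longrightarrow> Ck_on k S G \<Longrightarrow> Ck_on k S (\<lambda>p. F p * G p)"
  using Ck_on_bilinear[OF _ bounded_bilinear_mult] .

lemma Ck_on_inverse:
  fixes F :: "'a::real_normed_vector \<Rightarrow> real"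
  assumes "open S" "\<And>p. p \<in> S \<Longrightarrow> F p \<noteq> 0"
  shows "Ck_on k S F \<Longrightarrow> Ck_on k S (\<lambda>p. inverse (F p))"
proof (induction k)
  case 0
  then show ?case
    using assms by (auto intro: continuous_on_inverse)
next
  case (Suc k)
  note F = Ck_on_SucE[OF Suc.prems]
  have I: "Ck_on k S (\<lambda>p. inverse (F p))"
    by (rule Suc.IH[OF Ck_on_SucD[OF Suc.prems]])
  show ?case
  proof (rule Ck_on_SucI[where F' = "\<lambda>p v. - 1 * (inverse (F p) * dd v F p * inverse (F p))"])
    show "((\<lambda>p. inverse (F p)) has_derivative (\<lambda>v. - 1 * (inverse (F p) * dd v F p * inverse (F p)))) (at p)"
      if "p \<in> S" for p
      using Deriv.has_derivative_inverse[OF assms(2)[OF that] F(1)[OF that]] by simp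
    show "Ck_on k S (\<lambda>p. - 1 * (inverse (F p) * dd v F p * inverse (F p)))" for v
      by (intro Ck_on_mult Ck_on_const I F \<open>open S\<close>)
  qed fact
qed

lemma Ck_on_Pair:
  assumes "open S" 
  shows "Ck_on k S F \<Longrightarrow> Ck_on k S G \<Longrightarrow> Ck_on k S (\<lambda>p. (F p, G p))"
proof (induction k arbitrary: F G)
  case 0
  then show ?case
    by (simp add: continuous_on_Pair)
next
  case (Suc k)
  note F = Ck_on_SucE[OF Suc.prems(1)] and G = Ck_on_SucE[OF Suc.prems(2)]
  show ?case
    by (rule Ck_on_SucI[where F' = "\<lambda>p v. (dd v F p, dd v G p)", OF assms
          has_derivative_Pair[OF F(1) G(1)] Suc.IH[OF F(2) G(2)]])
qed

text \<open>Inverse functions satisfy a first-order system \<open>G' = E \<circ> G\<close> of this form.\<close>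

lemma smooth_on_of_derivative_comp:
  fixes G :: "'a::real_normed_vector \<Rightarrow> 'b::euclidean_space"
  assumes "open S" "open U" "G ` U \<subseteq> S"
    and "\<And>v. smooth_on S (\<lambda>p. E p v)"
    and "\<And>p. p \<in> U \<Longrightarrow> (G has_derivative E (G p)) (at p)"
  shows "smooth_on U G"
proof -
  have "Ck_on k U G" for k
  proof (induction k)
    case 0
    show ?case
      using assms(5) by (auto intro!: continuous_at_imp_continuous_on has_derivative_continuous)
  next
    case (Suc k)
    show ?case
      by (rule Ck_on_SucI[where F' = "\<lambda>p. E (G p)"])
        (use assms Suc in \<open>auto simp: smooth_on_def intro: Ck_on_compose\<close>)
  qed
  then show ?thesis
    by (simp add: smooth_on_def)
qed

lemma smooth_on_has_derivative: "smooth_on S F \<Longrightarrow> p \<in> S \<Longrightarrow> (F has_derivative (\<lambda>v. dd v F p)) (at p)"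
  using Ck_on_SucE(1)[of 0 S F p] unfolding smooth_on_def by (simp del: Ck_on.simps)

lemma smooth_on_dd: "smooth_on S F \<Longrightarrow> smooth_on S (dd v F)"
  using Ck_on_SucE(2)[of _ S F v] unfolding smooth_on_def by (simp del: Ck_on.simps)

lemma smooth_on_subset: "smooth_on S F \<Longrightarrow> U \<subseteq> S \<Longrightarrow> smooth_on U F"
  unfolding smooth_on_def using Ck_on_subset[of _ S F U] by simp

lemma smooth_on_cong: "open S \<Longrightarrow> (\<And>p. p \<in> S \<Longrightarrow> F p = G p) \<Longrightarrow> smooth_on S F \<longleftrightarrow> smooth_on S G"
  unfolding smooth_on_def using Ck_on_cong[of S F G] by simp

lemma smooth_on_compose:
  fixes G :: "'a::real_normed_vector \<Rightarrow> 'b::euclidean_space"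
  shows "smooth_on S F \<Longrightarrow> smooth_on U G \<Longrightarrow> open S \<Longrightarrow> open U \<Longrightarrow> G ` U \<subseteq> S \<Longrightarrow>
    smooth_on U (\<lambda>p. F (G p))"
  unfolding smooth_on_def using Ck_on_compose[of S U G _ F] by metis

lemma smooth_on_const: "open S \<Longrightarrow> smooth_on S (\<lambda>p. c)"
  unfolding smooth_on_def by (simp add: Ck_on_const)

lemma smooth_on_ident: "open S \<Longrightarrow> smooth_on S (\<lambda>p. p)"
  unfolding smooth_on_def by (simp add: Ck_on_ident)

lemma smooth_on_bounded_linear:
  "bounded_linear L \<Longrightarrow> smooth_on S F \<Longrightarrow> open S \<Longrightarrow> smooth_on S (\<lambda>p. L (F p))"
  unfolding smooth_on_def using Ck_on_bounded_linear[of S L _ F] by metis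

lemma smooth_on_fst: "smooth_on S F \<Longrightarrow> open S \<Longrightarrow> smooth_on S (\<lambda>p. fst (F p))"
  using smooth_on_bounded_linear[of fst S F] bounded_linear_fst by metis

lemma smooth_on_snd: "smooth_on S F \<Longrightarrow> open S \<Longrightarrow> smooth_on S (\<lambda>p. snd (F p))"
  using smooth_on_bounded_linear[of snd S F] bounded_linear_snd by metis

lemma smooth_on_add:
  "smooth_on S F \<Longrightarrow> smooth_on S G \<Longrightarrow> open S \<Longrightarrow> smooth_on S (\<lambda>p. F p + G p)"
  unfolding smooth_on_def using Ck_on_add[of S _ F G] by metis

lemma smooth_on_minus: "smooth_on S F \<Longrightarrow> open S \<Longrightarrow> smooth_on S (\<lambda>p. - F p)"
  using smooth_on_bounded_linear[of uminus S F] bounded_linear_minus[OF bounded_linear_ident] by metis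

lemma smooth_on_diff:
  "smooth_on S F \<Longrightarrow> smooth_on S G \<Longrightarrow> open S \<Longrightarrow> smooth_on S (\<lambda>p. F p - G p)"
  using smooth_on_add[of S F "\<lambda>p. - G p"] smooth_on_minus[of S G] by simp

lemma smooth_on_mult:
  fixes F G :: "'a::real_normed_vector \<Rightarrow> real"
  shows "smooth_on S F \<Longrightarrow> smooth_on S G \<Longrightarrow> open S \<Longrightarrow> smooth_on S (\<lambda>p. F p * G p)"
  unfolding smooth_on_def using Ck_on_mult[of S _ F G] by metis

lemma smooth_on_power:
  fixes F :: "'a::real_normed_vector \<Rightarrow> real"
  shows "smooth_on S F \<Longrightarrow> open S \<Longrightarrow> smooth_on S (\<lambda>p. F p ^ n)"
proof (induction n)
  case 0
  then show ?case
    using smooth_on_const[of S 1] by simp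
next
  case (Suc n)
  then show ?case
    using smooth_on_mult[of S F "\<lambda>p. F p ^ n"] by simp
qed

lemma smooth_on_inverse:
  fixes F :: "'a::real_normed_vector \<Rightarrow> real"
  shows "smooth_on S F \<Longrightarrow> open S \<Longrightarrow> (\<And>p. p \<in> S \<Longrightarrow> F p \<noteq> 0) \<Longrightarrow> smooth_on S (\<lambda>p. inverse (F p))"
  unfolding smooth_on_def using Ck_on_inverse[of S F] by metis

lemma smooth_on_divide:
  fixes F G :: "'a::real_normed_vector \<Rightarrow> real"
  assumes "smooth_on S F" "smooth_on S G" "open S" "\<And>p. p \<in> S \<Longrightarrow> G p \<noteq> 0"
  shows "smooth_on S (\<lambda>p. F p / G p)"
  using smooth_on_mult[OF assms(1) smooth_on_inverse[OF assms(2-4)] assms(3)]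
  by (simp add: divide_inverse)

lemma smooth_on_Pair:
  "smooth_on S F \<Longrightarrow> smooth_on S G \<Longrightarrow> open S \<Longrightarrow> smooth_on S (\<lambda>p. (F p, G p))"
  unfolding smooth_on_def using Ck_on_Pair[of S _ F G] by metis

lemmas smooth_on_intros = smooth_on_const smooth_on_ident smooth_on_fst smooth_on_snd
  smooth_on_add smooth_on_minus smooth_on_diff smooth_on_mult smooth_on_power smooth_on_Pair

section \<open>Derivatives of real functions and derivatives along curves\<close>

lemma smooth_on_DERIV:
  fixes F :: "real \<Rightarrow> real"
  assumes "smooth_on S F" "x \<in> S"
  shows "(F has_real_derivative deriv F x) (at x)"
proof -
  interpret L: linear "\<lambda>v. dd v F x"
    using smooth_on_has_derivative[OF assms] by (rule has_derivative_linear)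
  have "dd v F x = dd 1 F x * v" for v
    using L.scale[of v 1] by (simp only: real_scaleR_def mult_1_right mult_1_left mult.commute)
  then have "(\<lambda>v. dd v F x) = (*) (dd 1 F x)"
    by (rule ext)
  then have "(F has_real_derivative dd 1 F x) (at x)"
    unfolding has_field_derivative_def using smooth_on_has_derivative[OF assms] by metis
  then show ?thesis
    using DERIV_imp_deriv by force
qed

lemma smooth_on_deriv:
  fixes F :: "real \<Rightarrow> real"
  assumes "smooth_on S F" "open S"
  shows "smooth_on S (deriv F)"
proof -
  have "dd 1 F x = deriv F x" if "x \<in> S" for x
    using smooth_on_DERIV[OF assms(1) that] dd_eqI[of F "(*) (deriv F x)" x 1]
    unfolding has_field_derivative_def by simp
  then show ?thesis
    using smooth_on_dd[OF assms(1), of 1] smooth_on_cong[OF assms(2)] by blast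
qed

lemma smooth_on_continuous_on: "smooth_on S F \<Longrightarrow> continuous_on S F"
  unfolding smooth_on_def by (metis Ck_on.simps(1))

lemma smooth_on_along_curve:
  fixes F :: "'a::euclidean_space \<Rightarrow> real"
  assumes F: "smooth_on S F" and opens: "open S" "open J" and curve: "\<forall>s\<in>J. (c has_vector_derivative c' s) (at s) \<and> c s \<in> S"
  shows "s \<in> J \<Longrightarrow> ((\<lambda>s. F (c s)) has_real_derivative dd (c' s) F (c s)) (at s)"
    and "s \<in> J \<Longrightarrow> (c' has_vector_derivative c'') (at s) \<Longrightarrow>
      ((\<lambda>s. dd (c' s) F (c s)) has_real_derivative dd (c' s) (dd (c' s) F) (c s) + dd c'' F (c s)) (at s)"
proof -
  have c: "(c has_vector_derivative c' s) (at s)" and S: "c s \<in> S" if "s \<in> J" for s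
    using curve that by auto
  have lin: "linear (\<lambda>v. dd v F p)" if "p \<in> S" for p
    using smooth_on_has_derivative[OF F that] by (rule has_derivative_linear)
  have exp: "dd y F p = (\<Sum>b\<in>Basis. (y \<bullet> b) * dd b F p)" if "p \<in> S" for p y
  proof -
    interpret L: linear "\<lambda>v. dd v F p"
      by (rule lin[OF that])
    show ?thesis
      by (subst (1) euclidean_representation[symmetric]) (simp only: L.sum L.scaleR real_scaleR_def)
  qed
  have chain: "((\<lambda>s. G (c s)) has_real_derivative dd (c' s) G (c s)) (at s)"
    if "smooth_on S G" "s \<in> J" for G :: "'a \<Rightarrow> real" and s
  proof -
    have "((\<lambda>s. G (c s)) has_derivative (\<lambda>h. dd (h *\<^sub>R c' s) G (c s))) (at s)"
      using diff_chain_at[OF c[OF that(2), unfolded has_vector_derivative_def]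
          smooth_on_has_derivative[OF that(1) S[OF that(2)]]] by (simp add: comp_def)
    moreover have "dd (h *\<^sub>R c' s) G (c s) = dd (c' s) G (c s) * h" for h
      using linear_scale[OF has_derivative_linear[OF smooth_on_has_derivative[OF that(1) S[OF that(2)]]]]
      by (simp only: real_scaleR_def mult.commute)
    ultimately show ?thesis
      by (simp add: has_field_derivative_def)
  qed
  show "((\<lambda>s. F (c s)) has_real_derivative dd (c' s) F (c s)) (at s)" if "s \<in> J"
    by (rule chain[OF F that])
  show "((\<lambda>s. dd (c' s) F (c s)) has_real_derivative dd (c' s) (dd (c' s) F) (c s) + dd c'' F (c s)) (at s)"
    if s: "s \<in> J" and c'': "(c' has_vector_derivative c'') (at s)"
  proof -
    have exp2: "dd v (dd y F) p = (\<Sum>b\<in>Basis. (y \<bullet> b) * dd v (dd b F) p)" if p: "p \<in> S" for p y v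
    proof (rule dd_eqI[where F' = "\<lambda>v. \<Sum>b\<in>Basis. (y \<bullet> b) * dd v (dd b F) p"])
      have "((\<lambda>q. \<Sum>b\<in>Basis. (y \<bullet> b) * dd b F q) has_derivative
          (\<lambda>v. \<Sum>b\<in>Basis. (y \<bullet> b) * dd v (dd b F) p)) (at p)"
        by (intro has_derivative_sum has_derivative_mult_right
            smooth_on_has_derivative[OF smooth_on_dd[OF F] p])
      then show "(dd y F has_derivative (\<lambda>v. \<Sum>b\<in>Basis. (y \<bullet> b) * dd v (dd b F) p)) (at p)"
        by (rule has_derivative_transform_within_open[OF _ opens(1) p]) (simp only: exp[symmetric])
    qed
    have "((\<lambda>s. \<Sum>b\<in>Basis. (c' s \<bullet> b) * dd b F (c s)) has_real_derivative
        (\<Sum>b\<in>Basis. (c'' \<bullet> b) * dd b F (c s) + dd (c' s) (dd b F) (c s) * (c' s \<bullet> b))) (at s)"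
    proof (intro DERIV_sum DERIV_mult chain smooth_on_dd F s)
      show "((\<lambda>s. c' s \<bullet> b) has_real_derivative c'' \<bullet> b) (at s)" for b
        using bounded_linear.has_vector_derivative[OF bounded_linear_inner_left c'']
        by (simp add: has_real_derivative_iff_has_vector_derivative)
    qed
    also have "(\<Sum>b\<in>Basis. (c'' \<bullet> b) * dd b F (c s) + dd (c' s) (dd b F) (c s) * (c' s \<bullet> b))
        = dd (c' s) (dd (c' s) F) (c s) + dd c'' F (c s)"
      unfolding sum.distrib exp[OF S[OF s], of c''] exp2[OF S[OF s], of "c' s" "c' s"]
      by (simp add: mult.commute)
    finally show ?thesis
      by (rule has_field_derivative_transform_within_open[OF _ opens(2) s]) (simp only: S exp[symmetric])
  qed
qed

section \<open>Transformation of jets\<close>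

text \<open>The inverse function theorem supplies a differentiable \<open>g\<close>. Its derivative
  at \<open>y\<close> is \<open>E (g y)\<close> with \<open>E\<close> smooth on the set where the
  Jacobian does not vanish, and this first-order system makes \<open>g\<close> smooth.\<close>

lemma smooth_local_inverse_plane:
  fixes \<psi> :: "real \<times> real \<Rightarrow> real \<times> real"
  assumes smooth: "smooth_on U \<psi>" and "open U" "p0 \<in> U"
    and det: "fst (dd (1, 0) \<psi> p0) * snd (dd (0, 1) \<psi> p0) - fst (dd (0, 1) \<psi> p0) * snd (dd (1, 0) \<psi> p0) \<noteq> 0"
  obtains U' V g where "open U'" "U' \<subseteq> U" "p0 \<in> U'" "open V" "homeomorphism U' V \<psi> g" "smooth_on V g"
proof -
  define a where "a p = fst (dd (1, 0) \<psi> p)" for p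
  define b where "b p = fst (dd (0, 1) \<psi> p)" for p
  define c where "c p = snd (dd (1, 0) \<psi> p)" for p
  define d where "d p = snd (dd (0, 1) \<psi> p)" for p
  define \<Delta> where "\<Delta> p = a p * d p - b p * c p" for p
  have sm: "smooth_on U a" "smooth_on U b" "smooth_on U c" "smooth_on U d"
    unfolding a_def b_def c_def d_def
    by (intro smooth_on_fst smooth_on_snd smooth_on_dd smooth \<open>open U\<close>)+
  then have "smooth_on U \<Delta>"
    unfolding \<Delta>_def by (intro smooth_on_diff smooth_on_mult \<open>open U\<close>)
  define U0 where "U0 = {p \<in> U. \<Delta> p \<noteq> 0}"
  have "U0 = U \<inter> \<Delta> -` (- {0})"
    unfolding U0_def by auto
  then have "open U0"
    using continuous_open_preimage[OF smooth_on_continuous_on[OF \<open>smooth_on U \<Delta>\<close>] \<open>open U\<close> open_Compl[OF closed_singleton[of 0]]]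
    by simp
  have "p0 \<in> U0" "U0 \<subseteq> U"
    using assms by (auto simp: U0_def \<Delta>_def a_def b_def c_def d_def)
  \<comment> \<open>Cramer's rule: the inverse of the matrix with rows (a, b) and (c, d), written
    out so that its smooth dependence on \<open>p\<close> is visible.\<close>
  define E where "E p v = ((d p * fst v - b p * snd v) / \<Delta> p, (a p * snd v - c p * fst v) / \<Delta> p)"
    for p and v :: "real \<times> real"
  have lin: "bounded_linear (\<lambda>v. dd v \<psi> p)" if "p \<in> U0" for p
    using smooth_on_has_derivative[OF smooth] that \<open>U0 \<subseteq> U\<close> has_derivative_bounded_linear by blast
  have dd: "dd v \<psi> p = (fst v * a p + snd v * b p, fst v * c p + snd v * d p)" if "p \<in> U0" for p v
  proof -
    interpret L: linear "\<lambda>v. dd v \<psi> p"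
      using lin[OF that] by (rule bounded_linear.linear)
    have "dd v \<psi> p = dd (fst v *\<^sub>R (1, 0) + snd v *\<^sub>R (0, 1)) \<psi> p"
      by simp
    then show ?thesis
      by (simp only: L.add L.scale) (simp add: prod_eq_iff a_def b_def c_def d_def)
  qed
  have inverses: "dd (E p v) \<psi> p = v" "E p (dd v \<psi> p) = v" if "p \<in> U0" for p v
  proof -
    have "\<Delta> p \<noteq> 0"
      using that by (simp add: U0_def)
    then show "dd (E p v) \<psi> p = v" "E p (dd v \<psi> p) = v"
      unfolding dd[OF that] E_def
      by (simp_all add: prod_eq_iff divide_simps) (simp_all add: \<Delta>_def algebra_simps)
  qed
  have E_lin: "bounded_linear (E p)" for p
  proof -
    have "linear (E p)"
      by (rule linearI) (simp_all add: E_def algebra_simps add_divide_distrib diff_divide_distrib)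
    then show ?thesis
      by (simp add: linear_conv_bounded_linear)
  qed
  define f' where "f' p = Blinfun (\<lambda>v. dd v \<psi> p)" for p
  have f': "blinfun_apply (f' p) = (\<lambda>v. dd v \<psi> p)" if "p \<in> U0" for p
    unfolding f'_def using bounded_linear_Blinfun_apply[OF lin[OF that]] .
  obtain U' V g g' where *: "open U'" "U' \<subseteq> U0" "p0 \<in> U'" "open V" "\<psi> p0 \<in> V" "homeomorphism U' V \<psi> g"
    "\<And>y. y \<in> V \<Longrightarrow> (g has_derivative (g' y)) (at y)"
    "\<And>y. y \<in> V \<Longrightarrow> g' y = inv (blinfun_apply (f' (g y)))"
    "\<And>y. y \<in> V \<Longrightarrow> bij (blinfun_apply (f' (g y)))"
  proof (rule inverse_function_theorem[of U0 \<psi> f' p0 "Blinfun (E p0)"])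
    show "(\<psi> has_derivative blinfun_apply (f' p)) (at p)" if "p \<in> U0" for p
      using smooth_on_has_derivative[OF smooth] that \<open>U0 \<subseteq> U\<close> f' by fastforce
    show "continuous_on U0 f'"
    proof (rule continuous_on_blinfun_componentwise)
      show "continuous_on U0 (\<lambda>p. f' p i)" for i
      proof (rule continuous_on_eq)
        show "continuous_on U0 (dd i \<psi>)"
          using smooth_on_continuous_on[OF smooth_on_dd[OF smooth]] \<open>U0 \<subseteq> U\<close> continuous_on_subset by blast
      qed (simp add: f')
    qed
    show "Blinfun (E p0) o\<^sub>L f' p0 = id_blinfun"
      by (rule blinfun_eqI)
        (simp add: f' \<open>p0 \<in> U0\<close> bounded_linear_Blinfun_apply[OF E_lin] inverses)
  qed (use \<open>open U0\<close> \<open>p0 \<in> U0\<close> in auto)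
  have gV: "g ` V \<subseteq> U0"
    using *(2,6) by (auto simp: homeomorphism_def)
  have "smooth_on V g"
  proof (rule smooth_on_of_derivative_comp[of U0 _ _ E])
    show "(g has_derivative E (g y)) (at y)" if "y \<in> V" for y
    proof -
      have "g y \<in> U0"
        using gV that by auto
      then have "inv (\<lambda>v. dd v \<psi> (g y)) = E (g y)"
        using inverses[of "g y"] by (intro inv_equality) auto
      then show ?thesis
        using *(7,8)[OF that] f'[OF \<open>g y \<in> U0\<close>] by simp
    qed
    show "smooth_on U0 (\<lambda>p. E p v)" for v
      unfolding E_def
      by (intro smooth_on_intros smooth_on_divide \<open>open U0\<close>
          smooth_on_subset[OF sm(1) \<open>U0 \<subseteq> U\<close>] smooth_on_subset[OF sm(2) \<open>U0 \<subseteq> U\<close>]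
          smooth_on_subset[OF sm(3) \<open>U0 \<subseteq> U\<close>] smooth_on_subset[OF sm(4) \<open>U0 \<subseteq> U\<close>]
          smooth_on_subset[OF \<open>smooth_on U \<Delta>\<close> \<open>U0 \<subseteq> U\<close>])
        (simp_all add: U0_def)
  qed (use \<open>open U0\<close> \<open>open V\<close> gV in auto)
  then show thesis
    using * \<open>U0 \<subseteq> U\<close> by (intro that[of U' V g]) auto
qed


abbreviation Dt :: "(txu \<Rightarrow> real) \<Rightarrow> txu \<Rightarrow> real" where "Dt \<equiv> dd (1, 0, 0)"
abbreviation Dx :: "(txu \<Rightarrow> real) \<Rightarrow> txu \<Rightarrow> real" where "Dx \<equiv> dd (0, 1, 0)"
abbreviation Du :: "(txu \<Rightarrow> real) \<Rightarrow> txu \<Rightarrow> real" where "Du \<equiv> dd (0, 0, 1)"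

lemma has_vector_derivative_Pair_real:
  "(f has_real_derivative f') (at x) \<Longrightarrow> (g has_vector_derivative g') (at x) \<Longrightarrow>
    ((\<lambda>s. (f s, g s)) has_vector_derivative (f', g')) (at x)"
  unfolding has_real_derivative_iff_has_vector_derivative has_vector_derivative_def
  by (drule (1) has_derivative_Pair) simp

text \<open>The number in \<open>det\<close> is the Jacobian of (P, Q) along a graph with
  first-order jet (p, q); as it is nonzero, the image of the graph of a quadratic polynomial is
  again a graph near the point. So all second-order jets (A, C, D) over (p, q) are available. The
  last two conclusions give first and second derivatives of \<open>w'\<close> in the images of the
  tangent directions \<open>v\<close>; \<open>m\<close> is the second derivative of \<open>w\<close>
  along (a, b).\<close>

lemma jet_realisation:
  fixes P Q R :: "txu \<Rightarrow> real" and p q A C D :: real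
  assumes "open B" and smooth: "smooth_on B P" "smooth_on B Q" "smooth_on B R"
    and z0: "z0 = (t0, x0, u0)" "z0 \<in> B"
    and det: "dd (1, 0, p) P z0 * dd (0, 1, q) Q z0 - dd (0, 1, q) P z0 * dd (1, 0, p) Q z0 \<noteq> 0"
  obtains W w W' w' where
    "open W" "smooth_on W w" "graph_on W w \<subseteq> B" "open W'" "smooth_on W' w'"
    "(\<lambda>z. (P z, Q z, R z)) ` graph_on W w = graph_on W' w'"
    "(t0, x0) \<in> W" "w (t0, x0) = u0" "(P z0, Q z0) \<in> W'" "w' (P z0, Q z0) = R z0"
    "\<And>a b. dd (a, b) w (t0, x0) = a * p + b * q"
    "\<And>a b. dd (a, b) (dd (a, b) w) (t0, x0) = a\<^sup>2 * A + 2 * a * b * C + b\<^sup>2 * D"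
    "\<And>a b v. v = (a, b, a * p + b * q) \<Longrightarrow> dd v R z0 = dd (dd v P z0, dd v Q z0) w' (P z0, Q z0)"
    "\<And>a b v e m. v = (a, b, a * p + b * q) \<Longrightarrow> e = (dd v P z0, dd v Q z0) \<Longrightarrow>
      m = a\<^sup>2 * A + 2 * a * b * C + b\<^sup>2 * D \<Longrightarrow>
      dd v (dd v R) z0 + m * Du R z0 = dd e (dd e w') (P z0, Q z0) +
        dd (dd v (dd v P) z0 + m * Du P z0, dd v (dd v Q) z0 + m * Du Q z0) w' (P z0, Q z0)"
proof -
  define w :: "real \<times> real \<Rightarrow> real" where
    "w = (\<lambda>y. u0 + p * (fst y - t0) + q * (snd y - x0) + A / 2 * (fst y - t0)\<^sup>2 +
      C * ((fst y - t0) * (snd y - x0)) + D / 2 * (snd y - x0)\<^sup>2)"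
  have w: "smooth_on S w" if "open S" for S
    unfolding w_def by (intro smooth_on_intros that)
  have dw: "dd v w = (\<lambda>y. p * fst v + q * snd v + A * (fst y - t0) * fst v +
      C * ((fst y - t0) * snd v + (snd y - x0) * fst v) + D * (snd y - x0) * snd v)" for v
  proof
    fix y
    have "(w has_derivative (\<lambda>v. p * fst v + q * snd v + A * (fst y - t0) * fst v +
        C * ((fst y - t0) * snd v + (snd y - x0) * fst v) + D * (snd y - x0) * snd v)) (at y)"
      unfolding w_def by (auto intro!: derivative_eq_intros simp: field_simps)
    from dd_eqI[OF this] show "dd v w y = p * fst v + q * snd v + A * (fst y - t0) * fst v +
        C * ((fst y - t0) * snd v + (snd y - x0) * fst v) + D * (snd y - x0) * snd v" .
  qed
  have ddw: "dd v (dd v w) y = (fst v)\<^sup>2 * A + 2 * fst v * snd v * C + (snd v)\<^sup>2 * D" for v y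
  proof -
    have "(dd v w has_derivative (\<lambda>h. A * fst h * fst v + C * (fst h * snd v + snd h * fst v) +
        D * snd h * snd v)) (at y)"
      unfolding dw by (auto intro!: derivative_eq_intros simp: algebra_simps)
    from dd_eqI[OF this, of v] show ?thesis
      by (simp add: algebra_simps power2_eq_square)
  qed
  define j where "j y = (fst y, snd y, w y)" for y
  have j: "smooth_on S j" if "open S" for S
    unfolding j_def by (intro smooth_on_intros that w)
  define U where "U = j -` B"
  have "open U"
    unfolding U_def
    using smooth_on_continuous_on[OF j[OF open_UNIV]] \<open>open B\<close> by (auto intro: open_vimage)
  have jU: "j ` U \<subseteq> B"
    by (auto simp: U_def)
  define \<psi> where "\<psi> y = (P (j y), Q (j y))" for y
  have "smooth_on U \<psi>"
    unfolding \<psi>_def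
    by (rule smooth_on_Pair[OF smooth_on_compose[OF smooth(1) j[OF \<open>open U\<close>] \<open>open B\<close> \<open>open U\<close> jU]
          smooth_on_compose[OF smooth(2) j[OF \<open>open U\<close>] \<open>open B\<close> \<open>open U\<close> jU] \<open>open U\<close>])
  have y0: "(t0, x0) \<in> U" and j0: "j (t0, x0) = z0"
    using z0 by (auto simp: U_def j_def w_def)
  have dj: "(j has_derivative (\<lambda>v. (fst v, snd v, dd v w y))) (at y)" for y
    unfolding j_def
    by (intro has_derivative_Pair smooth_on_has_derivative[OF w[OF open_UNIV]] has_derivative_fst
        has_derivative_snd has_derivative_ident UNIV_I)
  have d\<psi>: "dd v \<psi> (t0, x0) = (dd (fst v, snd v, fst v * p + snd v * q) P z0,
      dd (fst v, snd v, fst v * p + snd v * q) Q z0)" for v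
  proof (rule dd_eqI)
    have "((\<lambda>y. F (j y)) has_derivative (\<lambda>v. dd (fst v, snd v, fst v * p + snd v * q) F z0)) (at (t0, x0))"
      if "smooth_on B F" for F :: "txu \<Rightarrow> real"
      using diff_chain_at[OF dj[of "(t0, x0)"], of F "\<lambda>v. dd v F z0"] smooth_on_has_derivative[OF that z0(2)]
      by (simp add: comp_def j0 dw mult.commute)
    then show "(\<psi> has_derivative (\<lambda>v. (dd (fst v, snd v, fst v * p + snd v * q) P z0,
        dd (fst v, snd v, fst v * p + snd v * q) Q z0))) (at (t0, x0))"
      unfolding \<psi>_def by (intro has_derivative_Pair; use smooth in blast)
  qed
  obtain W W' g where *: "open W" "W \<subseteq> U" "(t0, x0) \<in> W" "open W'" "homeomorphism W W' \<psi> g" "smooth_on W' g"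
    by (rule smooth_local_inverse_plane[OF \<open>smooth_on U \<psi>\<close> \<open>open U\<close> y0]) (use det in \<open>simp_all add: d\<psi>\<close>)
  define w' where "w' y = R (j (g y))" for y
  have hom: "\<psi> ` W = W'" "g ` W' = W" "\<And>y. y \<in> W \<Longrightarrow> g (\<psi> y) = y" "\<And>y. y \<in> W' \<Longrightarrow> \<psi> (g y) = y"
    using *(5) by (auto simp: homeomorphism_def)
  have jW: "j ` W \<subseteq> B"
    using jU *(2) by auto
  have "smooth_on W' (\<lambda>y. j (g y))"
    by (rule smooth_on_compose[OF j[OF *(1)] *(6,1,4)]) (simp add: hom)
  moreover have "(\<lambda>y. j (g y)) ` W' \<subseteq> B"
    using jW hom(2) by auto
  ultimately have w': "smooth_on W' w'"
    unfolding w'_def by (rule smooth_on_compose[OF smooth(3) _ \<open>open B\<close> *(4)])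
  have w'\<psi>: "w' (\<psi> y) = R (j y)" if "y \<in> W" for y
    using hom(3)[OF that] by (simp add: w'_def)
  have gr: "graph_on W w = j ` W"
    unfolding graph_on_def by (rule image_cong[OF refl]) (simp add: j_def split_beta)
  have "(\<lambda>z. (P z, Q z, R z)) ` graph_on W w = (\<lambda>y. (fst (\<psi> y), snd (\<psi> y), w' (\<psi> y))) ` W"
    unfolding gr image_image by (rule image_cong[OF refl]) (simp add: w'\<psi>[symmetric], simp add: \<psi>_def)
  also have "\<dots> = (\<lambda>y. (fst y, snd y, w' y)) ` (\<psi> ` W)"
    by (simp add: image_image)
  also have "\<dots> = graph_on W' w'"
    unfolding hom(1) graph_on_def by (rule image_cong[OF refl]) (simp add: split_beta)
  finally have graphs: "(\<lambda>z. (P z, Q z, R z)) ` graph_on W w = graph_on W' w'" .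
  have \<psi>0: "\<psi> (t0, x0) = (P z0, Q z0)"
    by (simp add: \<psi>_def j0)
  have curves: "dd v R z0 = dd (dd v P z0, dd v Q z0) w' (P z0, Q z0)"
    "dd v (dd v R) z0 + m * Du R z0 = dd e (dd e w') (P z0, Q z0) +
        dd (dd v (dd v P) z0 + m * Du P z0, dd v (dd v Q) z0 + m * Du Q z0) w' (P z0, Q z0)"
    if v: "v = (a, b, a * p + b * q)" and e: "e = (dd v P z0, dd v Q z0)"
      and m: "m = a\<^sup>2 * A + 2 * a * b * C + b\<^sup>2 * D" for a b v e m
  proof -
    \<comment> \<open>A straight line in the (t, x) plane, to be lifted to the graph. As
      \<open>w\<close> is quadratic, the lift has the constant acceleration (0, 0, m), which
      accounts for the terms \<open>m * Du P z0\<close>, \<open>m * Du Q z0\<close> and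
      \<open>m * Du R z0\<close>.\<close>
    define l where "l s = (t0 + s * a, x0 + s * b)" for s
    define J where "J = l -` W"
    have "open J"
      unfolding J_def l_def by (intro open_vimage \<open>open W\<close> continuous_intros)
    have "0 \<in> J"
      using *(3) by (simp add: J_def l_def)
    define \<gamma> where "\<gamma> s = j (l s)" for s
    define \<gamma>' where "\<gamma>' s = (a, b, a * p + b * q + s * m)" for s
    have \<gamma>: "(\<gamma> has_vector_derivative \<gamma>' s) (at s)" for s
      unfolding \<gamma>_def \<gamma>'_def j_def l_def fst_conv snd_conv w_def
      unfolding m by (intro has_vector_derivative_Pair_real has_real_derivative_iff_has_vector_derivative[THEN iffD1])
        (auto intro!: derivative_eq_intros simp: algebra_simps power2_eq_square)
    have \<gamma>': "(\<gamma>' has_vector_derivative (0, 0, m)) (at s)" for s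
      unfolding \<gamma>'_def
      by (intro has_vector_derivative_Pair_real has_real_derivative_iff_has_vector_derivative[THEN iffD1])
        (auto intro!: derivative_eq_intros)
    have \<gamma>B: "\<forall>s\<in>J. (\<gamma> has_vector_derivative \<gamma>' s) (at s) \<and> \<gamma> s \<in> B"
      using jW by (auto simp: \<gamma> \<gamma>_def[symmetric] J_def) (auto simp: \<gamma>_def)
    have \<gamma>0: "\<gamma> 0 = z0" "\<gamma>' 0 = v"
      by (simp_all add: \<gamma>_def \<gamma>'_def l_def j0 v)
    note along = smooth_on_along_curve[OF _ \<open>open B\<close> \<open>open J\<close> \<gamma>B]
    define c where "c s = (P (\<gamma> s), Q (\<gamma> s))" for s
    define c' where "c' s = (dd (\<gamma>' s) P (\<gamma> s), dd (\<gamma>' s) Q (\<gamma> s))" for s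
    define c'' where "c'' = (dd v (dd v P) z0 + dd (0, 0, m) P z0, dd v (dd v Q) z0 + dd (0, 0, m) Q z0)"
    have c\<psi>: "c s = \<psi> (l s)" for s
      by (simp add: c_def \<psi>_def \<gamma>_def)
    have c: "(c has_vector_derivative c' s) (at s)" if "s \<in> J" for s
      unfolding c_def c'_def
      using along(1)[OF smooth(1) that] along(1)[OF smooth(2) that]
      by (intro has_vector_derivative_Pair_real) (simp_all add: has_real_derivative_iff_has_vector_derivative)
    then have cW: "\<forall>s\<in>J. (c has_vector_derivative c' s) (at s) \<and> c s \<in> W'"
      using hom(1) by (auto simp: c\<psi> J_def)
    have c': "(c' has_vector_derivative c'') (at 0)"
      unfolding c'_def c''_def
      using along(2)[OF smooth(1) \<open>0 \<in> J\<close> \<gamma>'] along(2)[OF smooth(2) \<open>0 \<in> J\<close> \<gamma>']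
      by (intro has_vector_derivative_Pair_real)
        (simp_all add: has_real_derivative_iff_has_vector_derivative \<gamma>0)
    note along' = smooth_on_along_curve[OF w' \<open>open W'\<close> \<open>open J\<close> cW]
    have eq0: "R (\<gamma> s) = w' (c s)" if "s \<in> J" for s
      using that by (simp add: \<gamma>_def c\<psi> w'\<psi> J_def)
    \<comment> \<open>The first-order identity is stated on all of \<open>J\<close> because it is
      differentiated once more at 0 below.\<close>
    have eq1: "dd (\<gamma>' s) R (\<gamma> s) = dd (c' s) w' (c s)" if "s \<in> J" for s
      using DERIV_unique[OF along(1)[OF smooth(3) that]
          has_field_derivative_transform_within_open[OF along'(1)[OF that] \<open>open J\<close> that]] eq0 by simp
    have c0: "c 0 = (P z0, Q z0)" "c' 0 = (dd v P z0, dd v Q z0)"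
      by (simp_all add: c_def c'_def \<gamma>0)
    show "dd v R z0 = dd (dd v P z0, dd v Q z0) w' (P z0, Q z0)"
      using eq1[OF \<open>0 \<in> J\<close>] by (simp add: \<gamma>0 c0)
    have lin: "dd (0, 0, m) F z0 = m * Du F z0" if "smooth_on B F" for F :: "txu \<Rightarrow> real"
      using linear_scale[OF has_derivative_linear[OF smooth_on_has_derivative[OF that z0(2)]], of m "(0, 0, 1)"]
      by simp
    have "dd v (dd v R) z0 + dd (0, 0, m) R z0 = dd e (dd e w') (P z0, Q z0) + dd c'' w' (P z0, Q z0)"
      using DERIV_unique[OF along(2)[OF smooth(3) \<open>0 \<in> J\<close> \<gamma>']
          has_field_derivative_transform_within_open[OF along'(2)[OF \<open>0 \<in> J\<close> c'] \<open>open J\<close> \<open>0 \<in> J\<close>]] eq1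
      by (simp add: \<gamma>0 c0 e)
    then show "dd v (dd v R) z0 + m * Du R z0 = dd e (dd e w') (P z0, Q z0) +
        dd (dd v (dd v P) z0 + m * Du P z0, dd v (dd v Q) z0 + m * Du Q z0) w' (P z0, Q z0)"
      by (simp add: c''_def lin smooth)
  qed
  show thesis
  proof (rule that[OF *(1) w[OF *(1)] _ *(4) w' graphs *(3)])
    show "graph_on W w \<subseteq> B"
      using gr jW by simp
    show "w (t0, x0) = u0"
      by (simp add: w_def)
    show "(P z0, Q z0) \<in> W'" "w' (P z0, Q z0) = R z0"
      using imageI[OF *(3), of \<psi>] w'\<psi>[OF *(3)] by (simp_all add: hom(1) \<psi>0 j0)
    show "dd (a, b) w (t0, x0) = a * p + b * q" for a b
      by (simp add: dw)
    show "dd (a, b) (dd (a, b) w) (t0, x0) = a\<^sup>2 * A + 2 * a * b * C + b\<^sup>2 * D" for a b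
      by (simp add: ddw)
    show "dd v R z0 = dd (dd v P z0, dd v Q z0) w' (P z0, Q z0)"
      if "v = (a, b, a * p + b * q)" for a b v
      by (rule curves(1)[OF that refl refl])
  qed (rule curves(2))
qed

section \<open>The equation as a condition on second-order jets\<close>

lemma smooth_on_line:
  fixes F :: "'a::euclidean_space \<Rightarrow> real"
  assumes "smooth_on S F" "open S" "z \<in> S"
  shows "((\<lambda>s. F (z + s *\<^sub>R v)) has_real_derivative dd v F z) (at 0)"
proof -
  have "((\<lambda>s. z + s *\<^sub>R v) has_derivative (\<lambda>s. s *\<^sub>R v)) (at 0)"
    by (auto intro!: derivative_eq_intros)
  then have "((\<lambda>s. F (z + s *\<^sub>R v)) has_derivative (\<lambda>s. dd (s *\<^sub>R v) F z)) (at 0)"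
    using diff_chain_at[of "\<lambda>s. z + s *\<^sub>R v" _ 0 F "\<lambda>v. dd v F z"] smooth_on_has_derivative[OF assms(1,3)]
    by (simp add: comp_def)
  moreover have "dd (s *\<^sub>R v) F z = dd v F z * s" for s
    using linear_scale[OF has_derivative_linear[OF smooth_on_has_derivative[OF assms(1,3)]]]
    by (simp only: real_scaleR_def mult.commute)
  ultimately show ?thesis
    by (simp add: has_field_derivative_def)
qed

lemma smooth_on_partial:
  fixes w :: "real \<times> real \<Rightarrow> real"
  assumes "smooth_on W w" "open W" "(t, x) \<in> W"
  shows "((\<lambda>r. w (r, x)) has_real_derivative dd (1, 0) w (t, x)) (at t)"
    and "((\<lambda>y. w (t, y)) has_real_derivative dd (0, 1) w (t, x)) (at x)"
  using DERIV_shift[of "\<lambda>r. w (r, x)" _ 0 t] DERIV_shift[of "\<lambda>y. w (t, y)" _ 0 x]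
    smooth_on_line[OF assms, of "(1, 0)"] smooth_on_line[OF assms, of "(0, 1)"]
  by (simp_all add: add.commute)

lemma smooth_on_second_partial:
  fixes w :: "real \<times> real \<Rightarrow> real"
  assumes w: "smooth_on W w" "open W" "(t, x) \<in> W"
  shows "((\<lambda>s. deriv (\<lambda>r. w (r, x)) s) has_real_derivative dd (1, 0) (dd (1, 0) w) (t, x)) (at t)"
    and "((\<lambda>y. deriv (\<lambda>z. w (t, z)) y) has_real_derivative dd (0, 1) (dd (0, 1) w) (t, x)) (at x)"
proof -
  have "open ((\<lambda>s. (s, x)) -` W)" "open ((\<lambda>y. (t, y)) -` W)"
    by (intro open_vimage w(2) continuous_intros)+
  note transform = has_field_derivative_transform_within_open[OF _ this(1), of _ _ t]
    has_field_derivative_transform_within_open[OF _ this(2), of _ _ x]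
  show "((\<lambda>s. deriv (\<lambda>r. w (r, x)) s) has_real_derivative dd (1, 0) (dd (1, 0) w) (t, x)) (at t)"
    by (rule transform(1)[OF smooth_on_partial(1)[OF smooth_on_dd[OF w(1)] w(2,3)]])
      (use w in \<open>auto intro!: DERIV_imp_deriv[symmetric] smooth_on_partial\<close>)
  show "((\<lambda>y. deriv (\<lambda>z. w (t, z)) y) has_real_derivative dd (0, 1) (dd (0, 1) w) (t, x)) (at x)"
    by (rule transform(2)[OF smooth_on_partial(2)[OF smooth_on_dd[OF w(1)] w(2,3)]])
      (use w in \<open>auto intro!: DERIV_imp_deriv[symmetric] smooth_on_partial\<close>)
qed

lemma equation_holds_iff:
  fixes w :: "real \<times> real \<Rightarrow> real"
  assumes w: "smooth_on W w" "open W" "(t, x) \<in> W" and u: "w (t, x) = u"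
    and g: "(g has_real_derivative g1) (at x)" and H: "(H has_real_derivative H1) (at u)"
  shows "equation_holds (f, g, h, H, K) w (t, x) \<longleftrightarrow>
    f x * dd (1, 0) (dd (1, 0) w) (t, x) = g x * H u * dd (0, 1) (dd (0, 1) w) (t, x) +
      g x * H1 * (dd (0, 1) w (t, x))\<^sup>2 + (g1 * H u + h x * K u) * dd (0, 1) w (t, x)"
proof -
  have tt: "deriv (\<lambda>s. deriv (\<lambda>r. w (r, x)) s) t = dd (1, 0) (dd (1, 0) w) (t, x)"
    by (rule DERIV_imp_deriv[OF smooth_on_second_partial(1)[OF w]])
  have x: "deriv (\<lambda>z. w (t, z)) x = dd (0, 1) w (t, x)"
    by (rule DERIV_imp_deriv[OF smooth_on_partial(2)[OF w]])
  have "((\<lambda>y. H (w (t, y))) has_real_derivative H1 * dd (0, 1) w (t, x)) (at x)"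
    using DERIV_chain2[OF _ smooth_on_partial(2)[OF w], of H H1] H u by simp
  note DERIV_imp_deriv[OF DERIV_mult[OF DERIV_mult[OF g this] smooth_on_second_partial(2)[OF w]]]
  then show ?thesis
    unfolding equation_holds.simps tt x by (simp add: x u algebra_simps power2_eq_square)
qed

lemma admissible_equation_iff:
  assumes "admissible Ix Iu (f, g, h, H, K)" "x \<in> Ix" "u \<in> Iu"
    and "smooth_on W w" "open W" "(t, x) \<in> W" "w (t, x) = u"
  shows "equation_holds (f, g, h, H, K) w (t, x) \<longleftrightarrow>
    f x * dd (1, 0) (dd (1, 0) w) (t, x) = g x * H u * dd (0, 1) (dd (0, 1) w) (t, x) +
      g x * deriv H u * (dd (0, 1) w (t, x))\<^sup>2 + (deriv g x * H u + h x * K u) * dd (0, 1) w (t, x)"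
  using assms by (intro equation_holds_iff) (auto intro: smooth_on_DERIV)

text \<open>The points (A, C, D) = (l/f, 0, 0), (l/f, 1, 0) and ((G + l)/f, 0, 1) lie on the first
  plane; that they lie on the second one fixes its coefficients, with \<open>\<mu>\<close> = a/f.
  The variable C occurs in the second equation only, which makes \<open>b = 0\<close> the condition
  coming from the mixed derivative.\<close>

lemma proportional_affine_functionals:
  fixes f G l a b d m :: real
  assumes "f \<noteq> 0" and eq: "\<And>A C D. f * A = G * D + l \<longleftrightarrow> a * A + b * C + d * D = m"
  obtains \<mu> where "b = 0" "a = \<mu> * f" "d = - \<mu> * G" "m = \<mu> * l"
proof
  have m: "a * (l / f) = m"
    using eq[of "l / f" 0 0] \<open>f \<noteq> 0\<close> by simp
  show "b = 0"
    using eq[of "l / f" 0 1] m \<open>f \<noteq> 0\<close> by simp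
  show "a = a / f * f" "m = a / f * l"
    using \<open>f \<noteq> 0\<close> m by simp_all
  have "a * ((G + l) / f) + d = m"
    using eq[of "(G + l) / f" 1 0] \<open>f \<noteq> 0\<close> by simp
  then show "d = - (a / f) * G"
    using \<open>f \<noteq> 0\<close> m by (simp add: field_simps)
qed

section \<open>Partial derivatives and directions of constancy\<close>

lemma dd_expand:
  fixes F :: "txu \<Rightarrow> real"
  assumes "smooth_on B F" "z \<in> B"
  shows "dd (a, b, c) F z = a * Dt F z + b * Dx F z + c * Du F z"
proof -
  interpret L: linear "\<lambda>v. dd v F z"
    using smooth_on_has_derivative[OF assms] by (rule has_derivative_linear)
  have "dd (a, b, c) F z = dd (a *\<^sub>R (1, 0, 0) + b *\<^sub>R (0, 1, 0) + c *\<^sub>R (0, 0, 1)) F z"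
    by simp
  then show ?thesis
    by (simp only: L.add L.scale real_scaleR_def)
qed

lemma dd_expand2:
  fixes F :: "txu \<Rightarrow> real"
  assumes F: "smooth_on B F" "z \<in> B" and "open B"
  shows "dd v (dd (a, b, c) F) z =
    a * dd v (Dt F) z + b * dd v (Dx F) z + c * dd v (Du F) z"
proof (rule dd_eqI)
  have "((\<lambda>y. a * Dt F y + b * Dx F y + c * Du F y) has_derivative
      (\<lambda>v. a * dd v (Dt F) z + b * dd v (Dx F) z + c * dd v (Du F) z)) (at z)"
    by (intro has_derivative_add has_derivative_mult_right smooth_on_has_derivative[OF smooth_on_dd[OF F(1)] F(2)])
  then show "(dd (a, b, c) F has_derivative
      (\<lambda>v. a * dd v (Dt F) z + b * dd v (Dx F) z + c * dd v (Du F) z)) (at z)"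
    by (rule has_derivative_transform_within_open[OF _ \<open>open B\<close> F(2)]) (simp add: dd_expand[OF F(1), of _ a b c])
qed

lemma dd_plane_expand:
  fixes w :: "real \<times> real \<Rightarrow> real"
  assumes "smooth_on W w" "y \<in> W"
  shows "dd (a, b) w y = a * dd (1, 0) w y + b * dd (0, 1) w y"
proof -
  interpret L: linear "\<lambda>v. dd v w y"
    using smooth_on_has_derivative[OF assms] by (rule has_derivative_linear)
  have "dd (a, b) w y = dd (a *\<^sub>R (1, 0) + b *\<^sub>R (0, 1)) w y"
    by simp
  then show ?thesis
    by (simp only: L.add L.scale real_scaleR_def)
qed

lemma constant_along_line:
  fixes F :: "'a::euclidean_space \<Rightarrow> real"
  assumes F: "smooth_on B F" and "open B" "convex B" and zero: "\<And>z. z \<in> B \<Longrightarrow> dd v F z = 0"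
    and "z \<in> B" "z + v \<in> B"
  shows "F (z + v) = F z"
proof -
  have "F (z + 1 *\<^sub>R v) = F (z + 0 *\<^sub>R v)"
  proof (rule has_derivative_zero_unique[where f = "\<lambda>s. F (z + s *\<^sub>R v)" and s = "{0..1}"])
    fix s :: real assume s: "s \<in> {0..1}"
    have "(1 - s) *\<^sub>R z + s *\<^sub>R (z + v) \<in> B"
      using convexD_alt[OF \<open>convex B\<close> \<open>z \<in> B\<close> \<open>z + v \<in> B\<close>, of s] s by simp
    then have "z + s *\<^sub>R v \<in> B"
      by (simp add: algebra_simps)
    then have "((\<lambda>s. F (z + s *\<^sub>R v)) has_real_derivative 0) (at s)"
      using DERIV_shift[of "\<lambda>s. F (z + s *\<^sub>R v)" _ 0 s] smooth_on_line[OF F \<open>open B\<close>, of "z + s *\<^sub>R v" v] zero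
      by (simp add: algebra_simps)
    then have "((\<lambda>s. F (z + s *\<^sub>R v)) has_derivative (\<lambda>h. 0)) (at s)"
      by (simp add: has_field_derivative_def lambda_zero)
    then show "((\<lambda>s. F (z + s *\<^sub>R v)) has_derivative (\<lambda>h. 0)) (at s within {0..1})"
      by (rule has_derivative_at_withinI)
  qed auto
  then show ?thesis
    by simp
qed

text \<open>Near \<open>z\<close> the function \<open>F\<close> coincides with its translate by
  \<open>v\<close>, so both have the same derivative at \<open>z\<close>.\<close>

lemma dd_constant_along_line:
  fixes F :: "'a::euclidean_space \<Rightarrow> real"
  assumes F: "smooth_on B F" and B: "open B" "convex B" and zero: "\<And>z c. z \<in> B \<Longrightarrow> dd (c *\<^sub>R v) F z = 0"
    and z: "z \<in> B" "z + v \<in> B"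
  shows "dd y F (z + v) = dd y F z"
proof -
  define S where "S = B \<inter> (\<lambda>q. q + v) -` B"
  have "open S"
    unfolding S_def by (intro open_Int open_vimage B continuous_intros)
  have "z \<in> S"
    using z by (simp add: S_def)
  have "F (q + v) = F q" if "q \<in> S" for q
    using constant_along_line[OF F B, of v q] zero[of _ 1] that by (simp add: S_def)
  have "((\<lambda>q. q + v) has_derivative (\<lambda>y. y)) (at z)"
    by (auto intro!: derivative_eq_intros)
  then have "((\<lambda>q. F (q + v)) has_derivative (\<lambda>y. dd y F (z + v))) (at z)"
    using diff_chain_at[of "\<lambda>q. q + v" "\<lambda>y. y" z F "\<lambda>y. dd y F (z + v)"]
      smooth_on_has_derivative[OF F z(2)] by (simp add: comp_def)
  then have "(F has_derivative (\<lambda>y. dd y F (z + v))) (at z)"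
    by (rule has_derivative_transform_within_open[OF _ \<open>open S\<close> \<open>z \<in> S\<close>]) fact
  then show ?thesis
    by (rule dd_eqI[symmetric])
qed

text \<open>The first claim differentiates the zero function \<open>dd v F\<close>. For the other
  order of differentiation, \<open>F\<close> is invariant under translations along \<open>v\<close>,
  and hence so is \<open>dd y F\<close>.\<close>

lemma dd_dd_zero:
  fixes F :: "'a::euclidean_space \<Rightarrow> real"
  assumes F: "smooth_on B F" and B: "open B" "convex B" and zero: "\<And>z. z \<in> B \<Longrightarrow> dd v F z = 0" and z: "z \<in> B"
  shows "dd y (dd v F) z = 0" and "dd v (dd y F) z = 0"
proof -
  have "(dd v F has_derivative (\<lambda>y. 0)) (at z)"
    by (rule has_derivative_transform_within_open[OF has_derivative_const[of 0] B(1) z]) (simp add: zero)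
  then show "dd y (dd v F) z = 0"
    by (rule dd_eqI)
  have zero': "dd (c *\<^sub>R v) F q = 0" if "q \<in> B" for q c
    using linear_scale[OF has_derivative_linear[OF smooth_on_has_derivative[OF F that]], of c v] zero[OF that]
    by simp
  have "open ((\<lambda>s. z + s *\<^sub>R v) -` B)"
    by (intro open_vimage B continuous_intros)
  have "((\<lambda>s. dd y F (z + s *\<^sub>R v)) has_real_derivative 0) (at 0)"
  proof (rule has_field_derivative_transform_within_open[OF DERIV_const[of "dd y F z"]])
    show "open ((\<lambda>s. z + s *\<^sub>R v) -` B)" "0 \<in> (\<lambda>s. z + s *\<^sub>R v) -` B"
      using z by (auto intro!: open_vimage B continuous_intros)
    show "dd y F z = dd y F (z + s *\<^sub>R v)" if "s \<in> (\<lambda>s. z + s *\<^sub>R v) -` B" for s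
      using dd_constant_along_line[OF F B, of "s *\<^sub>R v" z y] zero' z that by simp
  qed
  then show "dd v (dd y F) z = 0"
    using DERIV_unique smooth_on_line[OF smooth_on_dd[OF F] B(1) z] by blast
qed

text \<open>The quadratic coefficient makes the polynomial nonvanishing and nonconstant for \<open>c \<noteq> 0\<close>;
  for \<open>c = 0\<close> this coefficient is \<open>0\<close> by \<open>x / 0 = 0\<close>.\<close>

definition quadr :: "real \<Rightarrow> real \<Rightarrow> real \<Rightarrow> real \<Rightarrow> real" where
  "quadr c b x0 x = c + b * (x - x0) + (b\<^sup>2 + c\<^sup>2) / c * (x - x0)\<^sup>2"

lemma smooth_on_quadr: "open S \<Longrightarrow> smooth_on S (quadr c b x0)"
  unfolding quadr_def by (intro smooth_on_intros)

lemma DERIV_quadr: "(quadr c b x0 has_real_derivative b + 2 * ((b\<^sup>2 + c\<^sup>2) / c) * (x - x0)) (at x)"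
proof -
  define k where "k = (b\<^sup>2 + c\<^sup>2) / c"
  show ?thesis
    unfolding quadr_def k_def[symmetric] by (auto intro!: derivative_eq_intros)
qed

lemma quadr_at [simp]: "quadr c b x0 x0 = c" "deriv (quadr c b x0) x0 = b"
  using DERIV_imp_deriv[OF DERIV_quadr[of c b x0 x0]] by (simp_all add: quadr_def)

text \<open>Completing squares leaves half of the constant term as a positive remainder. So
  \<open>quadr c b x0\<close> has the sign of \<open>c\<close> on the whole line, whatever its slope
  \<open>b\<close> at \<open>x0\<close>.\<close>

lemma quadr_sign:
  assumes "c \<noteq> 0"
  shows "c * quadr c b x0 x > 0"
proof -
  define y where "y = x - x0"
  have "c * quadr c b x0 x = c\<^sup>2 + (c * (b * y) + ((b * y)\<^sup>2 + (c * y)\<^sup>2))"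
    using assms by (simp add: quadr_def y_def power2_eq_square field_simps)
  also have "\<dots> = c\<^sup>2 / 2 + (c + b * y)\<^sup>2 / 2 + (b * y)\<^sup>2 / 2 + (c * y)\<^sup>2"
    by (simp add: power2_eq_square field_simps)
  also have "\<dots> > 0"
    using assms by (intro add_pos_nonneg) auto
  finally show ?thesis .
qed

text \<open>The leading coefficient is nonzero, so the derivative is affine with nonzero slope and
  differs at two points of \<open>S\<close>. Thus H alone fulfils (H_u, K_u) \<noteq> (0, 0), even
  when its slope at the base point is 0.\<close>

lemma quadr_not_constant:
  assumes "c \<noteq> 0" "open S" "S \<noteq> {}"
  obtains x where "x \<in> S" "deriv (quadr c b x0) x \<noteq> 0"
proof -
  obtain x where x: "x \<in> S"
    using assms by auto
  obtain e where e: "e > 0" "ball x e \<subseteq> S"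
    using openE[OF assms(2) x] by blast
  have y: "x + e / 2 \<in> S"
    using e by (auto simp: subset_iff dist_real_def)
  define k where "k = (b\<^sup>2 + c\<^sup>2) / c"
  have deriv: "deriv (quadr c b x0) y = b + 2 * k * (y - x0)" for y
    unfolding k_def by (rule DERIV_imp_deriv[OF DERIV_quadr])
  have "deriv (quadr c b x0) (x + e / 2) - deriv (quadr c b x0) x = k * e"
    unfolding deriv by (simp add: algebra_simps)
  also have "\<dots> \<noteq> 0"
    using e assms by (simp add: k_def add_nonneg_eq_0_iff)
  finally have "deriv (quadr c b x0) x \<noteq> 0 \<or> deriv (quadr c b x0) (x + e / 2) \<noteq> 0"
    by auto
  then show thesis
    using that x y by blast
qed

lemma admissible_quadr:
  assumes "open Ix" "open Iu" "Iu \<noteq> {}" "f \<noteq> 0" "g \<noteq> 0" "H \<noteq> 0"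
  shows "admissible Ix Iu (quadr f f1 x0, quadr g g1 x1, quadr h h1 x2, quadr H H1 u0, quadr K K1 u1)"
proof -
  obtain u where "u \<in> Iu" "deriv (quadr H H1 u0) u \<noteq> 0"
    using quadr_not_constant[OF \<open>H \<noteq> 0\<close> assms(2,3)] .
  moreover have "quadr c b x0 x \<noteq> 0" if "c \<noteq> 0" for c b x0 x
    using quadr_sign[OF that, of b x0 x] by auto
  ultimately show ?thesis
    using assms by (auto simp: smooth_on_quadr)
qed

section \<open>Comparison of the equations\<close>

lemma quadratic_zero:
  fixes a b c :: real
  assumes "\<And>q. a + b * q + c * q\<^sup>2 = 0"
  shows "a = 0" "b = 0" "c = 0"
  using assms[of 0] assms[of 1] assms[of "-1"] by auto

text \<open>The form \<open>m0 + p * m1 + q * m2\<close> will be the Jacobian determinant as a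
  function of the first-order jet (p, q). Multiplying by it extends the vanishing to all (p, q); the
  product is a polynomial with eight coefficients, determined by its values for p and q in {-1, 0,
  1}.\<close>

lemma bilinear_zero:
  fixes a b c d m0 m1 m2 :: real
  assumes nz: "(m0, m1, m2) \<noteq> (0, 0, 0)"
    and eq: "\<And>p q. m0 + p * m1 + q * m2 \<noteq> 0 \<Longrightarrow> a + p * b + q * c + p * q * d = 0"
  shows "a = 0 \<and> b = 0 \<and> c = 0 \<and> d = 0"
proof -
  have e: "(m0 + p * m1 + q * m2) * (a + p * b + q * c + p * q * d) = 0" for p q
    using eq by auto
  have coeffs: "c0 = 0 \<and> c1 = 0 \<and> c2 = 0 \<and> c3 = 0 \<and> c4 = 0 \<and> c5 = 0 \<and> c6 = 0 \<and> c7 = 0"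
    if z: "\<And>p q. c0 + p * c1 + q * c2 + p * q * c3 + p * p * c4 + q * q * c5 + p * p * q * c6 + p * q * q * c7 = 0"
    for c0 c1 c2 c3 c4 c5 c6 c7 :: real
    using z[of 0 0] z[of 1 0] z[of "-1" 0] z[of 0 1] z[of 0 "-1"] z[of 1 1] z[of 1 "-1"] z[of "-1" 1] z[of "-1" "-1"]
    by simp
  have "m0 * a = 0 \<and> m0 * b + m1 * a = 0 \<and> m0 * c + m2 * a = 0 \<and> m0 * d + m1 * c + m2 * b = 0 \<and>
      m1 * b = 0 \<and> m2 * c = 0 \<and> m1 * d = 0 \<and> m2 * d = 0"
  proof (rule coeffs)
    show "m0 * a + p * (m0 * b + m1 * a) + q * (m0 * c + m2 * a) + p * q * (m0 * d + m1 * c + m2 * b) +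
        p * p * (m1 * b) + q * q * (m2 * c) + p * p * q * (m1 * d) + p * q * q * (m2 * d) = 0" for p q
      by (rule trans[OF _ e[of p q]]) (simp add: algebra_simps)
  qed
  then show ?thesis
    using nz by auto
qed

locale equivalence_transformation =
  fixes It Ix Iu :: "real set" and T :: "txu \<times> elem_vals \<Rightarrow> txu \<times> elem_vals" and P Q R :: "txu \<Rightarrow> real"
    and B :: "txu set"
  defines B_def: "B \<equiv> It \<times> Ix \<times> Iu"
  assumes intervals: "open_interval It" "open_interval Ix" "open_interval Iu"
    and T_smooth: "smooth_on (B \<times> UNIV) T"
    and T_bij: "\<And>p. p \<in> B \<times> UNIV \<Longrightarrow> bij (frechet_derivative T (at p))"
    and fst_T: "\<And>z a. z \<in> B \<Longrightarrow> fst (T (z, a)) = (P z, Q z, R z)"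
    and transform: "\<And>\<theta>. admissible Ix Iu \<theta> \<Longrightarrow> \<exists>\<theta>'. admissible (Q ` B) (R ` B) \<theta>' \<and>
      (\<forall>z\<in>B. snd (T (z, vals_at \<theta> z)) = vals_at \<theta>' (P z, Q z, R z)) \<and>
      transforms_equation B (\<lambda>z. (P z, Q z, R z)) \<theta> \<theta>'"
begin

text \<open>A relation, since \<open>\<theta>'\<close> comes from an existential statement for each
  \<open>\<theta>\<close> separately. Constants extracted from a related pair belong to that pair
  until \<open>T\<close> is used to compare pairs.\<close>

definition related :: "elems \<Rightarrow> elems \<Rightarrow> bool" where
  "related \<theta> \<theta>' \<longleftrightarrow> admissible Ix Iu \<theta> \<and> admissible (Q ` B) (R ` B) \<theta>' \<and>
    (\<forall>z\<in>B. snd (T (z, vals_at \<theta> z)) = vals_at \<theta>' (P z, Q z, R z)) \<and>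
    transforms_equation B (\<lambda>z. (P z, Q z, R z)) \<theta> \<theta>'"

lemma intervals_open: "open It" "open Ix" "open Iu" "It \<noteq> {}" "Ix \<noteq> {}" "Iu \<noteq> {}"
  using intervals by (auto simp: open_interval_def)

lemma open_B: "open B"
  unfolding B_def by (intro open_Times intervals_open)

lemma convex_B: "convex B"
  unfolding B_def using intervals by (intro convex_Times) (simp_all add: open_interval_def is_interval_convex)

lemma related_quadr:
  assumes "f \<noteq> 0" "g \<noteq> 0" "H \<noteq> 0"
  shows "\<exists>f' g' h' H' K'.
    related (quadr f f1 x0, quadr g g1 x1, quadr h h1 x2, quadr H H1 u0, quadr K K1 u1) (f', g', h', H', K')"
proof -
  have adm: "admissible Ix Iu (quadr f f1 x0, quadr g g1 x1, quadr h h1 x2, quadr H H1 u0, quadr K K1 u1)"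
    by (intro admissible_quadr intervals_open assms)
  obtain \<theta>' where "related (quadr f f1 x0, quadr g g1 x1, quadr h h1 x2, quadr H H1 u0, quadr K K1 u1) \<theta>'"
    using transform[OF adm] adm unfolding related_def by blast
  then show ?thesis
    by (cases \<theta>') blast
qed

lemma smooth_PQR: "smooth_on B P" "smooth_on B Q" "smooth_on B R"
proof -
  have o: "open (B \<times> (UNIV :: elem_vals set))"
    by (intro open_Times open_B open_UNIV)
  have "smooth_on B (\<lambda>z. (z, 0 :: elem_vals))"
    by (intro smooth_on_intros open_B)
  from smooth_on_compose[OF T_smooth this o open_B]
  have "smooth_on B (\<lambda>z. T (z, 0))"
    by auto
  from smooth_on_fst[OF this open_B] have "smooth_on B (\<lambda>z. (P z, Q z, R z))"
    by (rule smooth_on_cong[OF open_B, THEN iffD1, rotated]) (simp add: fst_T)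
  from smooth_on_fst[OF this open_B] smooth_on_fst[OF smooth_on_snd[OF this open_B] open_B]
    smooth_on_snd[OF smooth_on_snd[OF this open_B] open_B]
  show "smooth_on B P" "smooth_on B Q" "smooth_on B R"
    by simp_all
qed

text \<open>Surjectivity of the derivative of \<open>T\<close> yields a direction in which (P, Q, R)
  has the derivative (\<alpha>, \<beta>, \<gamma>) itself; there the relation says that the sum of
  the three squares is 0. Nondegeneracy enters the later arguments in this form.\<close>

lemma gradients_independent:
  assumes z: "z \<in> B" and zero: "\<And>v. \<alpha> * dd v P z + \<beta> * dd v Q z + \<gamma> * dd v R z = 0"
  shows "\<alpha> = 0 \<and> \<beta> = 0 \<and> \<gamma> = 0"
proof -
  have o: "open (B \<times> (UNIV :: elem_vals set))"
    by (intro open_Times open_B open_UNIV)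
  have p: "(z, 0) \<in> B \<times> (UNIV :: elem_vals set)"
    using z by simp
  obtain v where v: "dd v T (z, 0) = ((\<alpha>, \<beta>, \<gamma>), 0)"
    using T_bij[OF p] unfolding dd_def bij_def surj_def by metis
  have "((\<lambda>p. fst (T p)) has_derivative (\<lambda>v. fst (dd v T (z, 0)))) (at (z, 0))"
    by (rule has_derivative_fst[OF smooth_on_has_derivative[OF T_smooth p]])
  then have "((\<lambda>p. (P (fst p), Q (fst p), R (fst p))) has_derivative (\<lambda>v. fst (dd v T (z, 0)))) (at (z, 0))"
    by (rule has_derivative_transform_within_open[OF _ o p]) (auto simp: fst_T)
  moreover have "((\<lambda>p. F (fst p)) has_derivative (\<lambda>v. dd (fst v) F z)) (at (z, 0 :: elem_vals))"
    if "smooth_on B F" for F :: "txu \<Rightarrow> real"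
    using diff_chain_at[OF has_derivative_fst[OF has_derivative_ident], of F "\<lambda>v. dd v F z" "(z, 0)"]
      smooth_on_has_derivative[OF that z] by (simp add: comp_def)
  then have "((\<lambda>p. (P (fst p), Q (fst p), R (fst p))) has_derivative
      (\<lambda>v. (dd (fst v) P z, dd (fst v) Q z, dd (fst v) R z))) (at (z, 0 :: elem_vals))"
    using smooth_PQR by (intro has_derivative_Pair) blast+
  ultimately have "(\<lambda>v. fst (dd v T (z, 0))) = (\<lambda>v. (dd (fst v) P z, dd (fst v) Q z, dd (fst v) R z))"
    by (rule has_derivative_unique)
  from fun_cong[OF this, of v] have "\<alpha> = dd (fst v) P z" "\<beta> = dd (fst v) Q z" "\<gamma> = dd (fst v) R z"
    by (simp_all add: v)
  then have "\<alpha> * \<alpha> + \<beta> * \<beta> + \<gamma> * \<gamma> = 0"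
    using zero[of "fst v"] by simp
  then show ?thesis
    by (smt (verit) mult_eq_0_iff zero_le_square)
qed


text \<open>The vectors \<open>v1\<close> and \<open>v2\<close> are tangent to the graph of \<open>w\<close> and are mapped to the new
  coordinate directions. The equivalence of the two equations is tested on all second-order jets
  over the first-order jet \<open>(p, q)\<close>, on which both equations are affine.\<close>

lemma jet_comparison:
  assumes rel: "related (f, g, h, H, K) (f', g', h', H', K')"
    and z: "z = (t, x, u)" "z \<in> B"
    and v: "v1 = (a1, b1, a1 * p + b1 * q)" "v2 = (a2, b2, a2 * p + b2 * q)"
    and dual: "dd v1 P z = 1" "dd v1 Q z = 0" "dd v2 P z = 0" "dd v2 Q z = 1"
    and S: "\<And>v. S v = dd v (dd v R) z - dd v1 R z * dd v (dd v P) z - dd v2 R z * dd v (dd v Q) z"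
    and \<kappa>: "\<kappa> = Du R z - dd v1 R z * Du P z - dd v2 R z * Du Q z"
    and F: "F = f' (Q z)" and c: "c = g' (Q z) * H' (R z)"
  obtains \<mu> where "\<kappa> \<noteq> 0" "F * a1 * b1 = c * a2 * b2"
    "\<kappa> * (F * a1\<^sup>2 - c * a2\<^sup>2) = \<mu> * f x" "\<kappa> * (F * b1\<^sup>2 - c * b2\<^sup>2) = - \<mu> * (g x * H u)"
    "F * S v1 - c * S v2 - g' (Q z) * deriv H' (R z) * (dd v2 R z)\<^sup>2
        - (deriv g' (Q z) * H' (R z) + h' (Q z) * K' (R z)) * dd v2 R z
      = - \<mu> * (g x * deriv H u * q\<^sup>2 + (deriv g x * H u + h x * K u) * q)"
proof -
  have adm: "admissible Ix Iu (f, g, h, H, K)" "admissible (Q ` B) (R ` B) (f', g', h', H', K')"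
    and tr: "transforms_equation B (\<lambda>z. (P z, Q z, R z)) (f, g, h, H, K) (f', g', h', H', K')"
    using rel by (auto simp: related_def)
  have xu: "x \<in> Ix" "u \<in> Iu"
    using z by (auto simp: B_def)
  note exp = dd_expand[OF smooth_PQR(1) z(2)] dd_expand[OF smooth_PQR(2) z(2)] dd_expand[OF smooth_PQR(3) z(2)]
  define P1 P2 Q1 Q2 where "P1 = dd (1, 0, p) P z" and "P2 = dd (0, 1, q) P z"
    and "Q1 = dd (1, 0, p) Q z" and "Q2 = dd (0, 1, q) Q z"
  have dual': "a1 * P1 + b1 * P2 = 1" "a1 * Q1 + b1 * Q2 = 0" "a2 * P1 + b2 * P2 = 0" "a2 * Q1 + b2 * Q2 = 1"
    using dual unfolding v P1_def P2_def Q1_def Q2_def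
      exp[of _ _ "a1 * p + b1 * q"] exp[of _ _ "a2 * p + b2 * q"] exp[of _ _ p] exp[of _ _ q]
    by (simp_all add: algebra_simps)
  \<comment> \<open>The dual conditions say that the total Jacobian of (P, Q) at the jet (p, q) and
    the matrix of (a1, b1), (a2, b2) are inverse to each other.\<close>
  have dets: "(P1 * Q2 - P2 * Q1) * (a1 * b2 - b1 * a2) = 1"
  proof -
    have "(P1 * Q2 - P2 * Q1) * (a1 * b2 - b1 * a2) =
        (a1 * P1 + b1 * P2) * (a2 * Q1 + b2 * Q2) - (a1 * Q1 + b1 * Q2) * (a2 * P1 + b2 * P2)"
      by (simp add: algebra_simps)
    then show ?thesis
      by (simp add: dual')
  qed
  have "\<kappa> \<noteq> 0"
  proof
    assume "\<kappa> = 0"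
    \<comment> \<open>If \<open>\<kappa>\<close> vanished, the linear form \<open>L\<close> would be
      zero on \<open>v1\<close>, \<open>v2\<close> and the u-direction, which span the space. But
      \<open>L = 0\<close> is a linear relation between the gradients in which that of R has
      coefficient 1.\<close>
    define L where "L v = dd v R z - dd v1 R z * dd v P z - dd v2 R z * dd v Q z" for v
    have L: "L (a, b, e) = a * L (1, 0, 0) + b * L (0, 1, 0) + e * L (0, 0, 1)" for a b e
      unfolding L_def exp[of a b e] by (simp add: algebra_simps)
    have "L (0, 0, 1) = 0"
      using \<open>\<kappa> = 0\<close> by (simp add: L_def \<kappa>)
    then have "a1 * L (1, 0, 0) + b1 * L (0, 1, 0) = 0" "a2 * L (1, 0, 0) + b2 * L (0, 1, 0) = 0"
      using L[of a1 b1 "a1 * p + b1 * q"] L[of a2 b2 "a2 * p + b2 * q"] by (simp_all add: L_def v[symmetric] dual)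
    then have "(a1 * b2 - b1 * a2) * L (1, 0, 0) = 0" "(a1 * b2 - b1 * a2) * L (0, 1, 0) = 0"
      by algebra+
    moreover have "a1 * b2 - b1 * a2 \<noteq> 0"
      using dets by auto
    ultimately have "L (a, b, e) = 0" for a b e
      using L[of a b e] \<open>L (0, 0, 1) = 0\<close> by simp
    then have L0: "L v = 0" for v
      by (cases v) simp
    have "- dd v1 R z * dd v P z + - dd v2 R z * dd v Q z + 1 * dd v R z = 0" for v
      using L0[of v] by (simp add: L_def)
    from gradients_independent[OF z(2) this] show False
      by simp
  qed
  define l where "l = g x * deriv H u * q\<^sup>2 + (deriv g x * H u + h x * K u) * q"
  define l' where "l' = g' (Q z) * deriv H' (R z) * (dd v2 R z)\<^sup>2
      + (deriv g' (Q z) * H' (R z) + h' (Q z) * K' (R z)) * dd v2 R z"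
  \<comment> \<open>\<open>S v1\<close> and \<open>S v2\<close> are the parts of the pure second
    derivatives of \<open>w'\<close> that the first-order jet determines; the second derivatives of
    \<open>w\<close> enter with the factor \<open>\<kappa>\<close>. This makes the new equation
    affine in (A, C, D).\<close>
  have equiv: "f x * A = g x * H u * D + l \<longleftrightarrow>
      (\<kappa> * (F * a1\<^sup>2 - c * a2\<^sup>2)) * A + (2 * \<kappa> * (F * a1 * b1 - c * a2 * b2)) * C
        + (\<kappa> * (F * b1\<^sup>2 - c * b2\<^sup>2)) * D = l' - (F * S v1 - c * S v2)" for A C D
  proof -
    have det: "dd (1, 0, p) P z * dd (0, 1, q) Q z - dd (0, 1, q) P z * dd (1, 0, p) Q z \<noteq> 0"
      using dets by (auto simp: P1_def P2_def Q1_def Q2_def)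
    show ?thesis
    proof (rule jet_realisation[OF open_B smooth_PQR z det, of A C D])
      fix W w W' w'
      assume w: "open W" "smooth_on W w" "graph_on W w \<subseteq> B" "open W'" "smooth_on W' w'"
      and gr: "(\<lambda>z. (P z, Q z, R z)) ` graph_on W w = graph_on W' w'"
      and pt: "(t, x) \<in> W" "w (t, x) = u" "(P z, Q z) \<in> W'" "w' (P z, Q z) = R z"
      and j1: "\<And>a b. dd (a, b) w (t, x) = a * p + b * q"
      and j2: "\<And>a b. dd (a, b) (dd (a, b) w) (t, x) = a\<^sup>2 * A + 2 * a * b * C + b\<^sup>2 * D"
      and k1: "\<And>a b v. v = (a, b, a * p + b * q) \<Longrightarrow> dd v R z = dd (dd v P z, dd v Q z) w' (P z, Q z)"
      and k2: "\<And>a b v e m. v = (a, b, a * p + b * q) \<Longrightarrow> e = (dd v P z, dd v Q z) \<Longrightarrow>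
        m = a\<^sup>2 * A + 2 * a * b * C + b\<^sup>2 * D \<Longrightarrow>
        dd v (dd v R) z + m * Du R z = dd e (dd e w') (P z, Q z) +
          dd (dd v (dd v P) z + m * Du P z, dd v (dd v Q) z + m * Du Q z) w' (P z, Q z)"
    have e1: "equation_holds (f, g, h, H, K) w (t, x) \<longleftrightarrow> f x * A = g x * H u * D + l"
      unfolding admissible_equation_iff[OF adm(1) xu w(2,1) pt(1,2)] j1 j2 by (simp add: l_def add.assoc)
    have z': "Q z \<in> Q ` B" "R z \<in> R ` B"
      using z(2) by auto
    have w1: "dd (1, 0) w' (P z, Q z) = dd v1 R z" "dd (0, 1) w' (P z, Q z) = dd v2 R z"
      using k1[OF v(1)] k1[OF v(2)] by (simp_all add: dual)
    have w2: "dd (a, b) w' (P z, Q z) = a * dd v1 R z + b * dd v2 R z" for a b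
      using dd_plane_expand[OF w(5) pt(3), of a b] by (simp add: w1)
    have w3: "dd (1, 0) (dd (1, 0) w') (P z, Q z) = S v1 + \<kappa> * (a1\<^sup>2 * A + 2 * a1 * b1 * C + b1\<^sup>2 * D)"
      using k2[OF v(1) refl refl] unfolding w2 dual S \<kappa> by (simp add: algebra_simps)
    have w4: "dd (0, 1) (dd (0, 1) w') (P z, Q z) = S v2 + \<kappa> * (a2\<^sup>2 * A + 2 * a2 * b2 * C + b2\<^sup>2 * D)"
      using k2[OF v(2) refl refl] unfolding w2 dual S \<kappa> by (simp add: algebra_simps)
    have e2: "equation_holds (f', g', h', H', K') w' (P z, Q z) \<longleftrightarrow>
        F * (S v1 + \<kappa> * (a1\<^sup>2 * A + 2 * a1 * b1 * C + b1\<^sup>2 * D)) =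
        c * (S v2 + \<kappa> * (a2\<^sup>2 * A + 2 * a2 * b2 * C + b2\<^sup>2 * D)) + l'"
      unfolding admissible_equation_iff[OF adm(2) z' w(5,4) pt(3,4)] w1 w3 w4 by (simp add: l'_def F c add.assoc)
    have "equation_holds (f, g, h, H, K) w (t, x) \<longleftrightarrow> equation_holds (f', g', h', H', K') w' (P z, Q z)"
      using bspec[OF mp[OF tr[unfolded transforms_equation_def, THEN spec, THEN spec, THEN spec, THEN spec]
            conjI[OF w(1) conjI[OF w(2) conjI[OF w(3) conjI[OF w(4) conjI[OF w(5) gr]]]]]] pt(1)]
      by (simp add: pt(2) z(1)[symmetric])
    then show ?thesis
      unfolding e1 e2 by (simp add: algebra_simps)
    qed
  qed
  have "f x \<noteq> 0"
    using adm(1) xu by auto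
  obtain \<mu> where \<mu>: "2 * \<kappa> * (F * a1 * b1 - c * a2 * b2) = 0" "\<kappa> * (F * a1\<^sup>2 - c * a2\<^sup>2) = \<mu> * f x"
    "\<kappa> * (F * b1\<^sup>2 - c * b2\<^sup>2) = - \<mu> * (g x * H u)" "l' - (F * S v1 - c * S v2) = \<mu> * l"
    by (rule proportional_affine_functionals[OF \<open>f x \<noteq> 0\<close> equiv])
  show thesis
  proof (rule that[OF \<open>\<kappa> \<noteq> 0\<close> _ \<mu>(2,3)])
    show "F * a1 * b1 = c * a2 * b2"
      using \<mu>(1) \<open>\<kappa> \<noteq> 0\<close> by simp
    show "F * S v1 - c * S v2 - g' (Q z) * deriv H' (R z) * (dd v2 R z)\<^sup>2
        - (deriv g' (Q z) * H' (R z) + h' (Q z) * K' (R z)) * dd v2 R z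
      = - \<mu> * (g x * deriv H u * q\<^sup>2 + (deriv g x * H u + h x * K u) * q)"
      using \<mu>(4) by (simp add: l_def[symmetric] l'_def)
  qed
qed


section \<open>Principal part: the first-order derivatives of P and Q\<close>

lemma related_nonzero:
  assumes "related (f, g, h, H, K) (f', g', h', H', K')" "z \<in> B"
  shows "f' (Q z) \<noteq> 0" "g' (Q z) \<noteq> 0" "H' (R z) \<noteq> 0"
  using assms by (auto simp: related_def)

lemma related_nonzero':
  assumes "related (f, g, h, H, K) (f', g', h', H', K')" "(t, x, u) \<in> B"
  shows "f x \<noteq> 0" "g x \<noteq> 0" "H u \<noteq> 0"
  using assms by (auto simp: related_def B_def)

text \<open>These minors are the coefficients of 1, p and q in the Jacobian of (P, Q) along a graph
  with jet (p, q). If all vanished, P_a dQ - Q_a dP would be zero for every coordinate direction a,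
  so each P_a would be 0 by independence, and then dP = 0, again contradicting independence.\<close>

lemma minors_nonzero:
  assumes z: "z \<in> B"
  defines "M a b \<equiv> dd a P z * dd b Q z - dd b P z * dd a Q z"
  shows "(M (1, 0, 0) (0, 1, 0), M (0, 0, 1) (0, 1, 0), M (1, 0, 0) (0, 0, 1)) \<noteq> (0, 0, 0)"
proof
  assume 0: "(M (1, 0, 0) (0, 1, 0), M (0, 0, 1) (0, 1, 0), M (1, 0, 0) (0, 0, 1)) = (0, 0, 0)"
  then have minors: "M (1, 0, 0) (0, 1, 0) = 0" "M (0, 0, 1) (0, 1, 0) = 0" "M (1, 0, 0) (0, 0, 1) = 0"
    by auto
  have "M (0, 1, 0) (1, 0, 0) = - M (1, 0, 0) (0, 1, 0)" "M (0, 1, 0) (0, 0, 1) = - M (0, 0, 1) (0, 1, 0)"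
    "M (0, 0, 1) (1, 0, 0) = - M (1, 0, 0) (0, 0, 1)"
    "M (1, 0, 0) (1, 0, 0) = 0" "M (0, 1, 0) (0, 1, 0) = 0" "M (0, 0, 1) (0, 0, 1) = 0"
    by (simp_all add: M_def)
  note minors' = this[unfolded minors neg_0_equal_iff_equal minus_zero]
  have all: "M a (b1, b2, b3) = 0" if "a \<in> {(1, 0, 0), (0, 1, 0), (0, 0, 1)}" for a b1 b2 b3
  proof -
    have "M a (b1, b2, b3) = b1 * M a (1, 0, 0) + b2 * M a (0, 1, 0) + b3 * M a (0, 0, 1)"
      unfolding M_def dd_expand[OF smooth_PQR(1) z, of b1 b2 b3] dd_expand[OF smooth_PQR(2) z, of b1 b2 b3]
      by (simp add: algebra_simps)
    also have "\<dots> = 0"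
      using that minors minors' by auto
    finally show ?thesis .
  qed
  have "dd a P z = 0" if "a \<in> {(1, 0, 0), (0, 1, 0), (0, 0, 1)}" for a
  proof -
    have "- dd a Q z * dd v P z + dd a P z * dd v Q z + 0 * dd v R z = 0" for v
      using all[OF that] by (cases v) (simp add: M_def)
    from gradients_independent[OF z this] show ?thesis
      by simp
  qed
  then have "dd (a, b, c) P z = 0" for a b c
    unfolding dd_expand[OF smooth_PQR(1) z, of a b c] by simp
  then have "dd v P z = 0" for v
    by (cases v) simp
  then have "1 * dd v P z + 0 * dd v Q z + 0 * dd v R z = 0" for v
    by simp
  from gradients_independent[OF z this] show False
    by simp
qed

text \<open>For every jet (p, q) with nonzero Jacobian the mixed coefficient gives F (Q_x + q Q_u)
  (Q_t + p Q_u) = c (P_x + q P_u) (P_t + p P_u), where F and c depend on the point and the elements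
  but not on the jet. So the coefficients of 1, p, q and p q agree; with P_u nonzero they would make
  dP and dQ linearly dependent.\<close>

lemma u_derivatives_vanish:
  assumes z: "z \<in> B"
  shows "Du P z = 0" "Du Q z = 0"
proof -
  obtain t x u where txu: "z = (t, x, u)"
    by (cases z)
  obtain f' g' h' H' K' where rel: "related (quadr 1 0 x, quadr 1 0 x, quadr 1 0 x, quadr 1 0 u, quadr 1 0 u) (f', g', h', H', K')"
    using related_quadr[of 1 1 1 0 x 0 x 1 0 x 0 u 1 0 u] by auto
  define F where "F = f' (Q z)"
  define c where "c = g' (Q z) * H' (R z)"
  have nz: "F \<noteq> 0" "c \<noteq> 0"
    using related_nonzero[OF rel z] by (simp_all add: F_def c_def)
  define Pt Px Pu Qt Qx Qu where "Pt = Dt P z" and "Px = Dx P z" and "Pu = Du P z"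
    and "Qt = Dt Q z" and "Qx = Dx Q z" and "Qu = Du Q z"
  have P: "dd (a, b, e) P z = a * Pt + b * Px + e * Pu" and Q: "dd (a, b, e) Q z = a * Qt + b * Qx + e * Qu" for a b e
    unfolding Pt_def Px_def Pu_def Qt_def Qx_def Qu_def using dd_expand[OF smooth_PQR(1) z] dd_expand[OF smooth_PQR(2) z]
    by blast+
  have poly: "F * Qx * Qt - c * Px * Pt = 0 \<and> F * Qx * Qu - c * Px * Pu = 0 \<and> F * Qu * Qt - c * Pu * Pt = 0 \<and>
      F * Qu * Qu - c * Pu * Pu = 0"
  proof (rule bilinear_zero)
    show "(Pt * Qx - Px * Qt, Pu * Qx - Px * Qu, Pt * Qu - Pu * Qt) \<noteq> (0, 0, 0)"
      using minors_nonzero[OF z] by (simp add: Pt_def Px_def Pu_def Qt_def Qx_def Qu_def)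
    fix p q
    define \<Delta> where "\<Delta> = Pt * Qx - Px * Qt + p * (Pu * Qx - Px * Qu) + q * (Pt * Qu - Pu * Qt)"
    assume "Pt * Qx - Px * Qt + p * (Pu * Qx - Px * Qu) + q * (Pt * Qu - Pu * Qt) \<noteq> 0"
    then have \<Delta>: "\<Delta> \<noteq> 0"
      by (simp add: \<Delta>_def)
    define i where "i = inverse \<Delta>"
    have i: "i * \<Delta> = 1" "i \<noteq> 0"
      using \<Delta> by (simp_all add: i_def)
    \<comment> \<open>The inverse of the total Jacobian at (p, q), again by Cramer's rule with
      \<open>i\<close> the reciprocal determinant.\<close>
    define a1 b1 a2 b2 where "a1 = i * (Qx + q * Qu)" and "b1 = - i * (Qt + p * Qu)"
      and "a2 = - i * (Px + q * Pu)" and "b2 = i * (Pt + p * Pu)"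
    note defs = a1_def b1_def a2_def b2_def
    have dual: "dd (a1, b1, a1 * p + b1 * q) P z = 1" "dd (a1, b1, a1 * p + b1 * q) Q z = 0"
      "dd (a2, b2, a2 * p + b2 * q) P z = 0" "dd (a2, b2, a2 * p + b2 * q) Q z = 1"
      unfolding P Q i(1)[symmetric] defs \<Delta>_def by algebra+
    have "F * a1 * b1 = c * a2 * b2"
      by (rule jet_comparison[OF rel txu z refl refl dual refl refl F_def c_def])
    moreover have "i * i * (F * Qx * Qt - c * Px * Pt + p * (F * Qx * Qu - c * Px * Pu) + q * (F * Qu * Qt - c * Pu * Pt) +
        p * q * (F * Qu * Qu - c * Pu * Pu)) = c * a2 * b2 - F * a1 * b1"
      unfolding defs by (simp add: algebra_simps)
    ultimately have "i * i * (F * Qx * Qt - c * Px * Pt + p * (F * Qx * Qu - c * Px * Pu) +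
        q * (F * Qu * Qt - c * Pu * Pt) + p * q * (F * Qu * Qu - c * Pu * Pu)) = 0"
      by simp
    then show "F * Qx * Qt - c * Px * Pt + p * (F * Qx * Qu - c * Px * Pu) + q * (F * Qu * Qt - c * Pu * Pt) +
        p * q * (F * Qu * Qu - c * Pu * Pu) = 0"
      using i(2) by (simp only: mult_eq_0_iff simp_thms)
  qed
  have "Pu = 0"
  proof (rule ccontr)
    assume "Pu \<noteq> 0"
    \<comment> \<open>F is eliminated by means of the p q coefficient, which leaves the minors of
      (dP, dQ) in the (t, u) and (x, u) directions.\<close>
    have "c * Pu * (Qt * Pu - Qu * Pt) = Qu * (F * Qu * Qt - c * Pu * Pt) - Qt * (F * Qu * Qu - c * Pu * Pu)"
      "c * Pu * (Qx * Pu - Qu * Px) = Qu * (F * Qx * Qu - c * Px * Pu) - Qx * (F * Qu * Qu - c * Pu * Pu)"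
      by (simp_all add: algebra_simps)
    then have "c * Pu * (Qt * Pu - Qu * Pt) = 0" "c * Pu * (Qx * Pu - Qu * Px) = 0"
      using poly by (simp_all only: mult_zero_right diff_self)
    then have "Qt * Pu - Qu * Pt = 0" "Qx * Pu - Qu * Px = 0"
      using nz \<open>Pu \<noteq> 0\<close> by simp_all
    moreover have "- Qu * dd (a, b, e) P z + Pu * dd (a, b, e) Q z + 0 * dd (a, b, e) R z =
        a * (Qt * Pu - Qu * Pt) + b * (Qx * Pu - Qu * Px)" for a b e
      unfolding P Q by (simp add: algebra_simps)
    ultimately have "- Qu * dd (a, b, e) P z + Pu * dd (a, b, e) Q z + 0 * dd (a, b, e) R z = 0" for a b e
      by (simp only: mult_zero_right add_0)
    then have "- Qu * dd v P z + Pu * dd v Q z + 0 * dd v R z = 0" for v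
      by (cases v) (simp only:)
    from gradients_independent[OF z this] show False
      using \<open>Pu \<noteq> 0\<close> by simp
  qed
  moreover from this poly have "Qu = 0"
    using nz by simp
  ultimately show "Du P z = 0" "Du Q z = 0"
    by (simp_all add: Pu_def Qu_def)
qed

lemma determinant_nonzero:
  assumes "z \<in> B"
  shows "Dt P z * Dx Q z - Dx P z * Dt Q z \<noteq> 0"
  using minors_nonzero[OF assms] u_derivatives_vanish[OF assms] by simp

text \<open>With P_u = Q_u = 0 the total derivatives of P and Q are the same for all (p, q), so the
  comparison is made at p = q = 0. The second relation results from eliminating \<open>\<mu>\<close>
  between the coefficients of A and D.\<close>

lemma principal_parts:
  assumes rel: "related (f, g, h, H, K) (f', g', h', H', K')" and z: "z = (t, x, u)" "z \<in> B"
    and F: "F = f' (Q z)" and c: "c = g' (Q z) * H' (R z)"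
  shows "F * Dx Q z * Dt Q z = c * Dx P z * Dt P z"
    and "g x * H u * (F * (Dx Q z)\<^sup>2 - c * (Dx P z)\<^sup>2) =
      - f x * (F * (Dt Q z)\<^sup>2 - c * (Dt P z)\<^sup>2)"
proof -
  define Pt Px Qt Qx where "Pt = Dt P z" and "Px = Dx P z"
    and "Qt = Dt Q z" and "Qx = Dx Q z"
  have P: "dd (a, b, e) P z = a * Pt + b * Px" and Q: "dd (a, b, e) Q z = a * Qt + b * Qx" for a b e
    unfolding Pt_def Px_def Qt_def Qx_def dd_expand[OF smooth_PQR(1) z(2), of a b e]
      dd_expand[OF smooth_PQR(2) z(2), of a b e] using u_derivatives_vanish[OF z(2)] by simp_all
  define i where "i = inverse (Pt * Qx - Px * Qt)"
  have i: "i * (Pt * Qx - Px * Qt) = 1" "i \<noteq> 0"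
    using determinant_nonzero[OF z(2)] by (simp_all add: i_def Pt_def Px_def Qt_def Qx_def)
  define a1 b1 a2 b2 where "a1 = i * Qx" and "b1 = - i * Qt" and "a2 = - i * Px" and "b2 = i * Pt"
  note defs = a1_def b1_def a2_def b2_def
  have dual: "dd (a1, b1, a1 * 0 + b1 * 0) P z = 1" "dd (a1, b1, a1 * 0 + b1 * 0) Q z = 0"
    "dd (a2, b2, a2 * 0 + b2 * 0) P z = 0" "dd (a2, b2, a2 * 0 + b2 * 0) Q z = 1"
    unfolding P Q i(1)[symmetric] defs by (simp_all add: algebra_simps)
  let ?v1 = "(a1, b1, a1 * 0 + b1 * 0)" and ?v2 = "(a2, b2, a2 * 0 + b2 * 0)"
  define S where "S v = dd v (dd v R) z - dd ?v1 R z * dd v (dd v P) z - dd ?v2 R z * dd v (dd v Q) z" for v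
  define \<kappa> where "\<kappa> = Du R z - dd ?v1 R z * Du P z - dd ?v2 R z * Du Q z"
  have *: "i * i * (F * Qx * Qt) = i * i * (c * Px * Pt) \<and>
    (\<kappa> * (i * i)) * (g x * H u * (F * Qx\<^sup>2 - c * Px\<^sup>2)) = (\<kappa> * (i * i)) * (- f x * (F * Qt\<^sup>2 - c * Pt\<^sup>2)) \<and> \<kappa> \<noteq> 0"
  proof (rule jet_comparison[OF rel z refl refl dual S_def \<kappa>_def F c])
    fix \<mu>
    assume "\<kappa> \<noteq> 0" and 1: "F * a1 * b1 = c * a2 * b2" and 2: "\<kappa> * (F * a1\<^sup>2 - c * a2\<^sup>2) = \<mu> * f x"
      and 3: "\<kappa> * (F * b1\<^sup>2 - c * b2\<^sup>2) = - \<mu> * (g x * H u)"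
    have m1: "(\<kappa> * (i * i)) * (g x * H u * (F * Qx\<^sup>2 - c * Px\<^sup>2)) = g x * H u * (\<kappa> * (F * a1\<^sup>2 - c * a2\<^sup>2))"
      and m2: "(\<kappa> * (i * i)) * (- f x * (F * Qt\<^sup>2 - c * Pt\<^sup>2)) = - f x * (\<kappa> * (F * b1\<^sup>2 - c * b2\<^sup>2))"
      by (simp_all add: defs algebra_simps power2_eq_square)
    have eq: "g x * H u * (\<mu> * f x) = - f x * (- \<mu> * (g x * H u))"
      by simp
    note trans[OF m1[unfolded 2] trans[OF eq m2[unfolded 3, symmetric]]]
    moreover have "i * i * (F * Qx * Qt) = i * i * (c * Px * Pt)"
      using 1 by (simp add: defs algebra_simps)
    ultimately show ?thesis
      using \<open>\<kappa> \<noteq> 0\<close> by blast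
  qed
  then show "F * Qx * Qt = c * Px * Pt" "g x * H u * (F * Qx\<^sup>2 - c * Px\<^sup>2) = - f x * (F * Qt\<^sup>2 - c * Pt\<^sup>2)"
    using i(2) by (auto simp only: mult_cancel_left mult_eq_0_iff)
qed

text \<open>Elements with f = H = 1 and with g = 1 or g = 2 at the point are compared. If Q_x Q_t
  were nonzero, the first relation of the principal parts would give F / c the same value r in both
  cases; the second relation, taken for both values of g, would then force r Q_x^2 = P_x^2 and r
  Q_t^2 = P_t^2, hence a zero determinant.\<close>

lemma two_alternatives:
  assumes z: "z \<in> B"
  shows "Dx P z = 0 \<and> Dt Q z = 0 \<or> Dt P z = 0 \<and> Dx Q z = 0"
proof -
  obtain t x u where txu: "z = (t, x, u)"
    by (cases z)
  define Pt Px Qt Qx where "Pt = Dt P z" and "Px = Dx P z"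
    and "Qt = Dt Q z" and "Qx = Dx Q z"
  note defs = Pt_def[symmetric] Px_def[symmetric] Qt_def[symmetric] Qx_def[symmetric]
  have parts: "\<exists>F c. F \<noteq> 0 \<and> c \<noteq> 0 \<and> F * Qx * Qt = c * Px * Pt \<and>
      g * (F * Qx\<^sup>2 - c * Px\<^sup>2) = - (F * Qt\<^sup>2 - c * Pt\<^sup>2)" if g: "g \<noteq> 0" for g
  proof -
    obtain f' g' h' H' K' where
      rel: "related (quadr 1 0 x, quadr g 0 x, quadr 1 0 x, quadr 1 0 u, quadr 1 0 u) (f', g', h', H', K')"
      using related_quadr[of 1 g 1 0 x 0 x 1 0 x 0 u 1 0 u] g by auto
    show ?thesis
      using related_nonzero[OF rel z] principal_parts[OF rel txu z refl refl]
      by (intro exI[of _ "f' (Q z)"] exI[of _ "g' (Q z) * H' (R z)"]) (simp add: defs)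
  qed
  obtain F1 c1 where 1: "F1 \<noteq> 0" "c1 \<noteq> 0" "F1 * Qx * Qt = c1 * Px * Pt"
    "1 * (F1 * Qx\<^sup>2 - c1 * Px\<^sup>2) = - (F1 * Qt\<^sup>2 - c1 * Pt\<^sup>2)"
    using parts[of 1] by auto
  obtain F2 c2 where 2: "F2 \<noteq> 0" "c2 \<noteq> 0" "F2 * Qx * Qt = c2 * Px * Pt"
    "2 * (F2 * Qx\<^sup>2 - c2 * Px\<^sup>2) = - (F2 * Qt\<^sup>2 - c2 * Pt\<^sup>2)"
    using parts[of 2] by auto
  have det: "Pt * Qx - Px * Qt \<noteq> 0"
    using determinant_nonzero[OF z] by (simp add: defs)
  have "Qx * Qt = 0"
  proof (rule ccontr)
    assume nz: "Qx * Qt \<noteq> 0"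
    define r where "r = Px * Pt / (Qx * Qt)"
    have F: "F1 = r * c1" "F2 = r * c2"
      using 1(3) 2(3) nz by (simp_all add: r_def field_simps)
    have "c1 * ((r * Qx\<^sup>2 - Px\<^sup>2) + (r * Qt\<^sup>2 - Pt\<^sup>2)) = 0" "c2 * (2 * (r * Qx\<^sup>2 - Px\<^sup>2) + (r * Qt\<^sup>2 - Pt\<^sup>2)) = 0"
      using 1(4) 2(4) unfolding F by (simp_all add: algebra_simps)
    then have "r * Qx\<^sup>2 = Px\<^sup>2" "r * Qt\<^sup>2 = Pt\<^sup>2"
      using 1(2) 2(2) by simp_all
    moreover have "r * (Qx * Qt) = Px * Pt"
      using nz by (simp add: r_def)
    moreover have "(Pt * Qx - Px * Qt)\<^sup>2 = Pt\<^sup>2 * Qx\<^sup>2 - 2 * (Px * Pt) * (Qx * Qt) + Px\<^sup>2 * Qt\<^sup>2"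
      by (simp add: power2_eq_square algebra_simps)
    ultimately have "(Pt * Qx - Px * Qt)\<^sup>2 = (r * Qt\<^sup>2) * Qx\<^sup>2 - 2 * (r * (Qx * Qt)) * (Qx * Qt) + (r * Qx\<^sup>2) * Qt\<^sup>2"
      by simp
    also have "\<dots> = 0"
      by (simp add: power2_eq_square algebra_simps)
    finally show False
      using det by simp
  qed
  moreover from this have "c1 * (Px * Pt) = 0"
    using 1(3) by (simp only: mult.assoc mult_zero_right)
  then have "Px * Pt = 0"
    using 1(2) by simp
  ultimately show ?thesis
    using det unfolding defs by auto
qed

lemma dd_dd_R_expand:
  assumes z: "z \<in> B" and v: "v = (a, b, e)"
  shows "dd v (dd v R) z = a * a * Dt (Dt R) z + b * b * Dx (Dx R) z
    + e * e * Du (Du R) z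
    + a * b * (Dt (Dx R) z + Dx (Dt R) z)
    + a * e * (Dt (Du R) z + Du (Dt R) z)
    + b * e * (Dx (Du R) z + Du (Dx R) z)"
  unfolding v dd_expand2[OF smooth_PQR(3) z open_B, of "(a, b, e)" a b e]
  unfolding dd_expand[OF smooth_on_dd[OF smooth_PQR(3)] z, of a b e]
  by (simp add: algebra_simps)

lemma dd_dd_PQ_expand:
  assumes z: "z \<in> B" and v: "v = (a, b, e)" and F: "F = P \<or> F = Q"
  shows "dd v (dd v F) z = a * a * Dt (Dt F) z + b * b * Dx (Dx F) z
    + a * b * (Dt (Dx F) z + Dx (Dt F) z)"
proof -
  have sm: "smooth_on B F" and zero: "\<And>z. z \<in> B \<Longrightarrow> Du F z = 0"
    using F smooth_PQR u_derivatives_vanish by auto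
  show ?thesis
    unfolding v dd_expand2[OF sm z open_B, of "(a, b, e)" a b e]
    unfolding dd_expand[OF smooth_on_dd[OF sm] z, of a b e]
    using dd_dd_zero[OF sm open_B convex_B zero z] by (simp add: algebra_simps)
qed

text \<open>It remains to exclude P_t = Q_x = 0. There the term with H_u of the new equation
  involves R_t only, so q^2 enters through R_uu on the new side and through H_u on the old side.
  With g = H = 1 at the point, its coefficient gives R_uu = R_u H_u for each prescribed H_u.\<close>

lemma cross_derivatives_vanish:
  assumes z: "z \<in> B"
  shows "Dx P z = 0" "Dt Q z = 0"
proof -
  obtain t x u where txu: "z = (t, x, u)"
    by (cases z)
  define Pt Px Qt Qx where "Pt = Dt P z" and "Px = Dx P z"
    and "Qt = Dt Q z" and "Qx = Dx Q z"
  define Rt Rx Ru where "Rt = Dt R z" and "Rx = Dx R z" and "Ru = Du R z"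
  note D = Pt_def[symmetric] Px_def[symmetric] Qt_def[symmetric] Qx_def[symmetric]
    Rt_def[symmetric] Rx_def[symmetric] Ru_def[symmetric]
  have swap: "\<not> (Pt = 0 \<and> Qx = 0)"
  proof
    assume 0: "Pt = 0 \<and> Qx = 0"
    have P: "dd (a, b, e) P z = b * Px" and Q: "dd (a, b, e) Q z = a * Qt"
      and R: "dd (a, b, e) R z = a * Rt + b * Rx + e * Ru" for a b e
      using 0 u_derivatives_vanish[OF z] dd_expand[OF smooth_PQR(1) z, of a b e]
        dd_expand[OF smooth_PQR(2) z, of a b e] dd_expand[OF smooth_PQR(3) z, of a b e] by (simp_all add: D)
    define i k where "i = inverse Px" and "k = inverse Qt"
    have ik: "i * Px = 1" "k * Qt = 1" "i \<noteq> 0"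
      using determinant_nonzero[OF z] 0 by (simp_all add: D i_def k_def)
    define R11 R22 R33 R23 where "R11 = Dt (Dt R) z" and "R22 = Dx (Dx R) z"
      and "R33 = Du (Du R) z"
      and "R23 = Dx (Du R) z + Du (Dx R) z"
    define P11 P22 Q11 Q22 where "P11 = Dt (Dt P) z" and "P22 = Dx (Dx P) z"
      and "Q11 = Dt (Dt Q) z" and "Q22 = Dx (Dx Q) z"
    note DD = R11_def[symmetric] R22_def[symmetric] R33_def[symmetric] R23_def[symmetric]
      P11_def[symmetric] P22_def[symmetric] Q11_def[symmetric] Q22_def[symmetric]
    have R33: "R33 = Ru * H1 \<and> Ru \<noteq> 0" for H1
    proof -
      obtain f' g' h' H' K' where
        rel: "related (quadr 1 0 x, quadr 1 0 x, quadr 1 0 x, quadr 1 H1 u, quadr 1 0 u) (f', g', h', H', K')"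
        using related_quadr[of 1 1 1 0 x 0 x 1 0 x H1 u 1 0 u] by auto
      define F c where "F = f' (Q z)" and "c = g' (Q z) * H' (R z)"
      have "F \<noteq> 0"
        using related_nonzero[OF rel z] by (simp add: F_def)
      define G L where "G = g' (Q z) * deriv H' (R z)" and "L = deriv g' (Q z) * H' (R z) + h' (Q z) * K' (R z)"
      have *: "(F * (i * i * R22 - i * Rx * (i * i * P22) - k * Rt * (i * i * Q22))
            - c * (k * k * R11 - i * Rx * (k * k * P11) - k * Rt * (k * k * Q11)) - G * (k * Rt)\<^sup>2 - L * (k * Rt))
          + (F * (i * i * R23 - i * Ru * (i * i * P22)) + c * (i * Ru * (k * k * P11)) - Ru * F * (i * i)) * q
          + (F * (i * i) * (R33 - Ru * H1)) * q\<^sup>2 = 0 \<and> Ru \<noteq> 0" for q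
      proof -
        let ?v1 = "(0, i, 0 * 0 + i * q)" and ?v2 = "(k, 0, k * 0 + 0 * q)"
        have dual: "dd ?v1 P z = 1" "dd ?v1 Q z = 0" "dd ?v2 P z = 0" "dd ?v2 Q z = 1"
          unfolding P Q ik by simp_all
        define S where "S v = dd v (dd v R) z - dd ?v1 R z * dd v (dd v P) z - dd ?v2 R z * dd v (dd v Q) z" for v
        define \<kappa> where "\<kappa> = Du R z - dd ?v1 R z * Du P z - dd ?v2 R z * Du Q z"
        have \<kappa>: "\<kappa> = Ru"
          using u_derivatives_vanish[OF z] by (simp add: \<kappa>_def D)
        have S1: "S ?v1 = i * i * R22 + i * q * (i * q) * R33 + i * (i * q) * R23
            - (i * Rx + i * q * Ru) * (i * i * P22) - k * Rt * (i * i * Q22)"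
          unfolding S_def dd_dd_R_expand[OF z refl, of 0 i "0 * 0 + i * q"]
            dd_dd_PQ_expand[OF z refl disjI1[OF refl], of 0 i "0 * 0 + i * q"]
            dd_dd_PQ_expand[OF z refl disjI2[OF refl], of 0 i "0 * 0 + i * q"] R DD by simp
        have S2: "S ?v2 = k * k * R11 - (i * Rx + i * q * Ru) * (k * k * P11) - k * Rt * (k * k * Q11)"
          unfolding S_def dd_dd_R_expand[OF z refl, of k 0 "k * 0 + 0 * q"]
            dd_dd_PQ_expand[OF z refl disjI1[OF refl], of k 0 "k * 0 + 0 * q"]
            dd_dd_PQ_expand[OF z refl disjI2[OF refl], of k 0 "k * 0 + 0 * q"] R DD by simp
        show ?thesis
        proof (rule jet_comparison[OF rel txu z refl refl dual S_def \<kappa>_def F_def c_def])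
          fix \<mu>
          assume "\<kappa> \<noteq> 0" and \<mu>: "\<kappa> * (F * i\<^sup>2 - c * 0\<^sup>2) = - \<mu> * (quadr 1 0 x x * quadr 1 H1 u u)"
            and eq: "F * S ?v1 - c * S ?v2 - g' (Q z) * deriv H' (R z) * (dd ?v2 R z)\<^sup>2
              - (deriv g' (Q z) * H' (R z) + h' (Q z) * K' (R z)) * dd ?v2 R z
              = - \<mu> * (quadr 1 0 x x * deriv (quadr 1 H1 u) u * q\<^sup>2
                + (deriv (quadr 1 0 x) x * quadr 1 H1 u u + quadr 1 0 x x * quadr 1 0 u u) * q)"
          have \<mu>': "- \<mu> = Ru * F * (i * i)"
            using \<mu> by (simp add: \<kappa> power2_eq_square)
          have "F * (i * i * R22 + i * q * (i * q) * R33 + i * (i * q) * R23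
              - (i * Rx + i * q * Ru) * (i * i * P22) - k * Rt * (i * i * Q22))
            - c * (k * k * R11 - (i * Rx + i * q * Ru) * (k * k * P11) - k * Rt * (k * k * Q11))
            - G * (k * Rt)\<^sup>2 - L * (k * Rt) = Ru * F * (i * i) * (H1 * q\<^sup>2 + q)"
            using eq unfolding S1 S2 \<mu>' R G_def[symmetric] L_def[symmetric] by simp
          then show ?thesis
            using \<open>\<kappa> \<noteq> 0\<close> \<kappa> by (simp add: algebra_simps power2_eq_square)
        qed
      qed
      have "F * (i * i) * (R33 - Ru * H1) = 0"
        by (rule quadratic_zero(3)[OF conjunct1[OF *]])
      then show ?thesis
        using * \<open>F \<noteq> 0\<close> ik(3) by simp
    qed
    \<comment> \<open>\<open>R33\<close> and \<open>Ru\<close> belong to the transformation, while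
      the slope \<open>H1\<close> of H at \<open>u\<close> is free.\<close>
    show False
      using R33[of 0] R33[of 1] by simp
  qed
  show "Dx P z = 0" "Dt Q z = 0"
    using two_alternatives[OF z] swap by (auto simp: D)
qed


section \<open>Lower-order terms: separated variables, affine P and R\<close>

lemma diagonal_nonzero:
  assumes "z \<in> B"
  shows "Dt P z \<noteq> 0" "Dx Q z \<noteq> 0"
  using determinant_nonzero[OF assms] cross_derivatives_vanish[OF assms] by auto

lemma mixed_PQ_vanish:
  assumes z: "z \<in> B"
  shows "dd v (Dx P) z = 0" "Dx (dd v P) z = 0"
    "dd v (Du P) z = 0" "Du (dd v P) z = 0"
    "dd v (Dt Q) z = 0" "Dt (dd v Q) z = 0"
    "dd v (Du Q) z = 0" "Du (dd v Q) z = 0"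
  using dd_dd_zero[OF smooth_PQR(1) open_B convex_B cross_derivatives_vanish(1) z]
    dd_dd_zero[OF smooth_PQR(1) open_B convex_B u_derivatives_vanish(1) z]
    dd_dd_zero[OF smooth_PQR(2) open_B convex_B cross_derivatives_vanish(2) z]
    dd_dd_zero[OF smooth_PQR(2) open_B convex_B u_derivatives_vanish(2) z] by blast+

text \<open>The tangent vectors are now (i, 0, i p) and (0, k, k q), so the comparison is a sum of a
  polynomial in p and one in q. The p^2 and p coefficients give R_uu and the mixed (t, u)
  derivatives of R, the q coefficient gives the last relation, and the coefficients of A and D
  relate the principal parts.\<close>

lemma coefficient_relations:
  assumes rel: "related (f, g, h, H, K) (f', g', h', H', K')" and z: "z = (t, x, u)" "z \<in> B"
    and F: "F = f' (Q z)" and c: "c = g' (Q z) * H' (R z)"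
    and L: "L = deriv g' (Q z) * H' (R z) + h' (Q z) * K' (R z)"
    and ik: "i = inverse (Dt P z)" "k = inverse (Dx Q z)"
  defines "Rx \<equiv> Dx R z" and "Ru \<equiv> Du R z"
  shows "Ru \<noteq> 0"
    and "F * i\<^sup>2 * (g x * H u) = c * k\<^sup>2 * f x"
    and "Du (Du R) z = 0"
    and "Dt (Du R) z + Du (Dt R) z = i * Ru * Dt (Dt P) z"
    and "f x * (c * k\<^sup>2 * (Dx (Du R) z + Du (Dx R) z)
        - c * k ^ 3 * Ru * Dx (Dx Q) z
        + 2 * g' (Q z) * deriv H' (R z) * k\<^sup>2 * Rx * Ru + L * k * Ru)
      = Ru * F * i\<^sup>2 * (deriv g x * H u + h x * K u)"
proof -
  define Pt Qx Rt where "Pt = Dt P z" and "Qx = Dx Q z" and "Rt = Dt R z"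
  note D = Pt_def[symmetric] Qx_def[symmetric] Rt_def[symmetric] Rx_def[symmetric] Ru_def[symmetric]
  have P: "dd (a, b, e) P z = a * Pt" and Q: "dd (a, b, e) Q z = b * Qx"
    and R: "dd (a, b, e) R z = a * Rt + b * Rx + e * Ru" for a b e
    using cross_derivatives_vanish[OF z(2)] u_derivatives_vanish[OF z(2)] dd_expand[OF smooth_PQR(1) z(2), of a b e]
      dd_expand[OF smooth_PQR(2) z(2), of a b e] dd_expand[OF smooth_PQR(3) z(2), of a b e] by (simp_all add: D)
  have inv: "i * Pt = 1" "k * Qx = 1" "i \<noteq> 0" "k \<noteq> 0"
    using diagonal_nonzero[OF z(2)] by (simp_all add: ik D)
  define R11 R22 R33 R13 R23 where "R11 = Dt (Dt R) z" and "R22 = Dx (Dx R) z"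
    and "R33 = Du (Du R) z"
    and "R13 = Dt (Du R) z + Du (Dt R) z"
    and "R23 = Dx (Du R) z + Du (Dx R) z"
  define P11 Q22 where "P11 = Dt (Dt P) z" and "Q22 = Dx (Dx Q) z"
  note DD = R11_def[symmetric] R22_def[symmetric] R33_def[symmetric] R13_def[symmetric] R23_def[symmetric]
    P11_def[symmetric] Q22_def[symmetric]
  have "f x \<noteq> 0" "F \<noteq> 0" "c \<noteq> 0"
    using related_nonzero'[OF rel, of t x u] related_nonzero[OF rel z(2)] z by (auto simp: F c)
  define G where "G = g' (Q z) * deriv H' (R z)"
  define l where "l = deriv g x * H u + h x * K u"
  have *: "\<exists>\<mu>. Ru \<noteq> 0 \<and> Ru * (F * i\<^sup>2) = \<mu> * f x \<and> - Ru * (c * k\<^sup>2) = - \<mu> * (g x * H u) \<and>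
      F * (i\<^sup>2 * R11 + p * i\<^sup>2 * R13 + p\<^sup>2 * i\<^sup>2 * R33 - (i * Rt + p * i * Ru) * (i\<^sup>2 * P11))
      - c * (k\<^sup>2 * R22 + q * k\<^sup>2 * R23 + q\<^sup>2 * k\<^sup>2 * R33 - (k * Rx + q * k * Ru) * (k\<^sup>2 * Q22))
      - G * (k * Rx + q * k * Ru)\<^sup>2 - L * (k * Rx + q * k * Ru)
      = - \<mu> * (g x * deriv H u * q\<^sup>2 + l * q)" for p q
  proof -
    let ?v1 = "(i, 0, i * p + 0 * q)" and ?v2 = "(0, k, 0 * p + k * q)"
    have dual: "dd ?v1 P z = 1" "dd ?v1 Q z = 0" "dd ?v2 P z = 0" "dd ?v2 Q z = 1"
      unfolding P Q inv by simp_all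
    define S where "S v = dd v (dd v R) z - dd ?v1 R z * dd v (dd v P) z - dd ?v2 R z * dd v (dd v Q) z" for v
    define \<kappa> where "\<kappa> = Du R z - dd ?v1 R z * Du P z - dd ?v2 R z * Du Q z"
    have \<kappa>: "\<kappa> = Ru"
      using u_derivatives_vanish[OF z(2)] by (simp add: \<kappa>_def D)
    have Z: "Dt (Dt Q) z = 0" "Dx (Dx P) z = 0"
      using mixed_PQ_vanish[OF z(2)] by simp_all
    have S1: "S ?v1 = i\<^sup>2 * R11 + p * i\<^sup>2 * R13 + p\<^sup>2 * i\<^sup>2 * R33 - (i * Rt + p * i * Ru) * (i\<^sup>2 * P11)"
      unfolding S_def dd_dd_R_expand[OF z(2) refl, of i 0 "i * p + 0 * q"]
        dd_dd_PQ_expand[OF z(2) refl disjI1[OF refl], of i 0 "i * p + 0 * q"]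
        dd_dd_PQ_expand[OF z(2) refl disjI2[OF refl], of i 0 "i * p + 0 * q"] R DD Z
      by (simp add: power2_eq_square algebra_simps)
    have S2: "S ?v2 = k\<^sup>2 * R22 + q * k\<^sup>2 * R23 + q\<^sup>2 * k\<^sup>2 * R33 - (k * Rx + q * k * Ru) * (k\<^sup>2 * Q22)"
      unfolding S_def dd_dd_R_expand[OF z(2) refl, of 0 k "0 * p + k * q"]
        dd_dd_PQ_expand[OF z(2) refl disjI1[OF refl], of 0 k "0 * p + k * q"]
        dd_dd_PQ_expand[OF z(2) refl disjI2[OF refl], of 0 k "0 * p + k * q"] R DD Z
      by (simp add: power2_eq_square algebra_simps)
    have R2: "dd ?v2 R z = k * Rx + q * k * Ru"
      unfolding R by simp
    show ?thesis
    proof (rule jet_comparison[OF rel z refl refl dual S_def \<kappa>_def F c])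
      fix \<mu>
      assume 1: "\<kappa> \<noteq> 0" "\<kappa> * (F * i\<^sup>2 - c * 0\<^sup>2) = \<mu> * f x" "\<kappa> * (F * 0\<^sup>2 - c * k\<^sup>2) = - \<mu> * (g x * H u)"
        and eq: "F * S ?v1 - c * S ?v2 - g' (Q z) * deriv H' (R z) * (dd ?v2 R z)\<^sup>2
          - (deriv g' (Q z) * H' (R z) + h' (Q z) * K' (R z)) * dd ?v2 R z
          = - \<mu> * (g x * deriv H u * q\<^sup>2 + (deriv g x * H u + h x * K u) * q)"
      show ?thesis
        using 1 eq unfolding S1 S2 R2 \<kappa> G_def[symmetric] L[symmetric] l_def[symmetric]
        by (intro exI[of _ \<mu>]) simp
    qed
  qed
  obtain \<mu> where \<mu>: "Ru \<noteq> 0" "Ru * (F * i\<^sup>2) = \<mu> * f x" "- Ru * (c * k\<^sup>2) = - \<mu> * (g x * H u)"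
    using *[of 0 0] by blast
  \<comment> \<open>\<open>\<mu>\<close> comes from a separate comparison for each (p, q); the
    coefficient of A determines it, so one value serves all jets.\<close>
  have eq: "F * (i\<^sup>2 * R11 + p * i\<^sup>2 * R13 + p\<^sup>2 * i\<^sup>2 * R33 - (i * Rt + p * i * Ru) * (i\<^sup>2 * P11))
      - c * (k\<^sup>2 * R22 + q * k\<^sup>2 * R23 + q\<^sup>2 * k\<^sup>2 * R33 - (k * Rx + q * k * Ru) * (k\<^sup>2 * Q22))
      - G * (k * Rx + q * k * Ru)\<^sup>2 - L * (k * Rx + q * k * Ru)
      = - \<mu> * (g x * deriv H u * q\<^sup>2 + l * q)" for p q
  proof -
    obtain \<mu>' where \<mu>': "Ru * (F * i\<^sup>2) = \<mu>' * f x"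
      and eq': "F * (i\<^sup>2 * R11 + p * i\<^sup>2 * R13 + p\<^sup>2 * i\<^sup>2 * R33 - (i * Rt + p * i * Ru) * (i\<^sup>2 * P11))
      - c * (k\<^sup>2 * R22 + q * k\<^sup>2 * R23 + q\<^sup>2 * k\<^sup>2 * R33 - (k * Rx + q * k * Ru) * (k\<^sup>2 * Q22))
      - G * (k * Rx + q * k * Ru)\<^sup>2 - L * (k * Rx + q * k * Ru)
      = - \<mu>' * (g x * deriv H u * q\<^sup>2 + l * q)"
      using *[of p q] by blast
    have "\<mu>' = \<mu>"
      using \<mu>' \<mu>(2) \<open>f x \<noteq> 0\<close> by simp
    with eq' show ?thesis
      by simp
  qed
  define E0 where "E0 = F * (i\<^sup>2 * R11 - i * Rt * (i\<^sup>2 * P11)) - c * (k\<^sup>2 * R22 - k * Rx * (k\<^sup>2 * Q22))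
      - G * (k * Rx)\<^sup>2 - L * (k * Rx)"
  have p: "E0 + (F * i\<^sup>2 * (R13 - i * Ru * P11)) * p + (F * i\<^sup>2 * R33) * p\<^sup>2 = 0" for p
    using eq[of p 0] by (simp add: E0_def algebra_simps)
  have "E0 + (- (c * k\<^sup>2 * R23 - c * k ^ 3 * Ru * Q22 + 2 * G * k\<^sup>2 * Rx * Ru + L * k * Ru) + \<mu> * l) * q
      + (- c * k\<^sup>2 * R33 - G * (k * Ru)\<^sup>2 + \<mu> * (g x * deriv H u)) * q\<^sup>2 = 0" for q
    using eq[of 0 q] by (simp add: E0_def algebra_simps power2_eq_square power3_eq_cube)
  from quadratic_zero(2)[OF this]
  have q: "c * k\<^sup>2 * R23 - c * k ^ 3 * Ru * Q22 + 2 * G * k\<^sup>2 * Rx * Ru + L * k * Ru = \<mu> * l"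
    by simp
  show "Ru \<noteq> 0"
    by (rule \<mu>(1))
  have "Ru * (F * i\<^sup>2 * (g x * H u)) = Ru * (c * k\<^sup>2 * f x)"
    using \<mu>(2,3) by algebra
  then show "F * i\<^sup>2 * (g x * H u) = c * k\<^sup>2 * f x"
    using \<mu>(1) by simp
  show "Du (Du R) z = 0"
    using quadratic_zero(3)[OF p] \<open>F \<noteq> 0\<close> inv by (simp add: DD)
  show "Dt (Du R) z + Du (Dt R) z = i * Ru * Dt (Dt P) z"
    using quadratic_zero(2)[OF p] \<open>F \<noteq> 0\<close> inv unfolding DD by simp
  show "f x * (c * k\<^sup>2 * (Dx (Du R) z + Du (Dx R) z)
        - c * k ^ 3 * Ru * Dx (Dx Q) z
        + 2 * g' (Q z) * deriv H' (R z) * k\<^sup>2 * Rx * Ru + L * k * Ru)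
      = Ru * F * i\<^sup>2 * (deriv g x * H u + h x * K u)"
    using q \<mu>(2) unfolding DD l_def[symmetric] G_def by (simp add: algebra_simps)
qed

lemma independent_of_u:
  assumes "(t, x, u) \<in> B" "(t, x, u') \<in> B"
  shows "Q (t, x, u) = Q (t, x, u')" "dd v P (t, x, u) = dd v P (t, x, u')" "dd v Q (t, x, u) = dd v Q (t, x, u')"
proof -
  have zero: "dd (c *\<^sub>R (0, 0, u - u')) F z = 0" if "z \<in> B" "F = P \<or> F = Q" for z c F
    using that u_derivatives_vanish[OF that(1)] dd_expand[OF smooth_PQR(1) that(1), of 0 0 "c * (u - u')"]
      dd_expand[OF smooth_PQR(2) that(1), of 0 0 "c * (u - u')"] by auto
  have z: "(t, x, u) = (t, x, u') + (0, 0, u - u')"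
    by simp
  show "Q (t, x, u) = Q (t, x, u')"
    using constant_along_line[OF smooth_PQR(2) open_B convex_B, of "(0, 0, u - u')" "(t, x, u')"] zero[of _ Q 1] assms
    by simp
  show "dd v P (t, x, u) = dd v P (t, x, u')" "dd v Q (t, x, u) = dd v Q (t, x, u')"
    using dd_constant_along_line[OF smooth_PQR(1) open_B convex_B, of "(0, 0, u - u')" "(t, x, u')" v] zero[of _ P]
      dd_constant_along_line[OF smooth_PQR(2) open_B convex_B, of "(0, 0, u - u')" "(t, x, u')" v] zero[of _ Q] assms
    by simp_all
qed

text \<open>The relation \<open>f' g H R\<^sub>u / P\<^sub>t\<^sup>2 \<sim> g' H' f / Q\<^sub>x\<^sup>2\<close> shows that \<open>H'(R) / H(u)\<close> depends on \<open>(t, x)\<close> only. For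
  \<open>H = 1 + (u - u\<^sub>0)\<^sup>2\<close>, a critical point of \<open>H\<close> at \<open>u\<^sub>0\<close> forces one of \<open>H'\<close>, whence \<open>H'(R)\<close> is
  stationary in \<open>t\<close> and \<open>x\<close> for all values of \<open>u\<close>.\<close>

lemma R_depends_on_u:
  assumes z: "z \<in> B"
  shows "Dt R z = 0" "Dx R z = 0"
proof -
  obtain t x u where txu: "z = (t, x, u)"
    by (cases z)
  then have u: "u \<in> Iu" and tx: "t \<in> It" "x \<in> Ix"
    using z by (auto simp: B_def)
  obtain e where e: "e > 0" "ball u e \<subseteq> Iu"
    using openE[OF intervals_open(3) u] by blast
  \<comment> \<open>H is centred at a point different from \<open>u\<close>, so that it is
    stationary at \<open>u0\<close> but not at \<open>u\<close>.\<close>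
  define u0 where "u0 = u + e / 2"
  have u0: "u0 \<in> Iu" "u0 \<noteq> u"
    using e by (auto simp: subset_iff dist_real_def u0_def)
  define H where "H = quadr 1 0 u0"
  obtain f' g' h' H' K' where rel: "related (quadr 1 0 x, quadr 1 0 x, quadr 1 0 x, H, quadr 1 0 u) (f', g', h', H', K')"
    using related_quadr[of 1 1 1 0 x 0 x 1 0 x 0 u0 1 0 u] by (auto simp: H_def)
  have H: "H v \<noteq> 0" "H u0 = 1" "(H has_real_derivative 2 * (v - u0)) (at v)" for v
    using quadr_sign[of 1 0 u0 v] DERIV_quadr[of 1 0 u0 v] by (auto simp: H_def)
  \<comment> \<open>The relation of the principal parts is taken at v and at \<open>u0\<close> over
    the same (s, y). The values of f', g', P_t and Q_x are equal at both points, so only H' and H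
    remain, and H is 1 at \<open>u0\<close>.\<close>
  have H'R: "H' (R (s, y, v)) = H' (R (s, y, u0)) * H v" if "(s, y, v) \<in> B" for s y v
  proof -
    have B0: "(s, y, u0) \<in> B"
      using that u0 by (auto simp: B_def)
    note ind = independent_of_u[OF that B0]
    define i k where "i = inverse (Dt P (s, y, u0))" and "k = inverse (Dx Q (s, y, u0))"
    define a where "a = f' (Q (s, y, u0)) * i\<^sup>2"
    define b where "b = g' (Q (s, y, u0)) * k\<^sup>2"
    have "b \<noteq> 0"
      using related_nonzero[OF rel B0] diagonal_nonzero[OF B0] by (simp add: b_def k_def)
    have q: "quadr 1 0 x y \<noteq> 0"
      using quadr_sign[of 1 0 x y] by auto
    have "a * H v = b * H' (R (s, y, v))"
      using coefficient_relations(2)[OF rel refl that refl refl refl refl refl] q unfolding ind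
      by (simp add: a_def b_def i_def k_def mult_ac)
    moreover have "a = b * H' (R (s, y, u0))"
      using coefficient_relations(2)[OF rel refl B0 refl refl refl refl refl] q
      by (simp add: a_def b_def i_def k_def H(2) mult_ac)
    ultimately show ?thesis
      using \<open>b \<noteq> 0\<close> by simp
  qed
  have smH: "smooth_on (R ` B) H'"
    using rel by (auto simp: related_def)
  have D: "((\<lambda>s. H' (R (q + s *\<^sub>R v))) has_real_derivative deriv H' (R q) * dd v R q) (at 0)" if "q \<in> B" for q v
    using DERIV_chain2[OF _ smooth_on_line[OF smooth_PQR(3) open_B that, of v], of H' "deriv H' (R q)"]
      smooth_on_DERIV[OF smH, of "R q"] that by simp
  define z0 where "z0 = (t, x, u0)"
  have z0: "z0 \<in> B"
    using tx u0 by (auto simp: z0_def B_def)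
  have o: "open ((\<lambda>s. q + s *\<^sub>R v) -` B)" for q v
    by (intro open_vimage open_B continuous_intros)
  have in0: "0 \<in> (\<lambda>s. q + s *\<^sub>R v) -` B" if "q \<in> B" for q v
    using that by simp
  have e3: "deriv H' (R (t, x, v)) * Du R (t, x, v) = H' (R z0) * (2 * (v - u0))" if "(t, x, v) \<in> B" for v
  proof (rule DERIV_unique[OF D[OF that]])
    have "((\<lambda>s. H (v + s)) has_real_derivative 2 * (v - u0)) (at 0)"
      using DERIV_shift[of H "2 * (v - u0)" 0 v] H(3)[of v] by (simp add: add.commute)
    then have "((\<lambda>s. H' (R z0) * H (v + s)) has_real_derivative H' (R z0) * (2 * (v - u0))) (at 0)"
      by (rule DERIV_cmult)
    then show "((\<lambda>s. H' (R ((t, x, v) + s *\<^sub>R (0, 0, 1)))) has_real_derivative H' (R z0) * (2 * (v - u0))) (at 0)"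
      by (rule has_field_derivative_transform_within_open[OF _ o in0[OF that, of "(0, 0, 1)"]])
        (use H'R[of t x] in \<open>simp add: z0_def\<close>)
  qed
  have "deriv H' (R z0) = 0"
    using e3[of u0] z0 coefficient_relations(1)[OF rel _ z0 refl refl refl refl refl] by (auto simp: z0_def)
  have "deriv H' (R z) \<noteq> 0"
    using e3[of u] z u0 related_nonzero[OF rel z0] by (auto simp: txu)
  \<comment> \<open>The identity for \<open>H'\<close> is differentiated in (t, x) with u fixed; on
    the right-hand side only R at \<open>u0\<close> varies, where \<open>H'\<close> is
    stationary.\<close>
  have "deriv H' (R z) * dd (a, b, 0) R z = (deriv H' (R z0) * dd (a, b, 0) R z0) * H u" for a b
  proof (rule DERIV_unique[OF D[OF z]])
    show "((\<lambda>s. H' (R (z + s *\<^sub>R (a, b, 0)))) has_real_derivative deriv H' (R z0) * dd (a, b, 0) R z0 * H u) (at 0)"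
      by (rule has_field_derivative_transform_within_open[OF DERIV_cmult_right[OF D[OF z0]] o in0[OF z, of "(a, b, 0)"]])
        (use H'R in \<open>simp add: txu z0_def\<close>)
  qed
  then have "dd (a, b, 0) R z = 0" for a b
    using \<open>deriv H' (R z0) = 0\<close> \<open>deriv H' (R z) \<noteq> 0\<close> by simp
  then show "Dt R z = 0" "Dx R z = 0"
    by simp_all
qed

lemma mixed_R_vanish:
  assumes z: "z \<in> B"
  shows "dd v (Dt R) z = 0" "Dt (dd v R) z = 0"
    "dd v (Dx R) z = 0" "Dx (dd v R) z = 0"
  using dd_dd_zero[OF smooth_PQR(3) open_B convex_B R_depends_on_u(1) z]
    dd_dd_zero[OF smooth_PQR(3) open_B convex_B R_depends_on_u(2) z] by blast+

lemma zero_gradient_constant: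
  fixes F :: "txu \<Rightarrow> real"
  assumes "\<And>z. z \<in> B \<Longrightarrow> (F has_derivative (\<lambda>v. 0)) (at z)"
  obtains d where "\<And>z. z \<in> B \<Longrightarrow> F z = d"
  using has_derivative_zero_constant[OF convex_B, of F] assms has_derivative_at_withinI by metis

lemma some_related: "\<exists>f g h H K f' g' h' H' K'. related (f, g, h, H, K) (f', g', h', H', K')"
  using related_quadr[of 1 1 1] by auto metis

text \<open>The slope conditions say that F and \<open>dd e F\<close> vary only through the
  coordinate \<open>l\<close>. So \<open>dd e F\<close> has zero gradient and is a constant
  \<delta>, and then F - \<delta> l has zero gradient on the convex box. It serves P with the
  coordinate t and R with the coordinate u.\<close>

lemma affine_of_constant_slope:
  fixes F l :: "txu \<Rightarrow> real"
  assumes F: "smooth_on B F" and e: "\<And>z. z \<in> B \<Longrightarrow> dd e (dd e F) z = 0"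
    and slope: "\<And>z v. z \<in> B \<Longrightarrow> dd v F z = dd e F z * l v" "\<And>z v. z \<in> B \<Longrightarrow> dd v (dd e F) z = dd e (dd e F) z * l v"
    and l: "bounded_linear l"
  shows "\<exists>\<delta> d. \<forall>z\<in>B. F z = \<delta> * l z + d \<and> dd e F z = \<delta>"
proof -
  have "dd v (dd e F) z = 0" if "z \<in> B" for v z
    using slope(2)[OF that, of v] e[OF that] by simp
  then have "(dd e F has_derivative (\<lambda>v. 0)) (at z)" if "z \<in> B" for z
    using smooth_on_has_derivative[OF smooth_on_dd[OF F] that, of e] that by simp
  then obtain \<delta> where \<delta>: "\<And>z. z \<in> B \<Longrightarrow> dd e F z = \<delta>"
    using zero_gradient_constant by blast
  have "((\<lambda>z. F z - \<delta> * l z) has_derivative (\<lambda>v. 0)) (at z)" if "z \<in> B" for z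
  proof -
    have "dd v F z - \<delta> * l v = 0" for v
      using slope(1)[OF that, of v] \<delta>[OF that] by simp
    moreover have "((\<lambda>z. F z - \<delta> * l z) has_derivative (\<lambda>v. dd v F z - \<delta> * l v)) (at z)"
      by (intro has_derivative_diff smooth_on_has_derivative[OF F that] has_derivative_mult_right
          bounded_linear_imp_has_derivative l)
    ultimately show ?thesis
      by simp
  qed
  then obtain d where "\<And>z. z \<in> B \<Longrightarrow> F z - \<delta> * l z = d"
    using zero_gradient_constant[of "\<lambda>z. F z - \<delta> * l z"] by blast
  then show ?thesis
    using \<delta> by (intro exI[of _ \<delta>] exI[of _ d]) (auto simp: algebra_simps)
qed

lemma P_affine: "\<exists>\<delta>1 \<delta>2. \<delta>1 \<noteq> 0 \<and> (\<forall>z\<in>B. P z = \<delta>1 * fst z + \<delta>2)"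
proof -
  obtain f g h H K f' g' h' H' K' where rel: "related (f, g, h, H, K) (f', g', h', H', K')"
    using some_related by blast
  have P11: "Dt (Dt P) z = 0" if "z \<in> B" for z
    using coefficient_relations(4)[OF rel _ that refl refl refl refl refl] mixed_R_vanish[OF that]
      coefficient_relations(1)[OF rel _ that refl refl refl refl refl] diagonal_nonzero[OF that]
    by (cases z) auto
  have slope: "dd v P z = Dt P z * fst v" "dd v (Dt P) z = Dt (Dt P) z * fst v" if "z \<in> B" for v z
  proof -
    obtain a b c where v: "v = (a, b, c)"
      by (cases v)
    show "dd v P z = Dt P z * fst v" "dd v (Dt P) z = Dt (Dt P) z * fst v"
      unfolding v dd_expand[OF smooth_PQR(1) that, of a b c]
        dd_expand[OF smooth_on_dd[OF smooth_PQR(1)] that, of a b c "(1, 0, 0)"]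
      using cross_derivatives_vanish[OF that] u_derivatives_vanish[OF that] mixed_PQ_vanish[OF that] by simp_all
  qed
  obtain \<delta>1 \<delta>2 where *: "\<forall>z\<in>B. P z = \<delta>1 * fst z + \<delta>2 \<and> Dt P z = \<delta>1"
    using affine_of_constant_slope[OF smooth_PQR(1) P11 slope bounded_linear_fst] by blast
  obtain z where "z \<in> B"
    using intervals_open by (auto simp: B_def)
  then have "\<delta>1 \<noteq> 0"
    using * diagonal_nonzero by blast
  then show ?thesis
    using * by blast
qed

lemma R_affine: "\<exists>\<delta>3 \<delta>4. \<delta>3 \<noteq> 0 \<and> (\<forall>z\<in>B. R z = \<delta>3 * snd (snd z) + \<delta>4)"
proof -
  obtain f g h H K f' g' h' H' K' where rel: "related (f, g, h, H, K) (f', g', h', H', K')"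
    using some_related by blast
  have R33: "Du (Du R) z = 0" if "z \<in> B" for z
    using coefficient_relations(3)[OF rel _ that refl refl refl refl refl] by (cases z) auto
  have slope: "dd v R z = Du R z * snd (snd v)" "dd v (Du R) z = Du (Du R) z * snd (snd v)" if "z \<in> B" for v z
  proof -
    obtain a b c where v: "v = (a, b, c)"
      by (cases v)
    show "dd v R z = Du R z * snd (snd v)" "dd v (Du R) z = Du (Du R) z * snd (snd v)"
      unfolding v dd_expand[OF smooth_PQR(3) that, of a b c]
        dd_expand[OF smooth_on_dd[OF smooth_PQR(3)] that, of a b c "(0, 0, 1)"]
      using R_depends_on_u[OF that] mixed_R_vanish[OF that] by simp_all
  qed
  obtain \<delta>3 \<delta>4 where *: "\<forall>z\<in>B. R z = \<delta>3 * snd (snd z) + \<delta>4 \<and> Du R z = \<delta>3"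
    using affine_of_constant_slope[OF smooth_PQR(3) R33 slope
        bounded_linear_compose[OF bounded_linear_snd bounded_linear_snd]] by blast
  obtain z where "z \<in> B"
    using intervals_open by (auto simp: B_def)
  then have "\<delta>3 \<noteq> 0"
    using * coefficient_relations(1)[OF rel _ \<open>z \<in> B\<close> refl refl refl refl refl] by (cases z) auto
  then show ?thesis
    using * by blast
qed

end

section \<open>Transformation of the arbitrary elements\<close>

locale fibered_equivalence_transformation = equivalence_transformation +
  fixes \<delta>1 \<delta>2 \<delta>3 \<delta>4 :: real and X :: "real \<Rightarrow> real"
  assumes \<delta>_nonzero: "\<delta>1 \<noteq> 0" "\<delta>3 \<noteq> 0"
    and X_smooth: "smooth_on Ix X" and X_deriv: "\<And>x. x \<in> Ix \<Longrightarrow> deriv X x \<noteq> 0"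
    and PQR_eq: "\<And>t x u. (t, x, u) \<in> B \<Longrightarrow> P (t, x, u) = \<delta>1 * t + \<delta>2"
      "\<And>t x u. (t, x, u) \<in> B \<Longrightarrow> Q (t, x, u) = X x" "\<And>t x u. (t, x, u) \<in> B \<Longrightarrow> R (t, x, u) = \<delta>3 * u + \<delta>4"
begin

lemma partials:
  assumes z: "(t, x, u) \<in> B"
  shows "Dt P (t, x, u) = \<delta>1" "Dx Q (t, x, u) = deriv X x"
    "Du R (t, x, u) = \<delta>3" "Dx (Dx Q) (t, x, u) = deriv (deriv X) x"
proof -
  have x: "x \<in> Ix"
    using z by (simp add: B_def)
  have "((\<lambda>z. \<delta>1 * fst z + \<delta>2) has_derivative (\<lambda>v. \<delta>1 * fst v)) (at (t, x, u))"
    by (auto intro!: derivative_eq_intros)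
  then have "(P has_derivative (\<lambda>v. \<delta>1 * fst v)) (at (t, x, u))"
    by (rule has_derivative_transform_within_open[OF _ open_B z]) (auto simp: PQR_eq)
  then show "Dt P (t, x, u) = \<delta>1"
    using dd_eqI by fastforce
  have "((\<lambda>z. \<delta>3 * snd (snd z) + \<delta>4) has_derivative (\<lambda>v. \<delta>3 * snd (snd v))) (at (t, x, u))"
    by (auto intro!: derivative_eq_intros)
  then have "(R has_derivative (\<lambda>v. \<delta>3 * snd (snd v))) (at (t, x, u))"
    by (rule has_derivative_transform_within_open[OF _ open_B z]) (auto simp: PQR_eq)
  then show "Du R (t, x, u) = \<delta>3"
    using dd_eqI by fastforce
  have proj: "((\<lambda>z. F (fst (snd z))) has_derivative (\<lambda>v. deriv F x * fst (snd v))) (at (t, x, u))"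
    if "smooth_on Ix F" "x \<in> Ix" for F x and t u :: real
  proof -
    have "((\<lambda>z :: txu. fst (snd z)) has_derivative (\<lambda>v. fst (snd v))) (at (t, x, u))"
      by (auto intro!: derivative_eq_intros)
    then show ?thesis
      using diff_chain_at[of "\<lambda>z :: txu. fst (snd z)" _ "(t, x, u)" F "(*) (deriv F x)"]
        smooth_on_DERIV[OF that] by (simp add: comp_def has_field_derivative_def)
  qed
  have Q2: "Dx Q (t, x, u) = deriv X x" if z: "(t, x, u) \<in> B" for t x u
  proof -
    have "x \<in> Ix"
      using z by (simp add: B_def)
    from proj[OF X_smooth this] have "(Q has_derivative (\<lambda>v. deriv X x * fst (snd v))) (at (t, x, u))"
      by (rule has_derivative_transform_within_open[OF _ open_B z]) (auto simp: PQR_eq)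
    then show ?thesis
      using dd_eqI by fastforce
  qed
  then show "Dx Q (t, x, u) = deriv X x"
    using z .
  from proj[OF smooth_on_deriv[OF X_smooth intervals_open(2)] x]
  have "(Dx Q has_derivative (\<lambda>v. deriv (deriv X) x * fst (snd v))) (at (t, x, u))"
    by (rule has_derivative_transform_within_open[OF _ open_B z]) (auto simp: Q2)
  then show "Dx (Dx Q) (t, x, u) = deriv (deriv X) x"
    using dd_eqI by fastforce
qed

lemma B_I: "t \<in> It \<Longrightarrow> x \<in> Ix \<Longrightarrow> u \<in> Iu \<Longrightarrow> (t, x, u) \<in> B"
  by (simp add: B_def)

lemma related_values:
  assumes rel: "related (f, g, h, H, K) (f', g', h', H', K')" and z: "(t, x, u) \<in> B"
  shows "snd (T ((t, x, u), (f x, g x, h x, H u, K u))) =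
    (f' (X x), g' (X x), h' (X x), H' (\<delta>3 * u + \<delta>4), K' (\<delta>3 * u + \<delta>4))"
proof -
  have "snd (T ((t, x, u), vals_at (f, g, h, H, K) (t, x, u))) =
      vals_at (f', g', h', H', K') (P (t, x, u), Q (t, x, u), R (t, x, u))"
    using rel z unfolding related_def by blast
  then show ?thesis
    by (simp add: PQR_eq[OF z])
qed

text \<open>The quantity m of the overview, formed from one related pair.\<close>

definition weight :: "(real \<Rightarrow> real) \<Rightarrow> (real \<Rightarrow> real) \<Rightarrow> real \<Rightarrow> real" where
  "weight f f' x = f' (X x) * deriv X x / (f x * \<delta>1\<^sup>2)"

text \<open>The relation of the principal parts becomes m X_x g H = g' H', in which the variables x
  and u separate, so H' / H is a constant \<epsilon> of the pair. The last claim is the relation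
  from the q coefficient, with R_x and the mixed derivatives of R zero and g' replaced by its
  formula.\<close>

lemma related_elements:
  assumes rel: "related (f, g, h, H, K) (f', g', h', H', K')"
  shows "\<exists>\<epsilon>. \<epsilon> \<noteq> 0 \<and> (\<forall>u\<in>Iu. H' (\<delta>3 * u + \<delta>4) = \<epsilon> * H u) \<and>
      (\<forall>x\<in>Ix. g' (X x) = weight f f' x * deriv X x * g x / \<epsilon>)"
    and "\<And>x. x \<in> Ix \<Longrightarrow> weight f f' x \<noteq> 0"
    and "\<And>x. x \<in> Ix \<Longrightarrow> (weight f f' has_real_derivative deriv (weight f f') x) (at x)"
    and "\<And>x u. x \<in> Ix \<Longrightarrow> u \<in> Iu \<Longrightarrow>
      h' (X x) * K' (\<delta>3 * u + \<delta>4) = weight f f' x * h x * K u - H u * g x * deriv (weight f f') x"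
proof -
  define m where "m = weight f f'"
  obtain t0 x0 u0 where base: "t0 \<in> It" "x0 \<in> Ix" "u0 \<in> Iu"
    using intervals_open by auto
  have sm: "smooth_on Ix f" "smooth_on Ix g" "smooth_on (Q ` B) f'" "smooth_on (Q ` B) g'"
    using rel by (auto simp: related_def)
  have XQ: "X x \<in> Q ` B" if "x \<in> Ix" for x
    using PQR_eq(2)[OF B_I[OF base(1) that base(3)]] B_I[OF base(1) that base(3)] by (metis imageI)
  have nz: "f x \<noteq> 0" "g x \<noteq> 0" "H u \<noteq> 0" "f' (X x) \<noteq> 0" "g' (X x) \<noteq> 0" "H' (\<delta>3 * u + \<delta>4) \<noteq> 0"
    if "x \<in> Ix" "u \<in> Iu" for x u
    using related_nonzero[OF rel B_I[OF base(1) that]] related_nonzero'[OF rel B_I[OF base(1) that]]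
    by (simp_all add: PQR_eq[OF B_I[OF base(1) that]])
  have r1: "m x * deriv X x * g x * H u = g' (X x) * H' (\<delta>3 * u + \<delta>4)" if "x \<in> Ix" "u \<in> Iu" for x u
  proof -
    note z = B_I[OF base(1) that]
    show ?thesis
      using coefficient_relations(2)[OF rel refl z refl refl refl refl refl] \<delta>_nonzero X_deriv[OF that(1)] nz[OF that]
      unfolding partials[OF z] PQR_eq[OF z] m_def weight_def by (simp add: field_simps power2_eq_square)
  qed
  define \<epsilon> where "\<epsilon> = m x0 * deriv X x0 * g x0 / g' (X x0)"
  have m_nz: "m x \<noteq> 0" if "x \<in> Ix" for x
    using nz[OF that base(3)] X_deriv[OF that] \<delta>_nonzero by (simp add: m_def weight_def)
  have \<epsilon>: "\<epsilon> \<noteq> 0"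
    using nz[OF base(2,3)] X_deriv[OF base(2)] m_nz[OF base(2)] by (simp add: \<epsilon>_def)
  have H': "H' (\<delta>3 * u + \<delta>4) = \<epsilon> * H u" if "u \<in> Iu" for u
    using r1[OF base(2) that] nz[OF base(2) that] by (simp add: \<epsilon>_def field_simps)
  have g': "g' (X x) = m x * deriv X x * g x / \<epsilon>" if "x \<in> Ix" for x
    using r1[OF that base(3)] nz[OF that base(3)] \<epsilon> H'[OF base(3)] by (simp add: field_simps)
  have dX: "(X has_real_derivative deriv X x) (at x)" "(deriv X has_real_derivative deriv (deriv X) x) (at x)"
    if "x \<in> Ix" for x
    using smooth_on_DERIV[OF X_smooth that]
      smooth_on_DERIV[OF smooth_on_deriv[OF X_smooth intervals_open(2)] that] by auto
  have dm: "(m has_real_derivative deriv m x) (at x)" if "x \<in> Ix" for x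
  proof -
    have "((\<lambda>x. f' (X x) * deriv X x / (f x * \<delta>1\<^sup>2)) has_real_derivative
        ((deriv f' (X x) * deriv X x * deriv X x + deriv (deriv X) x * f' (X x)) * (f x * \<delta>1\<^sup>2) -
          f' (X x) * deriv X x * (deriv f x * \<delta>1\<^sup>2)) / ((f x * \<delta>1\<^sup>2) * (f x * \<delta>1\<^sup>2))) (at x)"
      using nz[OF that base(3)] \<delta>_nonzero
      by (intro DERIV_divide DERIV_mult DERIV_cmult_right DERIV_chain2[where f = f' and g = X, OF smooth_on_DERIV[OF sm(3) XQ[OF that]]] dX that
          smooth_on_DERIV[OF sm(1)]) simp
    then have "(m has_real_derivative
        ((deriv f' (X x) * deriv X x * deriv X x + deriv (deriv X) x * f' (X x)) * (f x * \<delta>1\<^sup>2) -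
          f' (X x) * deriv X x * (deriv f x * \<delta>1\<^sup>2)) / ((f x * \<delta>1\<^sup>2) * (f x * \<delta>1\<^sup>2))) (at x)"
      unfolding m_def weight_def .
    then show ?thesis
      using DERIV_imp_deriv by force
  qed
  have K': "h' (X x) * K' (\<delta>3 * u + \<delta>4) = m x * h x * K u - H u * g x * deriv m x" if xu: "x \<in> Ix" "u \<in> Iu" for x u
  proof -
    note z = B_I[OF base(1) xu]
    define X1 X2 where "X1 = deriv X x" and "X2 = deriv (deriv X) x"
    have X1: "X1 \<noteq> 0"
      using X_deriv[OF xu(1)] by (simp add: X1_def)
    have "((\<lambda>x. g' (X x)) has_real_derivative deriv g' (X x) * X1) (at x)"
      unfolding X1_def by (intro DERIV_chain2[where f = g' and g = X, OF smooth_on_DERIV[OF sm(4) XQ[OF xu(1)]]] dX xu)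
    \<comment> \<open>\<open>deriv g'\<close> is eliminated by differentiating the formula for g'(X
      x). This brings in m_x and X_xx; the X_xx term cancels against the one that stems from
      Q_xx.\<close>
    moreover have "((\<lambda>x. m x * deriv X x * g x / \<epsilon>) has_real_derivative
        ((deriv m x * X1 + X2 * m x) * g x + deriv g x * (m x * X1)) / \<epsilon>) (at x)"
      unfolding X1_def X2_def by (intro DERIV_cdivide DERIV_mult dm dX smooth_on_DERIV[OF sm(2)] xu)
    then have "((\<lambda>x. g' (X x)) has_real_derivative
        ((deriv m x * X1 + X2 * m x) * g x + deriv g x * (m x * X1)) / \<epsilon>) (at x)"
      by (rule has_field_derivative_transform_within_open[OF _ intervals_open(2) xu(1)]) (simp add: g')
    ultimately have dg: "deriv g' (X x) * X1 = ((deriv m x * X1 + X2 * m x) * g x + deriv g x * (m x * X1)) / \<epsilon>"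
      by (rule DERIV_unique)
    define F where "F = f' (X x)"
    have "F * (inverse \<delta>1)\<^sup>2 = m x * f x / X1"
      using nz[OF xu] X1 \<delta>_nonzero by (simp add: F_def m_def weight_def X1_def field_simps)
    then have F: "\<delta>3 * F * (inverse \<delta>1)\<^sup>2 = \<delta>3 * (m x / X1 * f x)"
      by (simp add: mult.assoc)
    have "f x * (- (g' (X x) * H' (\<delta>3 * u + \<delta>4) * inverse X1 ^ 3 * \<delta>3 * X2)
        + (deriv g' (X x) * H' (\<delta>3 * u + \<delta>4) + h' (X x) * K' (\<delta>3 * u + \<delta>4)) * inverse X1 * \<delta>3)
      = \<delta>3 * F * (inverse \<delta>1)\<^sup>2 * (deriv g x * H u + h x * K u)"
      using coefficient_relations(5)[OF rel refl z refl refl refl refl refl] mixed_R_vanish[OF z] R_depends_on_u[OF z]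
      unfolding partials[OF z] PQR_eq[OF z] by (simp add: X1_def X2_def F_def)
    then have "f x * (\<delta>3 * (- (g' (X x) * H' (\<delta>3 * u + \<delta>4) * inverse X1 ^ 3 * X2)
        + (deriv g' (X x) * H' (\<delta>3 * u + \<delta>4) + h' (X x) * K' (\<delta>3 * u + \<delta>4)) * inverse X1))
      = f x * (\<delta>3 * (m x / X1 * (deriv g x * H u + h x * K u)))"
      unfolding F by (simp add: algebra_simps)
    then have "- (g' (X x) * H' (\<delta>3 * u + \<delta>4) * inverse X1 ^ 3 * X2)
        + (deriv g' (X x) * H' (\<delta>3 * u + \<delta>4) + h' (X x) * K' (\<delta>3 * u + \<delta>4)) * inverse X1
      = m x / X1 * (deriv g x * H u + h x * K u)"
      using nz(1)[OF xu] \<delta>_nonzero(2) by (simp only: mult_cancel_left simp_thms)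
    moreover have "g' (X x) * H' (\<delta>3 * u + \<delta>4) = m x * X1 * g x * H u"
      using r1[OF xu] by (simp add: X1_def)
    moreover have "deriv g' (X x) * H' (\<delta>3 * u + \<delta>4) =
        ((deriv m x * X1 + X2 * m x) * g x + deriv g x * (m x * X1)) * H u / X1"
    proof -
      have "deriv g' (X x) * \<epsilon> = ((deriv m x * X1 + X2 * m x) * g x + deriv g x * (m x * X1)) / X1"
        using dg X1 \<epsilon> by (simp add: field_simps)
      then have "deriv g' (X x) * \<epsilon> * H u = ((deriv m x * X1 + X2 * m x) * g x + deriv g x * (m x * X1)) / X1 * H u"
        by simp
      then show ?thesis
        unfolding H'[OF xu(2)] by simp
    qed
    ultimately have "- (m x * X1 * g x * H u * inverse X1 ^ 3 * X2)
        + (((deriv m x * X1 + X2 * m x) * g x + deriv g x * (m x * X1)) * H u / X1 + h' (X x) * K' (\<delta>3 * u + \<delta>4)) * inverse X1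
      = m x / X1 * (deriv g x * H u + h x * K u)"
      by simp
    then have "X1 * (X1 * (X1 * (X1 * (h' (X x) * K' (\<delta>3 * u + \<delta>4))))) =
        X1 * (X1 * (X1 * (X1 * (m x * h x * K u - H u * g x * deriv m x))))"
      using X1 by (simp add: field_simps power3_eq_cube)
    then show ?thesis
      using X1 by (simp only: mult_cancel_left simp_thms)
  qed
  show "\<exists>\<epsilon>. \<epsilon> \<noteq> 0 \<and> (\<forall>u\<in>Iu. H' (\<delta>3 * u + \<delta>4) = \<epsilon> * H u) \<and>
      (\<forall>x\<in>Ix. g' (X x) = weight f f' x * deriv X x * g x / \<epsilon>)"
    using \<epsilon> H' g' by (auto simp: m_def)
  show "weight f f' x \<noteq> 0" "(weight f f' has_real_derivative deriv (weight f f') x) (at x)" if "x \<in> Ix" for x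
    using m_nz[OF that] dm[OF that] by (simp_all add: m_def)
  show "h' (X x) * K' (\<delta>3 * u + \<delta>4) = weight f f' x * h x * K u - H u * g x * deriv (weight f f') x"
    if "x \<in> Ix" "u \<in> Iu" for x u
    using K'[OF that] by (simp add: m_def)
qed


text \<open>The elements \<open>f\<close>, \<open>g\<close>, \<open>H\<close> do not vanish, so at first the values of \<open>T\<close> can be compared, along
  arbitrary elements, only within one orthant of the space of values of \<open>(f, g, h, H, K)\<close>.\<close>

definition halfline :: "real \<Rightarrow> real set" where
  "halfline s = {y. s * y > 0}"

fun orthant :: "elem_vals \<Rightarrow> elem_vals set" where
  "orthant (s1, s2, s3, s4, s5) = halfline s1 \<times> halfline s2 \<times> halfline s3 \<times> halfline s4 \<times> halfline s5"

lemma convex_halfline: "convex (halfline s)"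
  using convex_halfspace_gt[of 0 s] by (simp add: halfline_def)

lemma convex_orthant: "convex (orthant s)"
  by (cases s) (auto intro!: convex_Times convex_halfline)

lemma quadr_halfline: "c \<in> halfline s \<Longrightarrow> quadr c b x0 x \<in> halfline s"
  using quadr_sign[of c b x0 x] by (auto simp: halfline_def zero_less_mult_iff)

fun quadr_elems :: "real \<Rightarrow> real \<Rightarrow> elem_vals \<Rightarrow> elem_vals \<Rightarrow> elems" where
  "quadr_elems x u (f, g, h, H, K) (f1, g1, h1, H1, K1) =
    (quadr f f1 x, quadr g g1 x, quadr h h1 x, quadr H H1 u, quadr K K1 u)"

lemma halfline_nonzero: "y \<in> halfline s \<Longrightarrow> y \<noteq> 0"
  by (auto simp: halfline_def)

lemma related_quadr_elems:
  assumes "a \<in> orthant s"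
  shows "\<exists>\<theta>'. related (quadr_elems x u a d) \<theta>'"
  using assms related_quadr halfline_nonzero by (cases a; cases d; cases s) (auto; metis)

lemma quadr_elems_orthant: "a \<in> orthant s \<Longrightarrow> vals_at (quadr_elems x u a d) z \<in> orthant s"
  by (cases a; cases d; cases s; cases z) (auto intro: quadr_halfline)

text \<open>The derivatives of the arbitrary elements at a point can be prescribed independently of
  their values, so a function of \<open>x\<close> along all arbitrary elements has a gradient in the direction of \<open>x\<close>.\<close>

lemma gradient_along_elements:
  fixes E :: "txu \<times> elem_vals \<Rightarrow> real"
  assumes z: "(t, x, u) \<in> B" and a: "a \<in> orthant s"
    and L: "(E has_derivative L) (at ((t, x, u), a))"
    and along: "\<And>d. \<exists>e. (e has_real_derivative n) (at x) \<and>
      (\<forall>t' x' u'. (t', x', u') \<in> B \<longrightarrow> E ((t', x', u'), vals_at (quadr_elems x u a d) (t', x', u')) = e x')"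
  shows "L ((c1, c2, c3), b) = c2 * n"
proof -
  interpret L: linear L
    using L by (rule has_derivative_linear)
  have main: "L ((c1, c2, c3), b) = c2 * n" if c: "c2 \<noteq> 0" "c3 \<noteq> 0" for c1 c2 c3 b
  proof -
    obtain f g h H K where a': "a = (f, g, h, H, K)"
      by (cases a)
    obtain b1 b2 b3 b4 b5 where b': "b = (b1, b2, b3, b4, b5)"
      by (cases b)
    \<comment> \<open>With these slopes the values of the elements along the line in direction (c1,
      c2, c3) start with velocity \<open>b\<close>: f, g, h change with x, and H, K with u. The
      quotients are the reason to assume c2 and c3 nonzero at first.\<close>
    define d where "d = (b1 / c2, b2 / c2, b3 / c2, b4 / c3, b5 / c3)"
    define l where "l r = (t + r * c1, x + r * c2, u + r * c3)" for r
    have Q: "((\<lambda>r. quadr v (w / c) y (y + r * c)) has_derivative (\<lambda>r. r * w)) (at 0)" if "c \<noteq> 0" for v w c y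
    proof -
      have "((\<lambda>r. y + r * c) has_real_derivative c) (at 0)"
        by (auto intro!: derivative_eq_intros)
      from DERIV_chain2[OF _ this, of "quadr v (w / c) y" "w / c"]
      have "((\<lambda>r. quadr v (w / c) y (y + r * c)) has_real_derivative w) (at 0)"
        using DERIV_quadr[of v "w / c" y y] that by simp
      then show ?thesis
        unfolding has_field_derivative_def by (rule has_derivative_eq_rhs) (auto simp: mult.commute)
    qed
    have "((\<lambda>r. (l r, vals_at (quadr_elems x u a d) (l r))) has_derivative (\<lambda>r. r *\<^sub>R ((c1, c2, c3), b))) (at 0)"
      unfolding l_def a' b' d_def quadr_elems.simps vals_at.simps scaleR_Pair real_scaleR_def
      by (intro has_derivative_Pair Q c) (auto intro!: derivative_eq_intros)
    moreover have "(E has_derivative L) (at (l 0, vals_at (quadr_elems x u a d) (l 0)))"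
      using L by (simp add: l_def a' d_def)
    ultimately have 1: "((\<lambda>r. E (l r, vals_at (quadr_elems x u a d) (l r))) has_derivative (\<lambda>r. L (r *\<^sub>R ((c1, c2, c3), b)))) (at 0)"
      using diff_chain_at by (fastforce simp: comp_def)
    obtain e where e: "(e has_real_derivative n) (at x)"
      "\<And>t' x' u'. (t', x', u') \<in> B \<Longrightarrow> E ((t', x', u'), vals_at (quadr_elems x u a d) (t', x', u')) = e x'"
      using along[of d] by blast
    have "((\<lambda>r. x + r * c2) has_real_derivative c2) (at 0)"
      by (auto intro!: derivative_eq_intros)
    from DERIV_chain2[OF _ this, of e n] have "((\<lambda>r. e (x + r * c2)) has_real_derivative n * c2) (at 0)"
      using e(1) by simp
    then have "((\<lambda>r. e (x + r * c2)) has_derivative (*) (n * c2)) (at 0)"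
      by (simp add: has_field_derivative_def)
    then have "((\<lambda>r. E (l r, vals_at (quadr_elems x u a d) (l r))) has_derivative (*) (n * c2)) (at 0)"
    proof (rule has_derivative_transform_within_open)
      show "open (l -` B)"
        unfolding l_def by (intro open_vimage open_B continuous_intros)
      show "0 \<in> l -` B"
        using z by (simp add: l_def)
      show "e (x + r * c2) = E (l r, vals_at (quadr_elems x u a d) (l r))" if "r \<in> l -` B" for r
        using e(2) that by (simp add: l_def)
    qed
    from fun_cong[OF has_derivative_unique[OF 1 this], of 1] show ?thesis
      by simp
  qed
  \<comment> \<open>Any direction is the difference of two directions with nonzero x- and
    u-components; \<open>k\<close> exceeds the absolute values of c2 and c3, and linearity of
    \<open>L\<close> does the rest.\<close>
  define k where "k = \<bar>c2\<bar> + \<bar>c3\<bar> + 1"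
  have "L ((c1, c2 + k, c3 + k), b) = (c2 + k) * n" "L ((0, k, k), 0) = k * n"
    by (rule main; simp add: k_def)+
  moreover have "L ((c1, c2 + k, c3 + k), b) = L ((c1, c2, c3), b) + L ((0, k, k), 0)"
    unfolding L.add[symmetric] by simp
  ultimately show ?thesis
    by (simp add: algebra_simps)
qed

end

text \<open>Two polynomials with the same value \<open>c\<close> at \<open>x0\<close> but different
  values at \<open>x1\<close>: the slope c / (x1 - x0) adds 2 c there. The rank-one argument uses
  this freedom at a second point, both in x and in u.\<close>

lemma quadr_second_value:
  assumes "c \<noteq> 0" "x1 \<noteq> x0"
  shows "quadr c (c / (x1 - x0)) x0 x1 = 3 * c + c * (x1 - x0)\<^sup>2" "quadr c 0 x0 x1 = c + c * (x1 - x0)\<^sup>2"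
proof -
  define y where "y = x1 - x0"
  have y: "y \<noteq> 0"
    using assms by (simp add: y_def)
  have "((c / y)\<^sup>2 + c\<^sup>2) / c * y\<^sup>2 = c + c * y\<^sup>2"
    using y assms by (simp add: field_simps power2_eq_square)
  then show "quadr c (c / (x1 - x0)) x0 x1 = 3 * c + c * (x1 - x0)\<^sup>2"
    using y unfolding quadr_def y_def[symmetric] by simp
  show "quadr c 0 x0 x1 = c + c * (x1 - x0)\<^sup>2"
    using assms by (simp add: quadr_def power2_eq_square)
qed

section \<open>The components of T within one orthant\<close>

context fibered_equivalence_transformation
begin

definition "Tf p = fst (snd (T p))"
definition "Tg p = fst (snd (snd (T p)))"
definition "Th p = fst (snd (snd (snd (T p))))"
definition "TH p = fst (snd (snd (snd (snd (T p)))))"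
definition "TK p = snd (snd (snd (snd (snd (T p)))))"

lemma open_domain: "open (B \<times> (UNIV :: elem_vals set))"
  by (intro open_Times open_B open_UNIV)

lemma T_components_smooth:
  "smooth_on (B \<times> UNIV) Tf" "smooth_on (B \<times> UNIV) Tg" "smooth_on (B \<times> UNIV) Th"
  "smooth_on (B \<times> UNIV) TH" "smooth_on (B \<times> UNIV) TK"
  unfolding Tf_def Tg_def Th_def TH_def TK_def
  by (intro smooth_on_fst smooth_on_snd T_smooth open_domain)+

lemma T_component_differentiable:
  assumes "smooth_on (B \<times> UNIV) F" "z \<in> B"
  shows "F differentiable (at (z, a))"
  using smooth_on_has_derivative[OF assms(1), of "(z, a)"] assms(2) by (auto simp: differentiable_def)

lemma T_along_elements:
  assumes "related (f, g, h, H, K) (f', g', h', H', K')" "(t, x, u) \<in> B"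
    and "vals_at (f, g, h, H, K) (t, x, u) = a"
  shows "Tf ((t, x, u), a) = f' (X x)" "Tg ((t, x, u), a) = g' (X x)" "Th ((t, x, u), a) = h' (X x)"
    "TH ((t, x, u), a) = H' (\<delta>3 * u + \<delta>4)" "TK ((t, x, u), a) = K' (\<delta>3 * u + \<delta>4)"
  using related_values[OF assms(1,2)] assms(3)
  by (auto simp: Tf_def Tg_def Th_def TH_def TK_def)

lemma quadr_elems_at: "vals_at (quadr_elems x u a d) (t, x, u) = a"
  by (cases a; cases d) simp

lemma quadr_elemsE:
  assumes "a \<in> orthant s"
  obtains f g h H K f' g' h' H' K' where "quadr_elems x u a d = (f, g, h, H, K)"
    "related (f, g, h, H, K) (f', g', h', H', K')"
proof -
  obtain \<theta>' where "related (quadr_elems x u a d) \<theta>'"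
    using related_quadr_elems[OF assms] by blast
  then show thesis
    using that by (metis prod.collapse)
qed

lemma zero_gradient_orthant:
  fixes E :: "txu \<times> elem_vals \<Rightarrow> real"
  assumes "\<And>z a. z \<in> B \<Longrightarrow> a \<in> orthant s \<Longrightarrow> (E has_derivative (\<lambda>v. 0)) (at (z, a))"
    and "z \<in> B" "a \<in> orthant s" "z' \<in> B" "a' \<in> orthant s"
  shows "E (z, a) = E (z', a')"
proof (rule has_derivative_zero_unique[where f = E and s = "B \<times> orthant s"])
  show "convex (B \<times> orthant s)"
    by (rule convex_Times[OF convex_B convex_orthant])
  fix p assume "p \<in> B \<times> orthant s"
  then obtain z a where p: "p = (z, a)" "z \<in> B" "a \<in> orthant s"
    by (rule SigmaE)
  show "(E has_derivative (\<lambda>v. 0)) (at p within B \<times> orthant s)"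
    unfolding p(1) by (rule has_derivative_at_withinI[OF assms(1)[OF p(2,3)]])
next
  show "(z, a) \<in> B \<times> orthant s" "(z', a') \<in> B \<times> orthant s"
    by (rule SigmaI[OF assms(2,3)], rule SigmaI[OF assms(4,5)])
qed

text \<open>This is the gradient along elements in the case of slope 0: every derivative of E
  vanishes on the convex set of points over one orthant. The constants \<open>e\<close> of different
  families of elements thereby turn out to be equal.\<close>

lemma constant_along_elements:
  fixes E :: "txu \<times> elem_vals \<Rightarrow> real"
  assumes diff: "\<And>z a. z \<in> B \<Longrightarrow> a \<in> orthant s \<Longrightarrow> E differentiable (at (z, a))"
    and const: "\<And>x u a d. a \<in> orthant s \<Longrightarrow> \<exists>e. \<forall>z\<in>B. E (z, vals_at (quadr_elems x u a d) z) = e"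
    and "z \<in> B" "a \<in> orthant s" "z' \<in> B" "a' \<in> orthant s"
  shows "E (z, a) = E (z', a')"
proof (rule zero_gradient_orthant[OF _ assms(3-6)])
  fix z a assume z: "z \<in> B" and a: "a \<in> orthant s"
  obtain t x u where txu: "z = (t, x, u)"
    by (cases z)
  obtain L where L: "(E has_derivative L) (at (z, a))"
    using diff[OF z a] by (auto simp: differentiable_def)
  have "L ((c1, c2, c3), b) = c2 * 0" for c1 c2 c3 b
  proof (rule gradient_along_elements[OF z[unfolded txu] a L[unfolded txu]])
    fix d
    obtain e where "\<forall>z\<in>B. E (z, vals_at (quadr_elems x u a d) z) = e"
      using const[OF a] by blast
    then show "\<exists>e. (e has_real_derivative 0) (at x) \<and> (\<forall>t' x' u'. (t', x', u') \<in> B \<longrightarrow>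
        E ((t', x', u'), vals_at (quadr_elems x u a d) (t', x', u')) = e x')"
      by (intro exI[of _ "\<lambda>_. e"]) auto
  qed
  then have "L v = 0" for v
    by (metis mult_zero_right prod.collapse)
  then have "L = (\<lambda>v. 0)"
    by (rule ext)
  with L show "(E has_derivative (\<lambda>v. 0)) (at (z, a))"
    by simp
qed

lemma component_nonzero:
  assumes z: "z \<in> B" and a: "a \<in> orthant s"
  shows "Tf (z, a) \<noteq> 0" "TH (z, a) \<noteq> 0"
proof -
  obtain t x u where txu: "z = (t, x, u)"
    by (cases z)
  obtain f g h H K f' g' h' H' K' where q: "quadr_elems x u a 0 = (f, g, h, H, K)"
    and rel: "related (f, g, h, H, K) (f', g', h', H', K')"
    by (rule quadr_elemsE[OF a])
  show "Tf (z, a) \<noteq> 0" "TH (z, a) \<noteq> 0"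
    using T_along_elements[OF rel z[unfolded txu] quadr_elems_at[of x u a 0 t, unfolded q]] related_nonzero[OF rel z]
    by (simp_all add: txu PQR_eq[OF z[unfolded txu]])
qed

text \<open>\<open>s \<in> orthant s\<close> says that no entry of \<open>s\<close> is zero, and it
  makes \<open>s\<close> a sample point of its orthant. Along each related pair TH / H is the
  constant \<epsilon> of the pair, so it has zero gradient and is one constant on the
  orthant.\<close>

lemma TH_on_orthant:
  assumes s: "s \<in> orthant s"
  obtains \<epsilon>2 where "\<epsilon>2 \<noteq> 0"
    "\<And>z f g h H K. z \<in> B \<Longrightarrow> (f, g, h, H, K) \<in> orthant s \<Longrightarrow> TH (z, (f, g, h, H, K)) = \<epsilon>2 * H"
proof -
  obtain z0 where z0: "z0 \<in> B"
    using B_I intervals_open by fastforce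
  define E :: "txu \<times> elem_vals \<Rightarrow> real" where "E p = TH p / fst (snd (snd (snd (snd p))))" for p
  have E: "E (z, a) = E (z0, s)" if "z \<in> B" "a \<in> orthant s" for z a
  proof (rule constant_along_elements[OF _ _ that z0 s])
    fix z :: txu and a :: elem_vals
    assume "z \<in> B" "a \<in> orthant s"
    then show "E differentiable (at (z, a))"
      unfolding E_def using halfline_nonzero
      by (cases a; cases s) (intro differentiable_divide T_component_differentiable[OF T_components_smooth(4)];
        auto intro!: differentiableI derivative_eq_intros)
  next
    fix x u :: real and a d :: elem_vals
    assume a: "a \<in> orthant s"
    obtain f g h H K f' g' h' H' K' where q: "quadr_elems x u a d = (f, g, h, H, K)"
      and rel: "related (f, g, h, H, K) (f', g', h', H', K')"
      by (rule quadr_elemsE[OF a])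
    obtain \<epsilon> where \<epsilon>: "\<And>u. u \<in> Iu \<Longrightarrow> H' (\<delta>3 * u + \<delta>4) = \<epsilon> * H u"
      using related_elements(1)[OF rel] by blast
    have "E (z, vals_at (quadr_elems x u a d) z) = \<epsilon>" if "z \<in> B" for z
    proof -
      obtain t y v where z: "z = (t, y, v)"
        by (cases z)
      then have "v \<in> Iu"
        using that by (simp add: B_def)
      then show ?thesis
        using T_along_elements(4)[OF rel that[unfolded z] refl] related_nonzero'[OF rel that[unfolded z]] \<epsilon>
        by (simp add: E_def q z)
    qed
    then show "\<exists>e. \<forall>z\<in>B. E (z, vals_at (quadr_elems x u a d) z) = e"
      by blast
  qed
  show thesis
  proof (rule that)
    show "E (z0, s) \<noteq> 0"
      using component_nonzero[OF z0 s] s halfline_nonzero by (cases s) (auto simp: E_def)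
    show "TH (z, (f, g, h, H, K)) = E (z0, s) * H" if "z \<in> B" "(f, g, h, H, K) \<in> orthant s" for z f g h H K
      using E[OF that, symmetric] that halfline_nonzero by (cases s) (auto simp: E_def)
  qed
qed

text \<open>\<open>weight\<close> as a function on the space of (t, x, u, f, g, h, H, K), with the
  new f read off from \<open>T\<close>, so that it can be compared between pairs.\<close>

definition N :: "txu \<times> elem_vals \<Rightarrow> real" where
  "N p = Tf p * deriv X (fst (snd (fst p))) / (fst (snd p) * \<delta>1\<^sup>2)"

lemma N_along_elements:
  assumes "related (f, g, h, H, K) (f', g', h', H', K')" "(t, x, u) \<in> B"
    and "vals_at (f, g, h, H, K) (t, x, u) = a"
  shows "N ((t, x, u), a) = weight f f' x"
  using T_along_elements(1)[OF assms] assms(3) by (auto simp: N_def weight_def)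

text \<open>Along elements N is the function m of the pair, and m_x = (m h K - h' K') / (g H). The
  right-hand side, \<open>n\<close>, is made of values of \<open>T\<close> and of the elements at
  the point, so it is the same for all slopes of the elements there. Hence the derivative of N is
  \<open>n\<close> times the x-component.\<close>

lemma N_gradient:
  assumes z: "(t, x, u) \<in> B" and a: "a \<in> orthant s"
  shows "\<exists>L. (N has_derivative L) (at ((t, x, u), a)) \<and> (\<forall>c1 c3 b. L ((c1, 0, c3), b) = 0)"
proof -
  have x: "x \<in> Ix" "u \<in> Iu"
    using z by (simp_all add: B_def)
  obtain f g h H K where a': "a = (f, g, h, H, K)"
    by (cases a)
  obtain s1 s2 s3 s4 s5 where s': "s = (s1, s2, s3, s4, s5)"
    by (cases s)
  have nz: "f \<noteq> 0" "g \<noteq> 0" "h \<noteq> 0" "H \<noteq> 0" "K \<noteq> 0"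
    using a halfline_nonzero by (auto simp: a' s')
  have "(deriv X has_real_derivative deriv (deriv X) x) (at x)"
    by (rule smooth_on_DERIV[OF smooth_on_deriv[OF X_smooth intervals_open(2)] x(1)])
  moreover have "((\<lambda>p :: txu \<times> elem_vals. fst (snd (fst p))) has_derivative (\<lambda>v. fst (snd (fst v)))) (at ((t, x, u), a))"
    by (auto intro!: derivative_eq_intros)
  ultimately have "((\<lambda>p :: txu \<times> elem_vals. deriv X (fst (snd (fst p)))) has_derivative
      (\<lambda>v. deriv (deriv X) x * fst (snd (fst v)))) (at ((t, x, u), a))"
    using diff_chain_at[of "\<lambda>p :: txu \<times> elem_vals. fst (snd (fst p))" "\<lambda>v. fst (snd (fst v))" "((t, x, u), a)"
        "deriv X" "(*) (deriv (deriv X) x)"]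
    by (auto simp: comp_def has_field_derivative_def)
  then have "(\<lambda>p :: txu \<times> elem_vals. deriv X (fst (snd (fst p)))) differentiable (at ((t, x, u), a))"
    by (rule differentiableI)
  moreover have "(\<lambda>p :: txu \<times> elem_vals. fst (snd p) * \<delta>1\<^sup>2) differentiable (at ((t, x, u), a))"
    by (rule differentiableI) (auto intro!: derivative_eq_intros)
  ultimately have "N differentiable (at ((t, x, u), a))"
    unfolding N_def using nz \<delta>_nonzero
    by (intro differentiable_divide differentiable_mult T_component_differentiable[OF T_components_smooth(1) z])
      (auto simp: a')
  then obtain L where L: "(N has_derivative L) (at ((t, x, u), a))"
    by (auto simp: differentiable_def)
  define n where "n = (N ((t, x, u), a) * h * K - Th ((t, x, u), a) * TK ((t, x, u), a)) / (H * g)"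
  have "L ((c1, c2, c3), b) = c2 * n" for c1 c2 c3 b
  proof (rule gradient_along_elements[OF z a L])
    fix d
    obtain ff gg hh HH KK f' g' h' H' K' where q: "quadr_elems x u a d = (ff, gg, hh, HH, KK)"
      and rel: "related (ff, gg, hh, HH, KK) (f', g', h', H', K')"
      by (rule quadr_elemsE[OF a])
    have at: "vals_at (ff, gg, hh, HH, KK) (t, x, u) = a"
      using quadr_elems_at[of x u a d t] by (simp add: q)
    have w: "(weight ff f' has_real_derivative deriv (weight ff f') x) (at x)"
      "h' (X x) * K' (\<delta>3 * u + \<delta>4) = weight ff f' x * hh x * KK u - HH u * gg x * deriv (weight ff f') x"
      using related_elements(3,4)[OF rel] x by blast+
    have vals: "ff x = f" "gg x = g" "hh x = h" "HH u = H" "KK u = K"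
      using at by (simp_all add: a')
    have "n = (weight ff f' x * h * K - h' (X x) * K' (\<delta>3 * u + \<delta>4)) / (H * g)"
      unfolding n_def N_along_elements[OF rel z at] T_along_elements[OF rel z at] by (rule refl)
    also have "\<dots> = H * g * deriv (weight ff f') x / (H * g)"
      unfolding w(2) vals by simp
    finally have n: "n = deriv (weight ff f') x"
      using nz by simp
    show "\<exists>e. (e has_real_derivative n) (at x) \<and> (\<forall>t' x' u'. (t', x', u') \<in> B \<longrightarrow>
        N ((t', x', u'), vals_at (quadr_elems x u a d) (t', x', u')) = e x')"
    proof (intro exI[of _ "weight ff f'"] conjI allI impI)
      show "(weight ff f' has_real_derivative n) (at x)"
        unfolding n by (rule w(1))
      show "N ((t', x', u'), vals_at (quadr_elems x u a d) (t', x', u')) = weight ff f' x'"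
        if "(t', x', u') \<in> B" for t' x' u'
        unfolding q by (rule N_along_elements[OF rel that refl])
    qed
  qed
  then show ?thesis
    using L by auto
qed

lemma N_depends_on_x:
  assumes z: "(t, x, u) \<in> B" "(t', x, u') \<in> B" and a: "a \<in> orthant s" "a' \<in> orthant s"
  shows "N ((t, x, u), a) = N ((t', x, u'), a')"
proof -
  let ?j = "\<lambda>q :: (real \<times> real) \<times> elem_vals. ((fst (fst q), x, snd (fst q)), snd q)"
  have x: "x \<in> Ix"
    using z by (simp add: B_def)
  have "(N \<circ> ?j) ((t, u), a) = (N \<circ> ?j) ((t', u'), a')"
  proof (rule has_derivative_zero_unique[where f = "N \<circ> ?j" and s = "(It \<times> Iu) \<times> orthant s"])
    have "convex It" "convex Iu"
      using intervals by (simp_all add: open_interval_def is_interval_convex)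
    then show "convex ((It \<times> Iu) \<times> orthant s)"
      by (intro convex_Times[OF convex_Times convex_orthant])
    fix q :: "(real \<times> real) \<times> elem_vals"
    assume "q \<in> (It \<times> Iu) \<times> orthant s"
    then have q: "(fst (fst q), x, snd (fst q)) \<in> B" "snd q \<in> orthant s"
      using x by (auto simp: B_def)
    obtain L where L: "(N has_derivative L) (at (?j q))" "\<And>c1 c3 b. L ((c1, 0, c3), b) = 0"
      using N_gradient[OF q] by auto
    have "(?j has_derivative (\<lambda>v. ((fst (fst v), 0, snd (fst v)), snd v))) (at q)"
      by (auto intro!: derivative_eq_intros)
    from diff_chain_at[OF this L(1)] have "((N \<circ> ?j) has_derivative (\<lambda>v. 0)) (at q)"
      by (simp add: comp_def L(2))
    then show "((N \<circ> ?j) has_derivative (\<lambda>v. 0)) (at q within (It \<times> Iu) \<times> orthant s)"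
      by (rule has_derivative_at_withinI)
  next
    show "((t, u), a) \<in> (It \<times> Iu) \<times> orthant s" "((t', u'), a') \<in> (It \<times> Iu) \<times> orthant s"
      using z a by (simp_all add: B_def)
  qed
  then show ?thesis
    by simp
qed

end

lemma open_real_other_point:
  fixes x :: real
  assumes "open S" "x \<in> S"
  shows "\<exists>y\<in>S. y \<noteq> x"
proof -
  obtain e where "e > 0" "ball x e \<subseteq> S"
    using openE[OF assms] by blast
  then have "x + e / 2 \<in> S" "x + e / 2 \<noteq> x"
    by (auto simp: subset_iff dist_real_def)
  then show ?thesis
    by blast
qed

context fibered_equivalence_transformation
begin

text \<open>With \<open>\<nu> = N\<close> a function of \<open>x\<close>, the identity \<open>h' K' = \<nu> h K - \<nu>' g H\<close> says that its right-hand
  side has rank one in \<open>(x, u)\<close>. If \<open>\<nu>' \<noteq> 0\<close> at \<open>x0\<close>, then for \<open>H\<close>, \<open>K\<close> linearly independent this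
  prescribes the value of \<open>h\<close> at \<open>x1\<close>.\<close>

lemma N_on_orthant:
  assumes s: "s \<in> orthant s"
  shows "\<exists>\<epsilon>1. \<epsilon>1 \<noteq> 0 \<and> (\<forall>z\<in>B. \<forall>a\<in>orthant s. N (z, a) = \<epsilon>1)"
proof -
  obtain t0 xx0 uu0 where base: "t0 \<in> It" "xx0 \<in> Ix" "uu0 \<in> Iu"
    using intervals_open by auto
  obtain s1 s2 s3 s4 s5 where s': "s = (s1, s2, s3, s4, s5)"
    by (cases s)
  have nz: "s1 \<noteq> 0" "s2 \<noteq> 0" "s3 \<noteq> 0" "s4 \<noteq> 0" "s5 \<noteq> 0"
    using s halfline_nonzero by (auto simp: s')
  define \<nu> where "\<nu> x = N ((t0, x, uu0), s)" for x
  have \<nu>: "N ((t, x, u), a) = \<nu> x" if "(t, x, u) \<in> B" "a \<in> orthant s" for t x u a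
    unfolding \<nu>_def using that base by (intro N_depends_on_x[OF that(1) _ that(2) s]) (simp add: B_def)
  have weight_\<nu>: "weight f f' x = \<nu> x" if q: "quadr_elems y u a d = (f, g, h, H, K)" and a: "a \<in> orthant s"
    and rel: "related (f, g, h, H, K) (f', g', h', H', K')" and x: "x \<in> Ix" for y u a d f g h H K f' g' h' H' K' x
  proof -
    have z: "(t0, x, uu0) \<in> B"
      using x base by (simp add: B_def)
    show ?thesis
      using N_along_elements[OF rel z refl] \<nu>[OF z quadr_elems_orthant[OF a, of y u d "(t0, x, uu0)"]]
      unfolding q by simp
  qed
  have deriv_\<nu>: "deriv (weight f f') x = deriv \<nu> x" "(\<nu> has_real_derivative deriv \<nu> x) (at x)"
    if q: "quadr_elems y u a d = (f, g, h, H, K)" and a: "a \<in> orthant s"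
    and rel: "related (f, g, h, H, K) (f', g', h', H', K')" and x: "x \<in> Ix" for y u a d f g h H K f' g' h' H' K' x
  proof -
    have "(\<nu> has_real_derivative deriv (weight f f') x) (at x)"
      by (rule has_field_derivative_transform_within_open[OF related_elements(3)[OF rel x] intervals_open(2) x])
        (rule weight_\<nu>[OF q a rel])
    then show "deriv (weight f f') x = deriv \<nu> x" "(\<nu> has_real_derivative deriv \<nu> x) (at x)"
      using DERIV_imp_deriv[of \<nu> "deriv (weight f f') x" x] by simp_all
  qed
  have product: "\<exists>h' K'. \<forall>x\<in>Ix. \<forall>u\<in>Iu. h' x * K' u = \<nu> x * h x * K u - H u * g x * deriv \<nu> x"
    if q: "quadr_elems y u a d = (f, g, h, H, K)" and a: "a \<in> orthant s" for y u a d f g h H K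
  proof -
    obtain ff gg hh HH KK f' g' h' H' K' where q': "quadr_elems y u a d = (ff, gg, hh, HH, KK)"
      and rel: "related (ff, gg, hh, HH, KK) (f', g', h', H', K')"
      by (rule quadr_elemsE[OF a])
    have eq: "ff = f" "gg = g" "hh = h" "HH = H" "KK = K"
      using q q' by simp_all
    have "\<forall>x\<in>Ix. \<forall>u\<in>Iu. h' (X x) * K' (\<delta>3 * u + \<delta>4) = \<nu> x * h x * K u - H u * g x * deriv \<nu> x"
      using related_elements(4)[OF rel] weight_\<nu>[OF q' a rel] deriv_\<nu>(1)[OF q' a rel] unfolding eq by simp
    then show ?thesis
      by (intro exI[of _ "\<lambda>x. h' (X x)"] exI[of _ "\<lambda>u. K' (\<delta>3 * u + \<delta>4)"])
  qed
  obtain f g h H K f' g' h' H' K' where q: "quadr_elems xx0 uu0 s 0 = (f, g, h, H, K)"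
    and rel: "related (f, g, h, H, K) (f', g', h', H', K')"
    by (rule quadr_elemsE[OF s])
  have \<nu>_nz: "\<nu> x \<noteq> 0" if "x \<in> Ix" for x
    using related_elements(2)[OF rel that] weight_\<nu>[OF q s rel that] by simp
  have zero: "deriv \<nu> x0 = 0" if x0: "x0 \<in> Ix" for x0
  proof (rule ccontr)
    assume \<nu>': "deriv \<nu> x0 \<noteq> 0"
    obtain x1 where x1: "x1 \<in> Ix" "x1 \<noteq> x0"
      using open_real_other_point[OF intervals_open(2) x0] by blast
    obtain u1 where u1: "u1 \<in> Iu" "u1 \<noteq> uu0"
      using open_real_other_point[OF intervals_open(3) base(3)] by blast
    \<comment> \<open>The slope of K makes K and H linearly independent on the two points
      \<open>uu0\<close> and \<open>u1\<close>: their determinant is 2 s4 s5.\<close>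
    define g H K where "g = quadr s2 0 x0" and "H = quadr s4 0 uu0" and "K = quadr s5 (s5 / (u1 - uu0)) uu0"
    have KH: "K u1 * H uu0 - K uu0 * H u1 = 2 * s4 * s5"
      unfolding K_def H_def quadr_second_value[OF nz(4) u1(2)] quadr_second_value[OF nz(5) u1(2)]
      by (simp add: algebra_simps)
    have rank: "(\<nu> x0 * s3) * (g x1 * deriv \<nu> x1) = (\<nu> x1 * quadr s3 b x0 x1) * (s2 * deriv \<nu> x0)" for b
    proof -
      have "quadr_elems x0 uu0 s (0, 0, b, 0, s5 / (u1 - uu0)) = (quadr s1 0 x0, g, quadr s3 b x0, H, K)"
        by (simp add: s' g_def H_def K_def)
      from product[OF this s] obtain h' K' where
        hK: "\<forall>x\<in>Ix. \<forall>u\<in>Iu. h' x * K' u = \<nu> x * quadr s3 b x0 x * K u - H u * g x * deriv \<nu> x"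
        by blast
      define \<alpha> \<beta> where "\<alpha> x = \<nu> x * quadr s3 b x0 x" and "\<beta> x = g x * deriv \<nu> x" for x
      have M: "h' x * K' u = \<alpha> x * K u - \<beta> x * H u" if "x \<in> Ix" "u \<in> Iu" for x u
        using hK that by (simp add: \<alpha>_def \<beta>_def algebra_simps)
      \<comment> \<open>The 2 x 2 minor of h'(x) K'(u) at x0, x1 and uu0, u1 vanishes. In terms of
        \<open>\<alpha>\<close> and \<open>\<beta>\<close> it factors into their minor and the
        determinant of K and H.\<close>
      have "(h' x0 * K' uu0) * (h' x1 * K' u1) = (h' x0 * K' u1) * (h' x1 * K' uu0)"
        by simp
      then have "(\<alpha> x0 * K uu0 - \<beta> x0 * H uu0) * (\<alpha> x1 * K u1 - \<beta> x1 * H u1) =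
          (\<alpha> x0 * K u1 - \<beta> x0 * H u1) * (\<alpha> x1 * K uu0 - \<beta> x1 * H uu0)"
        unfolding M[OF x0 base(3)] M[OF x1(1) u1(1)] M[OF x0 u1(1)] M[OF x1(1) base(3)] .
      then have "(\<alpha> x0 * \<beta> x1 - \<alpha> x1 * \<beta> x0) * (K u1 * H uu0 - K uu0 * H u1) = 0"
        by (simp add: algebra_simps)
      then have "\<alpha> x0 * \<beta> x1 = \<alpha> x1 * \<beta> x0"
        unfolding KH using nz by simp
      then show ?thesis
        by (simp add: \<alpha>_def \<beta>_def g_def)
    qed
    \<comment> \<open>\<open>\<nu>\<close> is the same function for all elements with values in the
      orthant, so only h(x1) in \<open>rank\<close> depends on the slope \<open>b\<close>; two
      slopes give it two different values.\<close>
    have "(\<nu> x1 * (3 * s3 + s3 * (x1 - x0)\<^sup>2)) * (s2 * deriv \<nu> x0) = (\<nu> x1 * (s3 + s3 * (x1 - x0)\<^sup>2)) * (s2 * deriv \<nu> x0)"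
      using rank[of "s3 / (x1 - x0)"] rank[of 0] unfolding quadr_second_value[OF nz(3) x1(2)] by simp
    then show False
      using \<nu>_nz[OF x1(1)] \<nu>' nz by simp
  qed
  have "convex Ix"
    using intervals(2) by (simp add: open_interval_def is_interval_convex)
  then have "\<exists>c. \<forall>x\<in>Ix. \<nu> x = c"
  proof (rule has_field_derivative_zero_constant)
    show "(\<nu> has_real_derivative 0) (at x within Ix)" if "x \<in> Ix" for x
      using deriv_\<nu>(2)[OF q s rel that] zero[OF that] by (auto intro: has_field_derivative_at_within)
  qed
  then obtain \<epsilon>1 where \<epsilon>1: "\<And>x. x \<in> Ix \<Longrightarrow> \<nu> x = \<epsilon>1"
    by blast
  have "N (z, a) = \<epsilon>1" if "z \<in> B" "a \<in> orthant s" for z a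
  proof -
    obtain t x u where z: "z = (t, x, u)"
      by (cases z)
    then have "x \<in> Ix"
      using that(1) by (simp add: B_def)
    then show ?thesis
      using \<nu>[OF that(1)[unfolded z] that(2)] \<epsilon>1 by (simp add: z)
  qed
  then show ?thesis
    using \<nu>_nz[OF base(2)] \<epsilon>1[OF base(2)] by auto
qed

text \<open>With m = \<epsilon>1 constant, h'(X x) K'(\<delta>3 u + \<delta>4) = \<epsilon>1 h(x)
  K(u). Separation of variables makes K' / K constant for each pair, hence TK / K constant on the
  orthant. Th follows by division, Tf from the definition of N, and Tg from the constant of the
  pair, which must be \<epsilon>2.\<close>

lemma T_on_orthant:
  assumes s: "s \<in> orthant s"
  shows "\<exists>\<epsilon>1 \<epsilon>2 \<epsilon>3. \<epsilon>1 \<noteq> 0 \<and> \<epsilon>2 \<noteq> 0 \<and> \<epsilon>3 \<noteq> 0 \<and>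
    (\<forall>t x u f g h H K. (t, x, u) \<in> B \<longrightarrow> (f, g, h, H, K) \<in> orthant s \<longrightarrow>
      snd (T ((t, x, u), (f, g, h, H, K))) =
        (\<epsilon>1 * \<delta>1\<^sup>2 / deriv X x * f, \<epsilon>1 / \<epsilon>2 * deriv X x * g, \<epsilon>1 / \<epsilon>3 * h, \<epsilon>2 * H, \<epsilon>3 * K))"
proof -
  obtain \<epsilon>1 where \<epsilon>1: "\<epsilon>1 \<noteq> 0" "\<And>z a. z \<in> B \<Longrightarrow> a \<in> orthant s \<Longrightarrow> N (z, a) = \<epsilon>1"
    using N_on_orthant[OF s] by blast
  obtain \<epsilon>2 where \<epsilon>2: "\<epsilon>2 \<noteq> 0"
    "\<And>z f g h H K. z \<in> B \<Longrightarrow> (f, g, h, H, K) \<in> orthant s \<Longrightarrow> TH (z, (f, g, h, H, K)) = \<epsilon>2 * H"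
    using TH_on_orthant[OF s] by metis
  obtain t0 x0 u0 where base: "t0 \<in> It" "x0 \<in> Ix" "u0 \<in> Iu"
    using intervals_open by auto
  note z0 = B_I[OF base]
  obtain s1 s2 s3 s4 s5 where s': "s = (s1, s2, s3, s4, s5)"
    by (cases s)
  have weight: "weight f f' x = \<epsilon>1"
    if q: "quadr_elems y u a d = (f, g, h, H, K)" and a: "a \<in> orthant s"
    and rel: "related (f, g, h, H, K) (f', g', h', H', K')" and x: "x \<in> Ix" for y u a d f g h H K f' g' h' H' K' x
  proof -
    have z: "(t0, x, u0) \<in> B"
      using x base by (simp add: B_def)
    show ?thesis
      using N_along_elements[OF rel z refl] \<epsilon>1(2)[OF z quadr_elems_orthant[OF a, of y u d "(t0, x, u0)"]]
      unfolding q by simp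
  qed
  have product: "h' (X x) * K' (\<delta>3 * u + \<delta>4) = \<epsilon>1 * h x * K u"
    if q: "quadr_elems y v a d = (f, g, h, H, K)" and a: "a \<in> orthant s"
    and rel: "related (f, g, h, H, K) (f', g', h', H', K')" and xu: "x \<in> Ix" "u \<in> Iu"
    for y v a d f g h H K f' g' h' H' K' x u
  proof -
    have "(weight f f' has_real_derivative 0) (at x)"
      by (rule has_field_derivative_transform_within_open[OF DERIV_const[of \<epsilon>1] intervals_open(2) xu(1)])
        (rule weight[OF q a rel, symmetric])
    from DERIV_imp_deriv[OF this] show ?thesis
      using related_elements(4)[OF rel xu] weight[OF q a rel xu(1)] by simp
  qed
  define E :: "txu \<times> elem_vals \<Rightarrow> real" where "E p = TK p / snd (snd (snd (snd (snd p))))" for p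
  have E: "E (z, a) = E ((t0, x0, u0), s)" if "z \<in> B" "a \<in> orthant s" for z a
  proof (rule constant_along_elements[OF _ _ that z0 s])
    fix z :: txu and a :: elem_vals
    assume "z \<in> B" "a \<in> orthant s"
    then show "E differentiable (at (z, a))"
      unfolding E_def using halfline_nonzero
      by (cases a; cases s) (intro differentiable_divide T_component_differentiable[OF T_components_smooth(5)];
        auto intro!: differentiableI derivative_eq_intros)
  next
    fix x u :: real and a d :: elem_vals
    assume a: "a \<in> orthant s"
    obtain f g h H K f' g' h' H' K' where q: "quadr_elems x u a d = (f, g, h, H, K)"
      and rel: "related (f, g, h, H, K) (f', g', h', H', K')"
      by (rule quadr_elemsE[OF a])
    have "E (z, vals_at (quadr_elems x u a d) z) = \<epsilon>1 * h x0 / h' (X x0)" if "z \<in> B" for z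
    proof -
      obtain t y v where z: "z = (t, y, v)"
        by (cases z)
      then have v: "v \<in> Iu"
        using that by (simp add: B_def)
      have "(f y, g y, h x0, H v, K v) \<in> orthant s"
        using quadr_elems_orthant[OF a, of x u d z] quadr_elems_orthant[OF a, of x u d "(t0, x0, u0)"]
        by (simp add: q z s')
      then have nz: "K v \<noteq> 0" "h x0 \<noteq> 0"
        using halfline_nonzero by (auto simp: s')
      have pr: "h' (X x0) * K' (\<delta>3 * v + \<delta>4) = \<epsilon>1 * h x0 * K v"
        by (rule product[OF q a rel base(2) v])
      then have "h' (X x0) \<noteq> 0"
        using nz \<epsilon>1(1) by auto
      then have "K' (\<delta>3 * v + \<delta>4) / K v = \<epsilon>1 * h x0 / h' (X x0)"
        using pr nz by (simp add: field_simps)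
      then show ?thesis
        using T_along_elements(5)[OF rel that[unfolded z] refl] by (simp add: E_def q z)
    qed
    then show "\<exists>e. \<forall>z\<in>B. E (z, vals_at (quadr_elems x u a d) z) = e"
      by blast
  qed
  define \<epsilon>3 where "\<epsilon>3 = E ((t0, x0, u0), s)"
  have formulas: "Tf ((t, x, u), (f, g, h, H, K)) = \<epsilon>1 * \<delta>1\<^sup>2 / deriv X x * f"
      "Tg ((t, x, u), (f, g, h, H, K)) = \<epsilon>1 / \<epsilon>2 * deriv X x * g"
      "TK ((t, x, u), (f, g, h, H, K)) = \<epsilon>3 * K"
      "Th ((t, x, u), (f, g, h, H, K)) * (\<epsilon>3 * K) = \<epsilon>1 * h * K" "h \<noteq> 0" "K \<noteq> 0"
    if z: "(t, x, u) \<in> B" and a: "(f, g, h, H, K) \<in> orthant s" for t x u f g h H K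
  proof -
    have xu: "x \<in> Ix" "u \<in> Iu"
      using z by (simp_all add: B_def)
    have nz: "f \<noteq> 0" "H \<noteq> 0" "h \<noteq> 0" "K \<noteq> 0"
      using a halfline_nonzero by (auto simp: s')
    show "h \<noteq> 0" "K \<noteq> 0"
      by fact+
    obtain ff gg hh HH KK f' g' h' H' K' where q: "quadr_elems x u (f, g, h, H, K) 0 = (ff, gg, hh, HH, KK)"
      and rel: "related (ff, gg, hh, HH, KK) (f', g', h', H', K')"
      by (rule quadr_elemsE[OF a])
    have at: "vals_at (ff, gg, hh, HH, KK) (t, x, u) = (f, g, h, H, K)"
      using quadr_elems_at[of x u "(f, g, h, H, K)" 0 t] by (simp add: q)
    then have vals: "ff x = f" "gg x = g" "hh x = h" "HH u = H" "KK u = K"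
      by simp_all
    note along = T_along_elements[OF rel z at]
    show "Tf ((t, x, u), (f, g, h, H, K)) = \<epsilon>1 * \<delta>1\<^sup>2 / deriv X x * f"
      using \<epsilon>1(2)[OF z a] nz X_deriv[OF xu(1)] \<delta>_nonzero by (simp add: N_def field_simps)
    show TK: "TK ((t, x, u), (f, g, h, H, K)) = \<epsilon>3 * K"
      using E[OF z a] nz by (simp add: E_def \<epsilon>3_def field_simps)
    show "Th ((t, x, u), (f, g, h, H, K)) * (\<epsilon>3 * K) = \<epsilon>1 * h * K"
      using product[OF q a rel xu] along TK by (simp add: vals)
    obtain \<epsilon> where \<epsilon>: "\<epsilon> \<noteq> 0" "H' (\<delta>3 * u + \<delta>4) = \<epsilon> * HH u" "g' (X x) = weight ff f' x * deriv X x * gg x / \<epsilon>"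
      using related_elements(1)[OF rel] xu by blast
    have "\<epsilon> = \<epsilon>2"
      using \<epsilon>(2) along(4) \<epsilon>2(2)[OF z a] nz by (simp add: vals)
    then show "Tg ((t, x, u), (f, g, h, H, K)) = \<epsilon>1 / \<epsilon>2 * deriv X x * g"
      using \<epsilon>(3) along(2) weight[OF q a rel xu(1)] by (simp add: vals)
  qed
  have \<epsilon>3: "\<epsilon>3 \<noteq> 0"
  proof -
    have "(s1, s2, s3, s4, s5) \<in> orthant s"
      unfolding s'[symmetric] by (rule s)
    from formulas(4-6)[OF z0 this] \<epsilon>1(1) show ?thesis
      by auto
  qed
  have "snd (T ((t, x, u), (f, g, h, H, K))) =
        (\<epsilon>1 * \<delta>1\<^sup>2 / deriv X x * f, \<epsilon>1 / \<epsilon>2 * deriv X x * g, \<epsilon>1 / \<epsilon>3 * h, \<epsilon>2 * H, \<epsilon>3 * K)"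
    if z: "(t, x, u) \<in> B" and a: "(f, g, h, H, K) \<in> orthant s" for t x u f g h H K
  proof -
    note fs = formulas[OF z a]
    have "Th ((t, x, u), (f, g, h, H, K)) = \<epsilon>1 / \<epsilon>3 * h"
      using fs(4,6) \<epsilon>3 by (simp add: field_simps)
    then show ?thesis
      using fs(1-3) \<epsilon>2(2)[OF z a] by (simp add: prod_eq_iff Tf_def Tg_def Th_def TH_def TK_def)
  qed
  then show ?thesis
    using \<epsilon>1(1) \<epsilon>2(1) \<epsilon>3 by blast
qed

end

text \<open>Along the ray through \<open>y\<close> the function \<open>\<phi>\<close> has the
  constant value \<open>\<alpha> y\<close> up to the origin, so by continuity
  \<open>\<alpha> y = \<phi> 0\<close> on either side.\<close>

lemma sign_independent:
  fixes \<phi> \<alpha> :: "real \<Rightarrow> real"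
  assumes \<phi>: "continuous_on UNIV \<phi>" and eq: "\<And>x y. x * y > 0 \<Longrightarrow> \<phi> x = \<alpha> y" and "y \<noteq> 0" "y' \<noteq> 0"
  shows "\<alpha> y = \<alpha> y'"
proof -
  have "\<alpha> y = \<phi> 0" if "y \<noteq> 0" for y
  proof (rule tendsto_unique)
    have "continuous_on UNIV (\<lambda>r. \<phi> (r * y))"
      by (intro continuous_on_compose2[OF \<phi>] continuous_intros) auto
    then have "isCont (\<lambda>r. \<phi> (r * y)) 0"
      by (simp add: continuous_on_eq_continuous_at)
    then have "((\<lambda>r. \<phi> (r * y)) \<longlongrightarrow> \<phi> 0) (at 0)"
      by (simp add: isCont_def)
    then show "((\<lambda>r. \<phi> (r * y)) \<longlongrightarrow> \<phi> 0) (at_right 0)"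
      by (rule filterlim_at_split[THEN iffD1, THEN conjunct2])
    have "eventually (\<lambda>r. \<phi> (r * y) = \<alpha> y) (at_right 0)"
      unfolding eventually_at_right_field
    proof (intro exI[of _ 1] conjI allI impI)
      fix r :: real
      assume "0 < r"
      moreover have "y * y > 0"
        using that by (simp add: power2_eq_square[symmetric])
      ultimately have "r * (y * y) > 0"
        by (rule mult_pos_pos)
      then show "\<phi> (r * y) = \<alpha> y"
        using eq[of "r * y" y] by (simp add: mult.assoc)
    qed simp
    then show "((\<lambda>r. \<phi> (r * y)) \<longlongrightarrow> \<alpha> y) (at_right 0)"
      by (rule tendsto_eventually)
  qed simp
  then show ?thesis
    using assms(3,4) by simp
qed

section \<open>From the orthants to the whole space of values\<close>

context fibered_equivalence_transformation
begin

lemma self_orthant: "(f, g, h, H, K) \<in> orthant (f, g, h, H, K) \<longleftrightarrow>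
    f \<noteq> 0 \<and> g \<noteq> 0 \<and> h \<noteq> 0 \<and> H \<noteq> 0 \<and> K \<noteq> 0"
  by (auto simp: halfline_def zero_less_mult_iff)

text \<open>By continuity, crossing one coordinate plane does not change the coefficients of the other four
  components of \<open>T\<close>, and these determine all three constants.\<close>

lemma T_off_coordinate_planes:
  "\<exists>\<epsilon>1 \<epsilon>2 \<epsilon>3. \<epsilon>1 \<noteq> 0 \<and> \<epsilon>2 \<noteq> 0 \<and> \<epsilon>3 \<noteq> 0 \<and> (\<forall>t x u f g h H K. (t, x, u) \<in> B \<longrightarrow>
    f \<noteq> 0 \<and> g \<noteq> 0 \<and> h \<noteq> 0 \<and> H \<noteq> 0 \<and> K \<noteq> 0 \<longrightarrow>
      snd (T ((t, x, u), (f, g, h, H, K))) =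
        (\<epsilon>1 * \<delta>1\<^sup>2 / deriv X x * f, \<epsilon>1 / \<epsilon>2 * deriv X x * g, \<epsilon>1 / \<epsilon>3 * h, \<epsilon>2 * H, \<epsilon>3 * K))"
proof -
  define W where "W s e1 e2 e3 \<longleftrightarrow> e1 \<noteq> 0 \<and> e2 \<noteq> 0 \<and> e3 \<noteq> 0 \<and>
    (\<forall>t x u f g h H K. (t, x, u) \<in> B \<longrightarrow> (f, g, h, H, K) \<in> orthant s \<longrightarrow>
      snd (T ((t, x, u), (f, g, h, H, K))) =
        (e1 * \<delta>1\<^sup>2 / deriv X x * f, e1 / e2 * deriv X x * g, e1 / e3 * h, e2 * H, e3 * K))" for s e1 e2 e3
  \<comment> \<open>The constants are chosen for every sign vector \<open>s\<close> at once, as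
    functions of \<open>s\<close>; what remains is that these functions take only one value.\<close>
  have "\<exists>e. \<forall>s. s \<in> orthant s \<longrightarrow> W s (fst (e s)) (fst (snd (e s))) (snd (snd (e s)))"
  proof (rule choice, rule allI)
    fix s
    show "\<exists>e. s \<in> orthant s \<longrightarrow> W s (fst e) (fst (snd e)) (snd (snd e))"
    proof (cases "s \<in> orthant s")
      case True
      then obtain e1 e2 e3 where "W s e1 e2 e3"
        unfolding W_def using T_on_orthant by blast
      then show ?thesis
        by (intro exI[of _ "(e1, e2, e3)"]) simp
    qed simp
  qed
  then obtain ee where ee: "\<And>s. s \<in> orthant s \<Longrightarrow> W s (fst (ee s)) (fst (snd (ee s))) (snd (snd (ee s)))"
    by blast
  define e1 e2 e3 where "e1 s = fst (ee s)" and "e2 s = fst (snd (ee s))" and "e3 s = snd (snd (ee s))" for s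
  have e: "W s (e1 s) (e2 s) (e3 s)" if "s \<in> orthant s" for s
    unfolding e1_def e2_def e3_def by (rule ee[OF that])
  obtain t0 x0 u0 where base: "t0 \<in> It" "x0 \<in> Ix" "u0 \<in> Iu"
    using intervals_open by auto
  define z0 where "z0 = (t0, x0, u0)"
  have z0: "z0 \<in> B"
    using base by (simp add: z0_def B_def)
  define k where "k = deriv X x0"
  have k: "k \<noteq> 0"
    using X_deriv base by (simp add: k_def)
  have nz: "e1 s \<noteq> 0" "e2 s \<noteq> 0" "e3 s \<noteq> 0" if "s \<in> orthant s" for s
    using e[OF that] by (simp_all add: W_def)
  have at: "\<forall>s a. s \<in> orthant s \<longrightarrow> a \<in> orthant s \<longrightarrow> Tf (z0, a) = e1 s * (\<delta>1\<^sup>2 / k * fst a)"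
    "\<forall>s a. s \<in> orthant s \<longrightarrow> a \<in> orthant s \<longrightarrow> Tg (z0, a) = e1 s / e2 s * (k * fst (snd a))"
    "\<forall>s a. s \<in> orthant s \<longrightarrow> a \<in> orthant s \<longrightarrow> Th (z0, a) = e1 s / e3 s * fst (snd (snd a))"
    "\<forall>s a. s \<in> orthant s \<longrightarrow> a \<in> orthant s \<longrightarrow> TH (z0, a) = e2 s * fst (snd (snd (snd a)))"
    "\<forall>s a. s \<in> orthant s \<longrightarrow> a \<in> orthant s \<longrightarrow> TK (z0, a) = e3 s * snd (snd (snd (snd a)))"
  proof -
    have "snd (T (z0, (f, g, h, H, K))) = (e1 s * \<delta>1\<^sup>2 / k * f, e1 s / e2 s * k * g, e1 s / e3 s * h, e2 s * H, e3 s * K)"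
      if "s \<in> orthant s" "(f, g, h, H, K) \<in> orthant s" for s f g h H K
      using e[OF that(1)] z0 that(2) unfolding W_def z0_def k_def by blast
    then show "\<forall>s a. s \<in> orthant s \<longrightarrow> a \<in> orthant s \<longrightarrow> Tf (z0, a) = e1 s * (\<delta>1\<^sup>2 / k * fst a)"
      "\<forall>s a. s \<in> orthant s \<longrightarrow> a \<in> orthant s \<longrightarrow> Tg (z0, a) = e1 s / e2 s * (k * fst (snd a))"
      "\<forall>s a. s \<in> orthant s \<longrightarrow> a \<in> orthant s \<longrightarrow> Th (z0, a) = e1 s / e3 s * fst (snd (snd a))"
      "\<forall>s a. s \<in> orthant s \<longrightarrow> a \<in> orthant s \<longrightarrow> TH (z0, a) = e2 s * fst (snd (snd (snd a)))"
      "\<forall>s a. s \<in> orthant s \<longrightarrow> a \<in> orthant s \<longrightarrow> TK (z0, a) = e3 s * snd (snd (snd (snd a)))"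
      by (simp_all add: Tf_def Tg_def Th_def TH_def TK_def)
  qed
  \<comment> \<open>The line \<open>c\<close> crosses one coordinate plane while the factor
    \<open>r\<close> of the component \<open>F\<close> keeps the nonzero value \<open>l\<close>. So
    F / l is continuous on the whole line and equals the coefficient \<open>C\<close> off the
    plane.\<close>
  have move: "C (c y) = C (c y')"
    if F: "smooth_on (B \<times> UNIV) F" "\<forall>s a. s \<in> orthant s \<longrightarrow> a \<in> orthant s \<longrightarrow> F (z0, a) = C s * r a"
      and c: "continuous_on UNIV c" "\<forall>x y. x * y > 0 \<longrightarrow> c x \<in> orthant (c y)"
      and r: "\<forall>x. r (c x) = l" "l \<noteq> 0" and y: "y \<noteq> 0" "y' \<noteq> 0"
    for C r :: "elem_vals \<Rightarrow> real" and F and c :: "real \<Rightarrow> elem_vals" and y y' l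
  proof (rule sign_independent[where \<phi> = "\<lambda>x. F (z0, c x) / l" and \<alpha> = "\<lambda>y. C (c y)", OF _ _ y])
    show "continuous_on UNIV (\<lambda>x. F (z0, c x) / l)"
      using z0 r(2) by (intro continuous_intros continuous_on_compose2[OF smooth_on_continuous_on[OF F(1)]] c) auto
    show "F (z0, c x) / l = C (c y)" if "x * y > 0" for x y
    proof -
      have "y * y > 0"
        using that by (auto simp: zero_less_mult_iff)
      then have "F (z0, c x) = C (c y) * r (c x)"
        using F(2) c(2) that by blast
      then show ?thesis
        using r by simp
    qed
  qed
  note moves = move[OF T_components_smooth(1) at(1)] move[OF T_components_smooth(2) at(2)]
    move[OF T_components_smooth(3) at(3)] move[OF T_components_smooth(4) at(4)] move[OF T_components_smooth(5) at(5)]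
  define V where "V s = (e1 s, e2 s, e3 s)" for s
  have V_f: "V (y, g, h, H, K) = V (y', g, h, H, K)"
    if "y \<noteq> 0" "y' \<noteq> 0" "g \<noteq> 0" "h \<noteq> 0" "H \<noteq> 0" "K \<noteq> 0" for y y' g h H K
  proof -
    define c where "c x = (x, g, h, H, K)" for x :: real
    have c: "continuous_on UNIV c" "\<forall>x y. x * y > 0 \<longrightarrow> c x \<in> orthant (c y)"
      using that by (auto simp: c_def halfline_def mult.commute zero_less_mult_iff intro!: continuous_intros)
    \<comment> \<open>In the f-direction the factor of the first component varies, so e1 is
      recovered from e1 / e2 and e2. The H- and K-directions below recover e2 from e1 / e2 and e3
      from e1 / e3 in the same way.\<close>
    have "e1 (c y) / e2 (c y) = e1 (c y') / e2 (c y')" "e2 (c y) = e2 (c y')" "e3 (c y) = e3 (c y')"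
      using moves(2)[OF c, of "k * g" y y'] moves(4)[OF c, of H y y'] moves(5)[OF c, of K y y'] that k
      by (simp_all add: c_def)
    moreover have "e2 (c y') \<noteq> 0"
      using nz(2)[of "c y'"] that unfolding c_def self_orthant by blast
    ultimately show ?thesis
      by (simp add: V_def c_def)
  qed
  have V_g: "V (f, y, h, H, K) = V (f, y', h, H, K)"
    if "y \<noteq> 0" "y' \<noteq> 0" "f \<noteq> 0" "h \<noteq> 0" "H \<noteq> 0" "K \<noteq> 0" for y y' f h H K
  proof -
    define c where "c x = (f, x, h, H, K)" for x :: real
    have c: "continuous_on UNIV c" "\<forall>x y. x * y > 0 \<longrightarrow> c x \<in> orthant (c y)"
      using that by (auto simp: c_def halfline_def mult.commute zero_less_mult_iff intro!: continuous_intros)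
    have "e1 (c y) = e1 (c y')" "e2 (c y) = e2 (c y')" "e3 (c y) = e3 (c y')"
      using moves(1)[OF c, of "\<delta>1\<^sup>2 / k * f" y y'] moves(4)[OF c, of H y y'] moves(5)[OF c, of K y y']
        that k \<delta>_nonzero by (simp_all add: c_def)
    then show ?thesis
      by (simp add: V_def c_def)
  qed
  have V_h: "V (f, g, y, H, K) = V (f, g, y', H, K)"
    if "y \<noteq> 0" "y' \<noteq> 0" "f \<noteq> 0" "g \<noteq> 0" "H \<noteq> 0" "K \<noteq> 0" for y y' f g H K
  proof -
    define c where "c x = (f, g, x, H, K)" for x :: real
    have c: "continuous_on UNIV c" "\<forall>x y. x * y > 0 \<longrightarrow> c x \<in> orthant (c y)"
      using that by (auto simp: c_def halfline_def mult.commute zero_less_mult_iff intro!: continuous_intros)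
    have "e1 (c y) = e1 (c y')" "e2 (c y) = e2 (c y')" "e3 (c y) = e3 (c y')"
      using moves(1)[OF c, of "\<delta>1\<^sup>2 / k * f" y y'] moves(4)[OF c, of H y y'] moves(5)[OF c, of K y y']
        that k \<delta>_nonzero by (simp_all add: c_def)
    then show ?thesis
      by (simp add: V_def c_def)
  qed
  have V_H: "V (f, g, h, y, K) = V (f, g, h, y', K)"
    if "y \<noteq> 0" "y' \<noteq> 0" "f \<noteq> 0" "g \<noteq> 0" "h \<noteq> 0" "K \<noteq> 0" for y y' f g h K
  proof -
    define c where "c x = (f, g, h, x, K)" for x :: real
    have c: "continuous_on UNIV c" "\<forall>x y. x * y > 0 \<longrightarrow> c x \<in> orthant (c y)"
      using that by (auto simp: c_def halfline_def mult.commute zero_less_mult_iff intro!: continuous_intros)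
    have "e1 (c y) = e1 (c y')" "e1 (c y) / e2 (c y) = e1 (c y') / e2 (c y')" "e3 (c y) = e3 (c y')"
      using moves(1)[OF c, of "\<delta>1\<^sup>2 / k * f" y y'] moves(2)[OF c, of "k * g" y y'] moves(5)[OF c, of K y y']
        that k \<delta>_nonzero by (simp_all add: c_def)
    moreover have "e1 (c y') \<noteq> 0" "e2 (c y) \<noteq> 0" "e2 (c y') \<noteq> 0"
      using nz(1,2)[of "c y'"] nz(2)[of "c y"] that unfolding c_def self_orthant by blast+
    ultimately show ?thesis
      by (simp add: V_def c_def)
  qed
  have V_K: "V (f, g, h, H, y) = V (f, g, h, H, y')"
    if "y \<noteq> 0" "y' \<noteq> 0" "f \<noteq> 0" "g \<noteq> 0" "h \<noteq> 0" "H \<noteq> 0" for y y' f g h H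
  proof -
    define c where "c x = (f, g, h, H, x)" for x :: real
    have c: "continuous_on UNIV c" "\<forall>x y. x * y > 0 \<longrightarrow> c x \<in> orthant (c y)"
      using that by (auto simp: c_def halfline_def mult.commute zero_less_mult_iff intro!: continuous_intros)
    have "e1 (c y) = e1 (c y')" "e1 (c y) / e3 (c y) = e1 (c y') / e3 (c y')" "e2 (c y) = e2 (c y')"
      using moves(1)[OF c, of "\<delta>1\<^sup>2 / k * f" y y'] moves(3)[OF c, of h y y'] moves(4)[OF c, of H y y']
        that k \<delta>_nonzero by (simp_all add: c_def)
    moreover have "e1 (c y') \<noteq> 0" "e3 (c y) \<noteq> 0" "e3 (c y') \<noteq> 0"
      using nz(1,3)[of "c y'"] nz(3)[of "c y"] that unfolding c_def self_orthant by blast+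
    ultimately show ?thesis
      by (simp add: V_def c_def)
  qed
  define s where "s = (1 :: real, 1 :: real, 1 :: real, 1 :: real, 1 :: real)"
  have s: "s \<in> orthant s"
    unfolding s_def self_orthant by simp
  have V: "V (f, g, h, H, K) = V s" if "f \<noteq> 0" "g \<noteq> 0" "h \<noteq> 0" "H \<noteq> 0" "K \<noteq> 0" for f g h H K
  proof -
    have "V (f, g, h, H, K) = V (1, g, h, H, K)"
      by (rule V_f) (use that in auto)
    also have "\<dots> = V (1, 1, h, H, K)"
      by (rule V_g) (use that in auto)
    also have "\<dots> = V (1, 1, 1, H, K)"
      by (rule V_h) (use that in auto)
    also have "\<dots> = V (1, 1, 1, 1, K)"
      by (rule V_H) (use that in auto)
    also have "\<dots> = V s"
      unfolding s_def by (rule V_K) (use that in auto)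
    finally show ?thesis .
  qed
  have "snd (T ((t, x, u), (f, g, h, H, K))) =
      (e1 s * \<delta>1\<^sup>2 / deriv X x * f, e1 s / e2 s * deriv X x * g, e1 s / e3 s * h, e2 s * H, e3 s * K)"
    if z: "(t, x, u) \<in> B" and a: "f \<noteq> 0" "g \<noteq> 0" "h \<noteq> 0" "H \<noteq> 0" "K \<noteq> 0" for t x u f g h H K
  proof -
    have o: "(f, g, h, H, K) \<in> orthant (f, g, h, H, K)"
      unfolding self_orthant using a by blast
    have eq: "e1 (f, g, h, H, K) = e1 s" "e2 (f, g, h, H, K) = e2 s" "e3 (f, g, h, H, K) = e3 s"
      using V[OF a] by (simp_all add: V_def)
    show ?thesis
      using e[OF o] z o unfolding W_def eq by blast
  qed
  then show ?thesis
    using nz[OF s] by (intro exI[of _ "e1 s"] exI[of _ "e2 s"] exI[of _ "e3 s"] conjI allI impI) simp_all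
qed

text \<open>Adding the same small nonzero r to all five values leaves every coordinate plane, so
  both sides agree along this path and, by continuity, also at r = 0.\<close>

lemma T_formula:
  "\<exists>\<epsilon>1 \<epsilon>2 \<epsilon>3. \<epsilon>1 \<noteq> 0 \<and> \<epsilon>2 \<noteq> 0 \<and> \<epsilon>3 \<noteq> 0 \<and> (\<forall>t x u. (t, x, u) \<in> B \<longrightarrow> (\<forall>f g h H K.
    snd (T ((t, x, u), (f, g, h, H, K))) =
      (\<epsilon>1 * \<delta>1\<^sup>2 / deriv X x * f, \<epsilon>1 / \<epsilon>2 * deriv X x * g, \<epsilon>1 / \<epsilon>3 * h, \<epsilon>2 * H, \<epsilon>3 * K)))"
proof -
  obtain \<epsilon>1 \<epsilon>2 \<epsilon>3 where \<epsilon>: "\<epsilon>1 \<noteq> 0" "\<epsilon>2 \<noteq> 0" "\<epsilon>3 \<noteq> 0"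
    and T: "\<And>t x u f g h H K. (t, x, u) \<in> B \<Longrightarrow> f \<noteq> 0 \<and> g \<noteq> 0 \<and> h \<noteq> 0 \<and> H \<noteq> 0 \<and> K \<noteq> 0 \<Longrightarrow>
      snd (T ((t, x, u), (f, g, h, H, K))) =
        (\<epsilon>1 * \<delta>1\<^sup>2 / deriv X x * f, \<epsilon>1 / \<epsilon>2 * deriv X x * g, \<epsilon>1 / \<epsilon>3 * h, \<epsilon>2 * H, \<epsilon>3 * K)"
    using T_off_coordinate_planes by metis
  have "snd (T ((t, x, u), (f, g, h, H, K))) =
      (\<epsilon>1 * \<delta>1\<^sup>2 / deriv X x * f, \<epsilon>1 / \<epsilon>2 * deriv X x * g, \<epsilon>1 / \<epsilon>3 * h, \<epsilon>2 * H, \<epsilon>3 * K)"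
    if z: "(t, x, u) \<in> B" for t x u f g h H K
  proof -
    define \<phi> where "\<phi> r = snd (T ((t, x, u), (f + r, g + r, h + r, H + r, K + r)))" for r
    define \<psi> where "\<psi> r = (\<epsilon>1 * \<delta>1\<^sup>2 / deriv X x * (f + r), \<epsilon>1 / \<epsilon>2 * deriv X x * (g + r),
      \<epsilon>1 / \<epsilon>3 * (h + r), \<epsilon>2 * (H + r), \<epsilon>3 * (K + r))" for r
    have "continuous_on UNIV \<phi>"
      unfolding \<phi>_def using z
      by (intro continuous_intros continuous_on_compose2[OF smooth_on_continuous_on[OF T_smooth]]) auto
    then have "(\<phi> \<longlongrightarrow> \<phi> 0) (at 0)"
      by (simp add: continuous_on_eq_continuous_at isCont_def)
    moreover have "(\<psi> \<longlongrightarrow> \<psi> 0) (at 0)"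
      unfolding \<psi>_def by (intro tendsto_intros)
    moreover have "eventually (\<lambda>r. \<psi> r = \<phi> r) (at 0)"
      using eventually_neq_at_within[of "- f" 0 UNIV] eventually_neq_at_within[of "- g" 0 UNIV]
        eventually_neq_at_within[of "- h" 0 UNIV] eventually_neq_at_within[of "- H" 0 UNIV]
        eventually_neq_at_within[of "- K" 0 UNIV]
    proof eventually_elim
      case (elim r)
      then show ?case
        unfolding \<phi>_def \<psi>_def by (intro T[OF z, symmetric]) (auto simp: add_eq_0_iff)
    qed
    ultimately have "\<phi> 0 = \<psi> 0"
      using tendsto_unique[of "at (0 :: real)" \<phi>] tendsto_cong[of \<psi> \<phi>] by auto
    then show ?thesis
      by (simp add: \<phi>_def \<psi>_def)
  qed
  then show ?thesis
    using \<epsilon> by blast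
qed

end

section \<open>Elements of the group have the normal form\<close>

definition normal_form :: "real set \<Rightarrow> real set \<Rightarrow> real set \<Rightarrow> (txu \<times> elem_vals \<Rightarrow> txu \<times> elem_vals) \<Rightarrow> bool" where
  "normal_form It Ix Iu T \<longleftrightarrow> (\<exists>\<delta>1 \<delta>2 \<delta>3 \<delta>4 \<epsilon>1 \<epsilon>2 \<epsilon>3 :: real. \<exists>X :: real \<Rightarrow> real.
      \<delta>1 * \<delta>3 * \<epsilon>1 * \<epsilon>2 * \<epsilon>3 \<noteq> 0 \<and> smooth_on Ix X \<and> (\<forall>x\<in>Ix. deriv X x \<noteq> 0) \<and>
      (\<forall>t\<in>It. \<forall>x\<in>Ix. \<forall>u\<in>Iu. \<forall>f g h H K.
        T ((t, x, u), (f, g, h, H, K)) =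
          ((\<delta>1 * t + \<delta>2, X x, \<delta>3 * u + \<delta>4),
           (\<epsilon>1 * \<delta>1\<^sup>2 / deriv X x * f, \<epsilon>1 * inverse \<epsilon>2 * deriv X x * g, \<epsilon>1 * inverse \<epsilon>3 * h,
            \<epsilon>2 * H, \<epsilon>3 * K))))"

context equivalence_transformation
begin

lemma T_normal_form: "normal_form It Ix Iu T"
proof -
  obtain \<delta>1 \<delta>2 where P: "\<delta>1 \<noteq> 0" "\<And>t x u. (t, x, u) \<in> B \<Longrightarrow> P (t, x, u) = \<delta>1 * t + \<delta>2"
    using P_affine by fastforce
  obtain \<delta>3 \<delta>4 where R: "\<delta>3 \<noteq> 0" "\<And>t x u. (t, x, u) \<in> B \<Longrightarrow> R (t, x, u) = \<delta>3 * u + \<delta>4"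
    using R_affine by fastforce
  obtain t0 x0 u0 where base: "t0 \<in> It" "x0 \<in> Ix" "u0 \<in> Iu"
    using intervals_open by auto
  \<comment> \<open>Q is constant in t and u on the convex box, so its restriction to one line in
    the x-direction serves as X.\<close>
  define X where "X x = Q (t0, x, u0)" for x
  have "smooth_on Ix (\<lambda>x. (t0, x, u0))"
    by (intro smooth_on_intros intervals_open)
  moreover have "(\<lambda>x. (t0, x, u0)) ` Ix \<subseteq> B"
    using base by (auto simp: B_def)
  ultimately have X: "smooth_on Ix X"
    unfolding X_def using smooth_on_compose[OF smooth_PQR(2) _ open_B intervals_open(2)] by blast
  have dX: "deriv X x \<noteq> 0" if "x \<in> Ix" for x
  proof -
    have z: "(t0, x, u0) \<in> B"
      using that base by (simp add: B_def)
    have "(X has_real_derivative Dx Q (t0, x, u0)) (at x)"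
      using DERIV_shift[of X "Dx Q (t0, x, u0)" 0 x]
        smooth_on_line[OF smooth_PQR(2) open_B z, of "(0, 1, 0)"] by (simp add: X_def[abs_def] add.commute)
    then show ?thesis
      using DERIV_imp_deriv diagonal_nonzero(2)[OF z] by metis
  qed
  have Q: "Q (t, x, u) = X x" if z: "(t, x, u) \<in> B" for t x u
  proof -
    have z0: "(t0, x, u0) \<in> B"
      using z base by (simp add: B_def)
    have "dd (t - t0, 0, u - u0) Q q = 0" if "q \<in> B" for q
      unfolding dd_expand[OF smooth_PQR(2) that, of "t - t0" 0 "u - u0"]
      using cross_derivatives_vanish[OF that] u_derivatives_vanish[OF that] by simp
    from constant_along_line[OF smooth_PQR(2) open_B convex_B this z0] show ?thesis
      using z by (simp add: X_def)
  qed
  interpret fibered_equivalence_transformation It Ix Iu T P Q R B \<delta>1 \<delta>2 \<delta>3 \<delta>4 X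
    by unfold_locales (use P[unfolded B_def] R[unfolded B_def] Q[unfolded B_def] X dX in auto)
  obtain \<epsilon>1 \<epsilon>2 \<epsilon>3 where \<epsilon>: "\<epsilon>1 \<noteq> 0" "\<epsilon>2 \<noteq> 0" "\<epsilon>3 \<noteq> 0"
    and T: "\<forall>t x u. (t, x, u) \<in> B \<longrightarrow> (\<forall>f g h H K. snd (T ((t, x, u), (f, g, h, H, K))) =
      (\<epsilon>1 * \<delta>1\<^sup>2 / deriv X x * f, \<epsilon>1 / \<epsilon>2 * deriv X x * g, \<epsilon>1 / \<epsilon>3 * h, \<epsilon>2 * H, \<epsilon>3 * K))"
    using T_formula by blast
  have "T ((t, x, u), (f, g, h, H, K)) = ((\<delta>1 * t + \<delta>2, X x, \<delta>3 * u + \<delta>4),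
       (\<epsilon>1 * \<delta>1\<^sup>2 / deriv X x * f, \<epsilon>1 * inverse \<epsilon>2 * deriv X x * g, \<epsilon>1 * inverse \<epsilon>3 * h, \<epsilon>2 * H, \<epsilon>3 * K))"
    if "t \<in> It" "x \<in> Ix" "u \<in> Iu" for t x u f g h H K
    using T[rule_format, OF B_I[OF that]] fst_T[OF B_I[OF that]] PQR_eq[OF B_I[OF that]]
    by (subst prod_eq_iff) (simp add: divide_inverse)
  moreover have "\<delta>1 * \<delta>3 * \<epsilon>1 * \<epsilon>2 * \<epsilon>3 \<noteq> 0"
    using \<epsilon> \<delta>_nonzero by simp
  ultimately show ?thesis
    unfolding normal_form_def using X dX by blast
qed

end

lemma usual_equivalence_group_normal_form:
  assumes "open_interval It" "open_interval Ix" "open_interval Iu" and T: "T \<in> usual_equivalence_group It Ix Iu"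
  shows "normal_form It Ix Iu T"
proof -
  let ?B = "It \<times> Ix \<times> Iu"
  obtain \<Phi> where *: "smooth_on (?B \<times> UNIV) T" "\<forall>p\<in>?B \<times> UNIV. bij (frechet_derivative T (at p))"
    "\<forall>z\<in>?B. \<forall>a. fst (T (z, a)) = \<Phi> z"
    "\<forall>\<theta>. admissible Ix Iu \<theta> \<longrightarrow>
      (\<exists>\<theta>'. admissible ((\<lambda>(t, x, u). x) ` \<Phi> ` ?B) ((\<lambda>(t, x, u). u) ` \<Phi> ` ?B) \<theta>' \<and>
        (\<forall>z\<in>?B. snd (T (z, vals_at \<theta> z)) = vals_at \<theta>' (\<Phi> z)) \<and> transforms_equation ?B \<Phi> \<theta> \<theta>')"
    using T unfolding usual_equivalence_group_def Let_def by blast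
  define P Q R where "P z = fst (\<Phi> z)" and "Q z = fst (snd (\<Phi> z))" and "R z = snd (snd (\<Phi> z))" for z
  have \<Phi>: "\<Phi> = (\<lambda>z. (P z, Q z, R z))"
    by (simp add: P_def Q_def R_def)
  have images: "(\<lambda>(t, x, u). x) ` \<Phi> ` ?B = Q ` ?B" "(\<lambda>(t, x, u). u) ` \<Phi> ` ?B = R ` ?B"
    by (simp_all add: \<Phi> image_image)
  interpret equivalence_transformation It Ix Iu T P Q R ?B
  proof unfold_locales
    show "\<exists>\<theta>'. admissible (Q ` ?B) (R ` ?B) \<theta>' \<and> (\<forall>z\<in>?B. snd (T (z, vals_at \<theta> z)) = vals_at \<theta>' (P z, Q z, R z)) \<and>
        transforms_equation ?B (\<lambda>z. (P z, Q z, R z)) \<theta> \<theta>'" if "admissible Ix Iu \<theta>" for \<theta>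
      using *(4) that unfolding images unfolding \<Phi> by blast
    show "fst (T (z, a)) = (P z, Q z, R z)" if "z \<in> ?B" for z a
      using *(3) that unfolding \<Phi> by blast
  qed (use assms * in auto)
  show ?thesis
    by (rule T_normal_form)
qed

section \<open>The transformations in normal form are equivalences\<close>

text \<open>The mean value theorem gives injectivity, and invariance of domain gives an open image
  and a continuous inverse. The derivative of Y is 1 / X_x evaluated at Y, and this first-order
  equation makes Y smooth.\<close>

lemma smooth_inverse_real:
  fixes X :: "real \<Rightarrow> real"
  assumes X: "smooth_on I X" and I: "open I" "is_interval I" and dX: "\<And>x. x \<in> I \<Longrightarrow> deriv X x \<noteq> 0"
  obtains Y where "open (X ` I)" "\<And>x. x \<in> I \<Longrightarrow> Y (X x) = x" "smooth_on (X ` I) Y"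
    "\<And>x. x \<in> I \<Longrightarrow> (Y has_real_derivative inverse (deriv X x)) (at (X x))"
proof -
  have inj: "inj_on X I"
  proof (rule linorder_inj_onI)
    fix a b assume ab: "a < b" "a \<in> I" "b \<in> I"
    have "DERIV X x :> deriv X x" if "a \<le> x" "x \<le> b" for x
      using smooth_on_DERIV[OF X] mem_is_interval_1_I[OF I(2) ab(2,3) that] by blast
    then obtain z where z: "a < z" "z < b" "X b - X a = (b - a) * deriv X z"
      using MVT2[OF ab(1), of X "deriv X"] by blast
    have "z \<in> I"
      using mem_is_interval_1_I[OF I(2) ab(2,3)] z by simp
    then show "X a \<noteq> X b"
      using z dX ab by auto
  qed auto
  have op: "open (X ` I)"
    by (rule invariance_of_domain[OF smooth_on_continuous_on[OF X] I(1) inj])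
  obtain Y where Y: "homeomorphism I (X ` I) X Y"
    by (rule invariance_of_domain_homeomorphism[OF I(1) smooth_on_continuous_on[OF X] _ inj]) auto
  have YX: "Y (X x) = x" if "x \<in> I" for x
    using Y that by (auto simp: homeomorphism_def)
  have der: "(Y has_derivative (\<lambda>v. inverse (deriv X (Y y)) * v)) (at y)" if y: "y \<in> X ` I" for y
  proof (rule has_derivative_inverse_basic[OF _ _ _ _ op y])
    have "Y y \<in> I"
      using y YX by auto
    then show "(X has_derivative (*) (deriv X (Y y))) (at (Y y))"
      using smooth_on_DERIV[OF X] by (simp add: has_field_derivative_def)
    show "bounded_linear (\<lambda>v. inverse (deriv X (Y y)) * v)"
      by (rule bounded_linear_mult_right)
    show "(\<lambda>v. inverse (deriv X (Y y)) * v) \<circ> (*) (deriv X (Y y)) = id"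
      using dX[OF \<open>Y y \<in> I\<close>] by auto
    show "continuous (at y) Y"
      using Y op y continuous_on_eq_continuous_at[of "X ` I" Y] unfolding homeomorphism_def by blast
    show "X (Y z) = z" if "z \<in> X ` I" for z
      using that YX by auto
  qed
  show thesis
  proof (rule that[OF op YX])
    show "smooth_on (X ` I) Y"
    proof (rule smooth_on_of_derivative_comp[OF I(1) op _ _ der])
      show "Y ` X ` I \<subseteq> I"
        using YX by auto
      show "smooth_on I (\<lambda>x. inverse (deriv X x) * v)" for v
        by (intro smooth_on_mult smooth_on_inverse smooth_on_const smooth_on_deriv X I dX)
    qed
    show "(Y has_real_derivative inverse (deriv X x)) (at (X x))" if "x \<in> I" for x
      using der[of "X x"] that YX[OF that] by (simp add: has_field_derivative_def)
  qed
qed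

lemma graph_on_iff: "(t, x, u) \<in> graph_on W w \<longleftrightarrow> (t, x) \<in> W \<and> u = w (t, x)"
  unfolding graph_on_def by force

locale normal_form_transformation =
  fixes It Ix Iu :: "real set" and T :: "txu \<times> elem_vals \<Rightarrow> txu \<times> elem_vals"
    and \<delta>1 \<delta>2 \<delta>3 \<delta>4 \<epsilon>1 \<epsilon>2 \<epsilon>3 :: real and X :: "real \<Rightarrow> real"
  assumes intervals: "open_interval It" "open_interval Ix" "open_interval Iu"
    and nonzero: "\<delta>1 \<noteq> 0" "\<delta>3 \<noteq> 0" "\<epsilon>1 \<noteq> 0" "\<epsilon>2 \<noteq> 0" "\<epsilon>3 \<noteq> 0"
    and X_smooth: "smooth_on Ix X" and X_deriv: "\<And>x. x \<in> Ix \<Longrightarrow> deriv X x \<noteq> 0"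
    and T: "\<And>t x u f g h H K. t \<in> It \<Longrightarrow> x \<in> Ix \<Longrightarrow> u \<in> Iu \<Longrightarrow> T ((t, x, u), (f, g, h, H, K)) =
      ((\<delta>1 * t + \<delta>2, X x, \<delta>3 * u + \<delta>4),
       (\<epsilon>1 * \<delta>1\<^sup>2 / deriv X x * f, \<epsilon>1 * inverse \<epsilon>2 * deriv X x * g, \<epsilon>1 * inverse \<epsilon>3 * h, \<epsilon>2 * H, \<epsilon>3 * K))"
begin

lemma intervals_open: "open It" "open Ix" "open Iu" "It \<noteq> {}" "Ix \<noteq> {}" "Iu \<noteq> {}"
  using intervals by (auto simp: open_interval_def)

definition "D = (It \<times> Ix \<times> Iu) \<times> (UNIV :: elem_vals set)"

lemma open_D: "open D"
  unfolding D_def by (intro open_Times intervals_open open_UNIV)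

text \<open>\<open>T\<close> is prescribed on \<open>D\<close> only. This total expression in
  projections coincides with it there, and smoothness and derivatives carry over because
  \<open>D\<close> is open.\<close>

definition T0 :: "txu \<times> elem_vals \<Rightarrow> txu \<times> elem_vals" where
  "T0 p = ((\<delta>1 * fst (fst p) + \<delta>2, X (fst (snd (fst p))), \<delta>3 * snd (snd (fst p)) + \<delta>4),
    (\<epsilon>1 * \<delta>1\<^sup>2 * (inverse (deriv X (fst (snd (fst p)))) * fst (snd p)),
     \<epsilon>1 * inverse \<epsilon>2 * (deriv X (fst (snd (fst p))) * fst (snd (snd p))), \<epsilon>1 * inverse \<epsilon>3 * fst (snd (snd (snd p))),
     \<epsilon>2 * fst (snd (snd (snd (snd p)))), \<epsilon>3 * snd (snd (snd (snd (snd p))))))"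

lemma T_eq: "p \<in> D \<Longrightarrow> T p = T0 p"
  using T by (cases p) (auto simp: D_def T0_def divide_inverse)

lemma smooth_x_component: "smooth_on Ix F \<Longrightarrow> smooth_on D (\<lambda>p. F (fst (snd (fst p))))"
  by (rule smooth_on_compose[OF _ smooth_on_fst[OF smooth_on_snd[OF smooth_on_fst[OF smooth_on_ident]]] intervals_open(2) open_D];
      (intro open_D)?) (auto simp: D_def)

lemma T_smooth: "smooth_on D T"
proof -
  have "smooth_on D T0"
    unfolding T0_def
    by (intro smooth_on_intros smooth_on_inverse smooth_x_component smooth_on_deriv X_smooth intervals_open open_D)
      (auto simp: D_def X_deriv)
  then show ?thesis
    using smooth_on_cong[OF open_D, of T T0] T_eq by simp
qed

lemma x_component_has_derivative:
  assumes "(F has_real_derivative F') (at x)"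
  shows "((\<lambda>p :: txu \<times> elem_vals. F (fst (snd (fst p)))) has_derivative (\<lambda>v. F' * fst (snd (fst v)))) (at ((t, x, u), a))"
proof -
  have "((\<lambda>p :: txu \<times> elem_vals. fst (snd (fst p))) has_derivative (\<lambda>v. fst (snd (fst v)))) (at ((t, x, u), a))"
    by (auto intro!: derivative_eq_intros)
  then show ?thesis
    using diff_chain_at[of "\<lambda>p :: txu \<times> elem_vals. fst (snd (fst p))" "\<lambda>v. fst (snd (fst v))" "((t, x, u), a)" F "(*) F'"]
      assms by (simp add: comp_def has_field_derivative_def)
qed

text \<open>The derivative is triangular: beyond its diagonal it has only the terms with
  \<open>X3\<close> and \<open>X2\<close> in the f- and g-components, both multiples of the
  x-component. So the kernel is trivial, and an injective linear map of a finite-dimensional space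
  into itself is bijective.\<close>

lemma T_bij:
  assumes p: "p \<in> D"
  shows "bij (frechet_derivative T (at p))"
proof -
  obtain t x u f g h H K where p': "p = ((t, x, u), (f, g, h, H, K))"
    by (metis prod.collapse)
  have x: "x \<in> Ix"
    using p by (simp add: D_def p')
  define X1 where "X1 = deriv X x"
  have X1: "X1 \<noteq> 0"
    using X_deriv[OF x] by (simp add: X1_def)
  have dX: "(X has_real_derivative X1) (at x)"
    unfolding X1_def by (rule smooth_on_DERIV[OF X_smooth x])
  have smX: "smooth_on Ix (deriv X)"
    by (rule smooth_on_deriv[OF X_smooth intervals_open(2)])
  obtain X2 where X2: "(deriv X has_real_derivative X2) (at x)"
    using smooth_on_DERIV[OF smX x] by blast
  have "smooth_on Ix (\<lambda>x. inverse (deriv X x))"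
    by (rule smooth_on_inverse[OF smX intervals_open(2) X_deriv])
  then obtain X3 where X3: "((\<lambda>x. inverse (deriv X x)) has_real_derivative X3) (at x)"
    using smooth_on_DERIV x by blast
  define L :: "txu \<times> elem_vals \<Rightarrow> txu \<times> elem_vals" where
    "L v = ((\<delta>1 * fst (fst v), X1 * fst (snd (fst v)), \<delta>3 * snd (snd (fst v))),
      (\<epsilon>1 * \<delta>1\<^sup>2 * (inverse X1 * fst (snd v) + X3 * fst (snd (fst v)) * f),
       \<epsilon>1 * inverse \<epsilon>2 * (X1 * fst (snd (snd v)) + X2 * fst (snd (fst v)) * g), \<epsilon>1 * inverse \<epsilon>3 * fst (snd (snd (snd v))),
       \<epsilon>2 * fst (snd (snd (snd (snd v)))), \<epsilon>3 * snd (snd (snd (snd (snd v))))))" for v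
  note dx = x_component_has_derivative[OF dX, of t u "(f, g, h, H, K)"]
  have 1: "((\<lambda>p. inverse (deriv X (fst (snd (fst p)))) * fst (snd p)) has_derivative
      (\<lambda>v. inverse X1 * fst (snd v) + X3 * fst (snd (fst v)) * f)) (at p)"
    using has_derivative_mult[OF x_component_has_derivative[OF X3, of t u "(f, g, h, H, K)"]
        has_derivative_fst[OF has_derivative_snd[OF has_derivative_ident]]] by (simp add: p' X1_def)
  have 2: "((\<lambda>p. deriv X (fst (snd (fst p))) * fst (snd (snd p))) has_derivative
      (\<lambda>v. X1 * fst (snd (snd v)) + X2 * fst (snd (fst v)) * g)) (at p)"
    using has_derivative_mult[OF x_component_has_derivative[OF X2, of t u "(f, g, h, H, K)"]
        has_derivative_fst[OF has_derivative_snd[OF has_derivative_snd[OF has_derivative_ident]]]] by (simp add: p' X1_def)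
  have "(T0 has_derivative L) (at p)"
    unfolding T0_def L_def
    by (intro has_derivative_Pair has_derivative_mult_right[OF 1] has_derivative_mult_right[OF 2] dx[folded p'])
      (auto intro!: derivative_eq_intros)
  then have TL: "(T has_derivative L) (at p)"
    by (rule has_derivative_transform_within_open[OF _ open_D p]) (simp add: T_eq)
  have lin: "linear L"
    using TL by (rule has_derivative_linear)
  have "inj L"
    unfolding linear_injective_0[OF lin]
  proof (intro allI impI)
    fix v assume "L v = 0"
    then show "v = 0"
      using nonzero X1 by (auto simp: L_def zero_prod_def prod_eq_iff)
  qed
  then have "bij L"
    using linear_injective_imp_surjective[OF lin] by (simp add: bij_def)
  then show ?thesis
    using frechet_derivative_at[OF TL] by simp
qed

definition \<Phi> :: "txu \<Rightarrow> txu" where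
  "\<Phi> z = (\<delta>1 * fst z + \<delta>2, X (fst (snd z)), \<delta>3 * snd (snd z) + \<delta>4)"

lemma \<Phi>_images: "(\<lambda>(t, x, u). x) ` \<Phi> ` (It \<times> Ix \<times> Iu) = X ` Ix"
  "(\<lambda>(t, x, u). u) ` \<Phi> ` (It \<times> Ix \<times> Iu) = (\<lambda>u. \<delta>3 * u + \<delta>4) ` Iu"
  using intervals_open(4-6) by (force simp: \<Phi>_def image_iff)+

definition "V v = (v - \<delta>4) / \<delta>3"

lemma V_inverse [simp]: "V (\<delta>3 * u + \<delta>4) = u"
  using nonzero by (simp add: V_def)

lemma new_u_range: "(\<lambda>u. \<delta>3 * u + \<delta>4) ` Iu = V -` Iu"
proof -
  have "v = \<delta>3 * V v + \<delta>4" for v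
    using nonzero by (simp add: V_def)
  then have "v \<in> (\<lambda>u. \<delta>3 * u + \<delta>4) ` Iu" if "V v \<in> Iu" for v
    using that by blast
  then show ?thesis
    by auto
qed

lemma open_new_u_range: "open (V -` Iu)"
  unfolding V_def by (intro open_vimage intervals_open continuous_intros) (simp add: nonzero)

lemma smooth_new_u_function:
  fixes F :: "real \<Rightarrow> real"
  assumes "smooth_on Iu F"
  shows "smooth_on (V -` Iu) (\<lambda>v. c * F (V v))"
proof -
  have "smooth_on (V -` Iu) V"
    unfolding V_def[abs_def] by (rule smooth_on_divide) (auto intro!: smooth_on_intros open_new_u_range[unfolded V_def[abs_def]] simp: nonzero)
  then have "smooth_on (V -` Iu) (\<lambda>v. F (V v))"
    by (rule smooth_on_compose[OF assms _ intervals_open(3) open_new_u_range]) auto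
  then show ?thesis
    using smooth_on_mult[of "V -` Iu" "\<lambda>_. c" "\<lambda>v. F (V v)"] smooth_on_const[OF open_new_u_range] open_new_u_range
    by blast
qed

lemma deriv_new_u_function:
  fixes F :: "real \<Rightarrow> real"
  assumes "smooth_on Iu F" "u \<in> Iu"
  shows "deriv (\<lambda>v. c * F (V v)) (\<delta>3 * u + \<delta>4) = c * deriv F u / \<delta>3"
proof -
  have "(V has_real_derivative 1 / \<delta>3) (at (\<delta>3 * u + \<delta>4))"
    unfolding V_def[abs_def] using nonzero by (auto intro!: derivative_eq_intros)
  moreover have "(F has_real_derivative deriv F u) (at (V (\<delta>3 * u + \<delta>4)))"
    using smooth_on_DERIV[OF assms] by simp
  ultimately have "((\<lambda>v. F (V v)) has_real_derivative deriv F u * (1 / \<delta>3)) (at (\<delta>3 * u + \<delta>4))"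
    by (rule DERIV_chain2[rotated])
  from DERIV_imp_deriv[OF DERIV_cmult[OF this, of c]] show ?thesis
    by simp
qed

text \<open>The equation for \<open>w'\<close> is that for \<open>w\<close> multiplied by \<open>\<epsilon>1 \<delta>3 / X\<^sub>x\<close>.\<close>

lemma transforms:
  assumes adm: "admissible Ix Iu (f, g, h, H, K)"
    and Y: "open (X ` Ix)" "\<And>x. x \<in> Ix \<Longrightarrow> Y (X x) = x"
      "\<And>x. x \<in> Ix \<Longrightarrow> (Y has_real_derivative inverse (deriv X x)) (at (X x))"
  shows "transforms_equation (It \<times> Ix \<times> Iu) \<Phi> (f, g, h, H, K)
    (\<lambda>y. \<epsilon>1 * \<delta>1\<^sup>2 / deriv X (Y y) * f (Y y), \<lambda>y. \<epsilon>1 * inverse \<epsilon>2 * deriv X (Y y) * g (Y y),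
      \<lambda>y. \<epsilon>1 * inverse \<epsilon>3 * h (Y y), \<lambda>v. \<epsilon>2 * H (V v), \<lambda>v. \<epsilon>3 * K (V v))"
    (is "transforms_equation ?B \<Phi> ?\<theta> (?f, ?g, ?h, ?H, ?K)")
proof -
  have main: "equation_holds ?\<theta> w (t, x) \<longleftrightarrow> equation_holds (?f, ?g, ?h, ?H, ?K) w' (\<delta>1 * t + \<delta>2, X x)"
    if W: "open W" "smooth_on W w" "graph_on W w \<subseteq> ?B" "open W'"
      and gr: "\<Phi> ` graph_on W w = graph_on W' w'" and tx: "(t, x) \<in> W" for W w W' w' t x
  proof -
    define S where "S t' = (t' - \<delta>2) / \<delta>1" for t'
    have S: "S (\<delta>1 * t + \<delta>2) = t" for t
      using nonzero by (simp add: S_def)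
    have dS: "(S has_real_derivative 1 / \<delta>1) (at t')" for t'
      unfolding S_def[abs_def] using nonzero by (auto intro!: derivative_eq_intros)
    have in_B: "t \<in> It" "x \<in> Ix" "w (t, x) \<in> Iu" if "(t, x) \<in> W" for t x
      using subsetD[OF W(3), of "(t, x, w (t, x))"] that by (simp_all add: graph_on_iff)
    have forward: "(\<delta>1 * t + \<delta>2, X x) \<in> W' \<and> w' (\<delta>1 * t + \<delta>2, X x) = \<delta>3 * w (t, x) + \<delta>4" if "(t, x) \<in> W" for t x
    proof -
      have "(t, x, w (t, x)) \<in> graph_on W w"
        using that by (simp add: graph_on_iff)
      from imageI[OF this, of \<Phi>] have "(\<delta>1 * t + \<delta>2, X x, \<delta>3 * w (t, x) + \<delta>4) \<in> graph_on W' w'"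
        unfolding gr by (simp add: \<Phi>_def)
      then show ?thesis
        by (simp add: graph_on_iff)
    qed
    \<comment> \<open>Every point of the new graph comes from the old one, so w' is \<delta>3 w(S
      t', Y y) + \<delta>4 on all of W'. The derivatives of w' are computed from this
      formula.\<close>
    have backward: "(S t', Y y) \<in> W \<and> Y y \<in> Ix \<and> X (Y y) = y \<and> w' (t', y) = \<delta>3 * w (S t', Y y) + \<delta>4"
      if "(t', y) \<in> W'" for t' y
    proof -
      have "(t', y, w' (t', y)) \<in> graph_on W' w'"
        using that by (simp add: graph_on_iff)
      then have "(t', y, w' (t', y)) \<in> \<Phi> ` graph_on W w"
        unfolding gr .
      then obtain t x where "(t, x) \<in> W" "t' = \<delta>1 * t + \<delta>2" "y = X x" "w' (t', y) = \<delta>3 * w (t, x) + \<delta>4"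
        by (elim imageE) (auto simp: graph_on_iff \<Phi>_def)
      then show ?thesis
        using in_B Y(2) by (auto simp: S)
    qed
    define t' y where "t' = \<delta>1 * t + \<delta>2" and "y = X x"
    have W': "(t', y) \<in> W'"
      using forward[OF tx] by (simp add: t'_def y_def)
    have x: "x \<in> Ix" and Sy: "S t' = t" "Y y = x"
      using in_B(2)[OF tx] by (simp_all add: t'_def y_def S Y(2))
    have o: "open ((\<lambda>s. (s, z)) -` W')" "open ((\<lambda>z. (s, z)) -` W')" for s z
      by (intro open_vimage W continuous_intros)+
    have w't: "deriv (\<lambda>r. w' (r, z)) s = \<delta>3 / \<delta>1 * deriv (\<lambda>r. w (r, Y z)) (S s)" if "(s, z) \<in> W'" for s z
    proof -
      have "((\<lambda>r. w (r, Y z)) has_real_derivative dd (1, 0) w (S s, Y z)) (at (S s))"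
        using smooth_on_partial(1)[OF W(2,1)] backward[OF that] by blast
      then have D: "((\<lambda>r. w (r, Y z)) has_real_derivative deriv (\<lambda>r. w (r, Y z)) (S s)) (at (S s))"
        using DERIV_imp_deriv by metis
      have "((\<lambda>r. \<delta>3 * w (S r, Y z) + \<delta>4) has_real_derivative \<delta>3 * (deriv (\<lambda>r. w (r, Y z)) (S s) * (1 / \<delta>1)) + 0) (at s)"
        by (intro DERIV_add DERIV_cmult DERIV_const DERIV_chain2[OF D dS])
      then have "((\<lambda>r. w' (r, z)) has_real_derivative \<delta>3 * (deriv (\<lambda>r. w (r, Y z)) (S s) * (1 / \<delta>1)) + 0) (at s)"
        by (rule has_field_derivative_transform_within_open[OF _ o(1)]) (use that backward in auto)
      from DERIV_imp_deriv[OF this] show ?thesis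
        by simp
    qed
    have w'x: "deriv (\<lambda>r. w' (s, r)) z = \<delta>3 * deriv (\<lambda>r. w (S s, r)) (Y z) * inverse (deriv X (Y z))"
      if "(s, z) \<in> W'" for s z
    proof -
      note b = backward[OF that]
      have "((\<lambda>r. w (S s, r)) has_real_derivative dd (0, 1) w (S s, Y z)) (at (Y z))"
        using smooth_on_partial(2)[OF W(2,1)] b by blast
      then have D: "((\<lambda>r. w (S s, r)) has_real_derivative deriv (\<lambda>r. w (S s, r)) (Y z)) (at (Y z))"
        using DERIV_imp_deriv by metis
      have dY: "(Y has_real_derivative inverse (deriv X (Y z))) (at z)"
        using Y(3)[of "Y z"] b by simp
      have "((\<lambda>r. \<delta>3 * w (S s, Y r) + \<delta>4) has_real_derivative
          \<delta>3 * (deriv (\<lambda>r. w (S s, r)) (Y z) * inverse (deriv X (Y z))) + 0) (at z)"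
        by (intro DERIV_add DERIV_cmult DERIV_const DERIV_chain2[OF D dY])
      then have "((\<lambda>r. w' (s, r)) has_real_derivative
          \<delta>3 * (deriv (\<lambda>r. w (S s, r)) (Y z) * inverse (deriv X (Y z))) + 0) (at z)"
        by (rule has_field_derivative_transform_within_open[OF _ o(2)]) (use that backward in auto)
      from DERIV_imp_deriv[OF this] show ?thesis
        by simp
    qed
    have tt: "deriv (\<lambda>s. deriv (\<lambda>r. w' (r, y)) s) t' = \<delta>3 / \<delta>1\<^sup>2 * deriv (\<lambda>s. deriv (\<lambda>r. w (r, x)) s) t"
    proof -
      note D0 = smooth_on_second_partial(1)[OF W(2,1) tx]
      have D: "((\<lambda>s. deriv (\<lambda>r. w (r, x)) s) has_real_derivative deriv (\<lambda>s. deriv (\<lambda>r. w (r, x)) s) t) (at (S t'))"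
        unfolding Sy DERIV_imp_deriv[OF D0] by (rule D0)
      have "((\<lambda>s. \<delta>3 / \<delta>1 * deriv (\<lambda>r. w (r, x)) (S s)) has_real_derivative
          \<delta>3 / \<delta>1 * (deriv (\<lambda>s. deriv (\<lambda>r. w (r, x)) s) t * (1 / \<delta>1))) (at t')"
        by (intro DERIV_cmult DERIV_chain2[OF D dS])
      then have "((\<lambda>s. deriv (\<lambda>r. w' (r, y)) s) has_real_derivative
          \<delta>3 / \<delta>1 * (deriv (\<lambda>s. deriv (\<lambda>r. w (r, x)) s) t * (1 / \<delta>1))) (at t')"
      proof (rule has_field_derivative_transform_within_open[OF _ o(1)])
        show "\<delta>3 / \<delta>1 * deriv (\<lambda>r. w (r, x)) (S s) = deriv (\<lambda>r. w' (r, y)) s" if "s \<in> (\<lambda>s. (s, y)) -` W'" for s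
          using w't[of s y] that Sy(2) by simp
      qed (use W' in simp)
      from DERIV_imp_deriv[OF this] show ?thesis
        by (simp add: power2_eq_square)
    qed
    \<comment> \<open>The flux g H(w) w_x. In the new flux \<epsilon>2 and X_x cancel, which leaves
      \<open>\<epsilon>1 * \<delta>3 * G (Y z)\<close>.\<close>
    define G where "G z = g z * H (w (t, z)) * deriv (\<lambda>r. w (t, r)) z" for z
    have "(G has_real_derivative deriv G x) (at x)"
    proof -
      have "smooth_on Ix g" "smooth_on Iu H"
        using adm by auto
      then have "(g has_real_derivative deriv g x) (at x)" "(H has_real_derivative deriv H (w (t, x))) (at (w (t, x)))"
        using smooth_on_DERIV x in_B(3)[OF tx] by blast+
      note DG = DERIV_mult[OF DERIV_mult[OF this(1) DERIV_chain2[OF this(2) smooth_on_partial(2)[OF W(2,1) tx]]]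
          smooth_on_second_partial(2)[OF W(2,1) tx], folded G_def]
      show ?thesis
        unfolding DERIV_imp_deriv[OF DG] by (rule DG)
    qed
    then have "(G has_real_derivative deriv G x) (at (Y y))"
      unfolding Sy .
    moreover have "(Y has_real_derivative inverse (deriv X x)) (at y)"
      using Y(3)[OF x] by (simp add: y_def)
    ultimately have "((\<lambda>z. \<epsilon>1 * \<delta>3 * G (Y z)) has_real_derivative \<epsilon>1 * \<delta>3 * (deriv G x * inverse (deriv X x))) (at y)"
      by (intro DERIV_cmult DERIV_chain2)
    then have "((\<lambda>z. ?g z * ?H (w' (t', z)) * deriv (\<lambda>r. w' (t', r)) z) has_real_derivative
        \<epsilon>1 * \<delta>3 * (deriv G x * inverse (deriv X x))) (at y)"
    proof (rule has_field_derivative_transform_within_open[OF _ o(2)])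
      show "\<epsilon>1 * \<delta>3 * G (Y z) = ?g z * ?H (w' (t', z)) * deriv (\<lambda>r. w' (t', r)) z" if "z \<in> (\<lambda>z. (t', z)) -` W'" for z
      proof -
        have z: "(t', z) \<in> W'"
          using that by simp
        note b = backward[OF z]
        have "deriv X (Y z) \<noteq> 0"
          using X_deriv b by blast
        moreover have "V (w' (t', z)) = w (t, Y z)"
          using b by (simp add: Sy)
        ultimately show ?thesis
          unfolding w'x[OF z] G_def Sy using nonzero by (simp add: field_simps)
      qed
    qed (use W' in simp)
    from DERIV_imp_deriv[OF this] have xx: "deriv (\<lambda>z. ?g z * ?H (w' (t', z)) * deriv (\<lambda>r. w' (t', r)) z) y =
        \<epsilon>1 * \<delta>3 * (deriv G x * inverse (deriv X x))" .
    have X1: "deriv X x \<noteq> 0"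
      by (rule X_deriv[OF x])
    have u': "w' (t', y) = \<delta>3 * w (t, x) + \<delta>4"
      using backward[OF W'] by (simp add: Sy)
    define c where "c = \<epsilon>1 * \<delta>3 * inverse (deriv X x)"
    have c: "c \<noteq> 0"
      using nonzero X1 by (simp add: c_def)
    have lhs: "?f y * deriv (\<lambda>s. deriv (\<lambda>r. w' (r, y)) s) t' = c * (f x * deriv (\<lambda>s. deriv (\<lambda>r. w (r, x)) s) t)"
      unfolding tt Sy c_def using nonzero by (simp add: divide_inverse)
    have rhs: "\<epsilon>1 * \<delta>3 * (deriv G x * inverse (deriv X x)) + ?h y * ?K (w' (t', y)) * deriv (\<lambda>r. w' (t', r)) y
        = c * (deriv G x + h x * K (w (t, x)) * deriv (\<lambda>r. w (t, r)) x)"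
      unfolding w'x[OF W'] u' V_inverse Sy c_def using nonzero X1 by (simp add: field_simps)
    have "equation_holds (?f, ?g, ?h, ?H, ?K) w' (t', y) \<longleftrightarrow>
        c * (f x * deriv (\<lambda>s. deriv (\<lambda>r. w (r, x)) s) t) = c * (deriv G x + h x * K (w (t, x)) * deriv (\<lambda>r. w (t, r)) x)"
      unfolding equation_holds.simps xx lhs rhs ..
    also have "\<dots> \<longleftrightarrow> equation_holds ?\<theta> w (t, x)"
      using c by (simp add: G_def[abs_def])
    finally show ?thesis
      by (simp add: t'_def y_def)
  qed
  show ?thesis
    unfolding transforms_equation_def
  proof (intro allI impI ballI, elim conjE, clarify)
    fix W w W' w' t x t' x' u'
    assume "open W" "smooth_on W w" "graph_on W w \<subseteq> ?B" "open W'" "\<Phi> ` graph_on W w = graph_on W' w'" "(t, x) \<in> W"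
      and "\<Phi> (t, x, w (t, x)) = (t', x', u')"
    then show "equation_holds ?\<theta> w (t, x) \<longleftrightarrow> equation_holds (?f, ?g, ?h, ?H, ?K) w' (t', x')"
      using main[of W w W' w' t x] by (simp add: \<Phi>_def)
  qed
qed

lemma mem_usual_equivalence_group: "T \<in> usual_equivalence_group It Ix Iu"
proof -
  let ?B = "It \<times> Ix \<times> Iu"
  have I: "is_interval Ix"
    using intervals(2) by (simp add: open_interval_def)
  obtain Y where Y: "open (X ` Ix)" "\<And>x. x \<in> Ix \<Longrightarrow> Y (X x) = x" "smooth_on (X ` Ix) Y"
    "\<And>x. x \<in> Ix \<Longrightarrow> (Y has_real_derivative inverse (deriv X x)) (at (X x))"
    by (rule smooth_inverse_real[OF X_smooth intervals_open(2) I X_deriv]) auto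
  have sm_Y: "smooth_on (X ` Ix) (\<lambda>y. F (Y y))" if "smooth_on Ix F" for F :: "real \<Rightarrow> real"
    using Y(2) by (intro smooth_on_compose[OF that Y(3) intervals_open(2) Y(1)]) auto
  have elements: "\<exists>\<theta>'. admissible (X ` Ix) ((\<lambda>u. \<delta>3 * u + \<delta>4) ` Iu) \<theta>' \<and>
      (\<forall>z\<in>?B. snd (T (z, vals_at \<theta> z)) = vals_at \<theta>' (\<Phi> z)) \<and> transforms_equation ?B \<Phi> \<theta> \<theta>'"
    if adm: "admissible Ix Iu \<theta>" for \<theta>
  proof -
    obtain f g h H K where \<theta>: "\<theta> = (f, g, h, H, K)"
      by (cases \<theta>)
    have sm: "smooth_on Ix f" "smooth_on Ix g" "smooth_on Ix h" "smooth_on Iu H" "smooth_on Iu K"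
      and nz: "\<And>x u. x \<in> Ix \<Longrightarrow> u \<in> Iu \<Longrightarrow> f x * g x * H u \<noteq> 0"
      and nc: "\<exists>u\<in>Iu. (deriv H u, deriv K u) \<noteq> (0, 0)"
      using adm by (auto simp: \<theta>)
    define f' g' h' H' K' where "f' y = \<epsilon>1 * \<delta>1\<^sup>2 / deriv X (Y y) * f (Y y)"
      and "g' y = \<epsilon>1 * inverse \<epsilon>2 * deriv X (Y y) * g (Y y)" and "h' y = \<epsilon>1 * inverse \<epsilon>3 * h (Y y)"
      and "H' v = \<epsilon>2 * H (V v)" and "K' v = \<epsilon>3 * K (V v)" for y v
    have smX: "smooth_on Ix (deriv X)"
      by (rule smooth_on_deriv[OF X_smooth intervals_open(2)])
    have "deriv X (Y y) \<noteq> 0" if "y \<in> X ` Ix" for y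
      using that Y(2) X_deriv by auto
    then have "smooth_on (X ` Ix) f'" "smooth_on (X ` Ix) g'" "smooth_on (X ` Ix) h'"
      unfolding f'_def g'_def h'_def
      by (intro smooth_on_mult smooth_on_divide smooth_on_const sm_Y sm smX Y(1); simp)+
    moreover have "smooth_on ((\<lambda>u. \<delta>3 * u + \<delta>4) ` Iu) H'" "smooth_on ((\<lambda>u. \<delta>3 * u + \<delta>4) ` Iu) K'"
      unfolding H'_def K'_def new_u_range by (intro smooth_new_u_function sm)+
    moreover have "f' y * g' y * H' v \<noteq> 0" if "y \<in> X ` Ix" "v \<in> (\<lambda>u. \<delta>3 * u + \<delta>4) ` Iu" for y v
      using that nz X_deriv nonzero by (auto simp: f'_def g'_def H'_def Y(2))
    moreover have "\<exists>v\<in>(\<lambda>u. \<delta>3 * u + \<delta>4) ` Iu. (deriv H' v, deriv K' v) \<noteq> (0, 0)"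
    proof -
      obtain u where u: "u \<in> Iu" "(deriv H u, deriv K u) \<noteq> (0, 0)"
        using nc by blast
      have "deriv H' (\<delta>3 * u + \<delta>4) = \<epsilon>2 * deriv H u / \<delta>3" "deriv K' (\<delta>3 * u + \<delta>4) = \<epsilon>3 * deriv K u / \<delta>3"
        unfolding H'_def K'_def by (intro deriv_new_u_function sm u)+
      then show ?thesis
        using u nonzero by (intro bexI[of _ "\<delta>3 * u + \<delta>4"]) auto
    qed
    ultimately have "admissible (X ` Ix) ((\<lambda>u. \<delta>3 * u + \<delta>4) ` Iu) (f', g', h', H', K')"
      unfolding admissible.simps by blast
    moreover have "snd (T ((t, x, u), vals_at \<theta> (t, x, u))) = vals_at (f', g', h', H', K') (\<Phi> (t, x, u))"
      if "t \<in> It" "x \<in> Ix" "u \<in> Iu" for t x u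
      using that by (simp add: \<theta> T \<Phi>_def f'_def g'_def h'_def H'_def K'_def Y(2))
    moreover have "transforms_equation ?B \<Phi> \<theta> (f', g', h', H', K')"
      using transforms[OF adm[unfolded \<theta>] Y(1,2,4)] unfolding \<theta> f'_def[abs_def] g'_def[abs_def] h'_def[abs_def]
        H'_def[abs_def] K'_def[abs_def] by simp
    ultimately show ?thesis
      by (intro exI[of _ "(f', g', h', H', K')"]) auto
  qed
  have "\<forall>z\<in>?B. \<forall>a. fst (T (z, a)) = \<Phi> z"
    using T by (auto simp: \<Phi>_def)
  then show ?thesis
    unfolding usual_equivalence_group_def Let_def mem_Collect_eq D_def[symmetric]
    using T_smooth T_bij elements \<Phi>_images by (intro conjI exI[of _ \<Phi>]) auto
qed

end

theorem theorem1:
  fixes It Ix Iu :: "real set"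
  assumes "open_interval It" and "open_interval Ix" and "open_interval Iu"
  shows "usual_equivalence_group It Ix Iu =
    {T. \<exists>\<delta>1 \<delta>2 \<delta>3 \<delta>4 \<epsilon>1 \<epsilon>2 \<epsilon>3 :: real. \<exists>X :: real \<Rightarrow> real.
      \<delta>1 * \<delta>3 * \<epsilon>1 * \<epsilon>2 * \<epsilon>3 \<noteq> 0 \<and>
      smooth_on Ix X \<and> (\<forall>x\<in>Ix. deriv X x \<noteq> 0) \<and>
      (\<forall>t\<in>It. \<forall>x\<in>Ix. \<forall>u\<in>Iu. \<forall>f g h H K.
        T ((t, x, u), (f, g, h, H, K)) =
          ((\<delta>1 * t + \<delta>2, X x, \<delta>3 * u + \<delta>4),
           (\<epsilon>1 * \<delta>1\<^sup>2 / deriv X x * f,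
            \<epsilon>1 * inverse \<epsilon>2 * deriv X x * g,
            \<epsilon>1 * inverse \<epsilon>3 * h,
            \<epsilon>2 * H,
            \<epsilon>3 * K)))}"
  unfolding normal_form_def[symmetric]
proof (rule set_eqI, unfold mem_Collect_eq, rule iffI)
  fix T
  assume "T \<in> usual_equivalence_group It Ix Iu"
  then show "normal_form It Ix Iu T"
    by (rule usual_equivalence_group_normal_form[OF assms])
next
  fix T
  assume "normal_form It Ix Iu T"
  then obtain \<delta>1 \<delta>2 \<delta>3 \<delta>4 \<epsilon>1 \<epsilon>2 \<epsilon>3 X where
    "\<delta>1 * \<delta>3 * \<epsilon>1 * \<epsilon>2 * \<epsilon>3 \<noteq> 0" "smooth_on Ix X" "\<forall>x\<in>Ix. deriv X x \<noteq> 0"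
    "\<forall>t\<in>It. \<forall>x\<in>Ix. \<forall>u\<in>Iu. \<forall>f g h H K.
        T ((t, x, u), (f, g, h, H, K)) =
          ((\<delta>1 * t + \<delta>2, X x, \<delta>3 * u + \<delta>4),
           (\<epsilon>1 * \<delta>1\<^sup>2 / deriv X x * f, \<epsilon>1 * inverse \<epsilon>2 * deriv X x * g, \<epsilon>1 * inverse \<epsilon>3 * h,
            \<epsilon>2 * H, \<epsilon>3 * K))"
    unfolding normal_form_def by blast
  then interpret normal_form_transformation It Ix Iu T \<delta>1 \<delta>2 \<delta>3 \<delta>4 \<epsilon>1 \<epsilon>2 \<epsilon>3 X
    using assms by unfold_locales simp_all
  show "T \<in> usual_equivalence_group It Ix Iu"
    by (rule mem_usual_equivalence_group)
qed

end
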